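(* Let $G$ be a countable group and $H\leq G$ a subgroup such that $H$ is a non-elementary hyperbolic group and $[H:H\cap gHg^{-1}]<\infty$ for all $g\in G$. Suppose that the action $H\curvearrowright\partial H$ of $H$ on its Gromov boundary is topologically free and that $s\notin C_G(H\cap s^{-1}Hs)$ for all $s\in G\setminus\{1\}$. Then there is an action $G\curvearrowright\partial H$ by homeomorphisms that is topologically free and extends the action $H\curvearrowright\partial H$.
   Context: A finitely generated group $H$ is (Gromov) hyperbolic if its word metric with respect to some finite generating set is Gromov hyperbolic; it is non-elementary if it is infinite and not virtually cyclic. Its Gromov boundary $\partial H$ is the set of equivalence classes of geodesic rays, where two rays are identified if they stay a bounded (Hausdorff) distance apart, with its usual compact metrizable topology. A quasi-isometry $\varphi:K\to H$ induces a homeomorphism $\partial\varphi:\partial K\to\partial H$. The action $H\curvearrowright\partial H$ sends $h\in H$ to the boundary homeomorphism induced by conjugation $x\mapsto hxh^{-1}$; this coincides with the homeomorphism induced by left multiplication by $h$. An action of a countable group $\Gamma$ by homeomorphisms on a compact Hausdorff space $X$ is topologically free if for every $g\in\Gamma\setminus\{1\}$ the fixed-point set $\{x\in X: gx=x\}$ has empty interior (equivalently, for countable $\Gamma$, the set of points with trivial stabilizer is dense in $X$). For a subset $S$ of a group $G$, $C_G(S)$ denotes the centralizer of $S$ in $G$. *)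

theory Defs
  imports "HOL-Analysis.Analysis" "HOL-Algebra.Group_Action" "HOL-Algebra.Generated_Groups"
begin

definition Gromov_product :: "('a \<Rightarrow> 'a \<Rightarrow> real) \<Rightarrow> 'a \<Rightarrow> 'a \<Rightarrow> 'a \<Rightarrow> real" where
  "Gromov_product d w x y = (d w x + d w y - d x y) / 2"

definition Gromov_hyperbolic :: "'a set \<Rightarrow> ('a \<Rightarrow> 'a \<Rightarrow> real) \<Rightarrow> bool" where
  "Gromov_hyperbolic M d \<longleftrightarrow>
     (\<exists>\<delta>. \<forall>w\<in>M. \<forall>x\<in>M. \<forall>y\<in>M. \<forall>z\<in>M.
        Gromov_product d w x z \<ge> min (Gromov_product d w x y) (Gromov_product d w y z) - \<delta>)"

text \<open>
  Rays are parametrised by the natural numbers. For a word metric on a group these are exactly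
  the vertex sequences of the geodesic rays in the Cayley graph that start at a vertex; every
  geodesic ray in the Cayley graph stays at bounded distance from one of them.
\<close>

definition geodesic_rays :: "'a set \<Rightarrow> ('a \<Rightarrow> 'a \<Rightarrow> real) \<Rightarrow> (nat \<Rightarrow> 'a) set" where
  "geodesic_rays M d = {\<gamma>. range \<gamma> \<subseteq> M \<and> (\<forall>m n. d (\<gamma> m) (\<gamma> n) = \<bar>real m - real n\<bar>)}"

definition finite_Hausdorff_dist :: "('a \<Rightarrow> 'a \<Rightarrow> real) \<Rightarrow> 'a set \<Rightarrow> 'a set \<Rightarrow> bool" where
  "finite_Hausdorff_dist d A B \<longleftrightarrow>
     (\<exists>C. (\<forall>a\<in>A. \<exists>b\<in>B. d a b \<le> C) \<and> (\<forall>b\<in>B. \<exists>a\<in>A. d a b \<le> C))"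

definition asymptotic :: "'a set \<Rightarrow> ('a \<Rightarrow> 'a \<Rightarrow> real) \<Rightarrow> ((nat \<Rightarrow> 'a) \<times> (nat \<Rightarrow> 'a)) set" where
  "asymptotic M d = {(\<gamma>, \<gamma>') \<in> geodesic_rays M d \<times> geodesic_rays M d.
     finite_Hausdorff_dist d (range \<gamma>) (range \<gamma>')}"

definition Gromov_boundary :: "'a set \<Rightarrow> ('a \<Rightarrow> 'a \<Rightarrow> real) \<Rightarrow> (nat \<Rightarrow> 'a) set set" where
  "Gromov_boundary M d = geodesic_rays M d // asymptotic M d"

definition ray_topology :: "'a set \<Rightarrow> ('a \<Rightarrow> 'a \<Rightarrow> real) \<Rightarrow> (nat \<Rightarrow> 'a) topology" where
  "ray_topology M d =
     subtopology (product_topology (\<lambda>_. discrete_topology M) UNIV) (geodesic_rays M d)"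

text \<open>
  The topology of the boundary is the quotient of the topology of pointwise convergence on
  geodesic rays (which, for uniformly discrete spaces such as groups with a word metric, is
  uniform convergence on compact sets). The rays need not start at a common base point: the set of
  rays starting at a given point is clopen, and the quotient topology that it induces on the
  boundary of a proper geodesic hyperbolic space does not depend on the point, so all of them
  together induce the same topology as those issuing from one base point.
\<close>

definition boundary_topology :: "'a set \<Rightarrow> ('a \<Rightarrow> 'a \<Rightarrow> real) \<Rightarrow> (nat \<Rightarrow> 'a) set topology" where
  "boundary_topology M d = topology (\<lambda>U. U \<subseteq> Gromov_boundary M d \<and>
     openin (ray_topology M d) {\<gamma> \<in> geodesic_rays M d. asymptotic M d `` {\<gamma>} \<in> U})"

lemma topspace_ray_topology: "topspace (ray_topology M d) = geodesic_rays M d"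
  by (auto simp: ray_topology_def geodesic_rays_def)

lemma openin_boundary_topology:
  "openin (boundary_topology M d) U \<longleftrightarrow> U \<subseteq> Gromov_boundary M d \<and>
     openin (ray_topology M d) {\<gamma> \<in> geodesic_rays M d. asymptotic M d `` {\<gamma>} \<in> U}"
proof -
  let ?P = "\<lambda>U. {\<gamma> \<in> geodesic_rays M d. asymptotic M d `` {\<gamma>} \<in> U}"
  have "?P (S \<inter> T) = ?P S \<inter> ?P T" for S T by auto
  moreover have "?P (\<Union>\<K>) = \<Union>(?P ` \<K>)" for \<K> by auto
  ultimately have "istopology (\<lambda>U. U \<subseteq> Gromov_boundary M d \<and> openin (ray_topology M d) (?P U))"
    unfolding istopology_def by (auto intro!: openin_Int openin_Union simp del: Union_iff)
  then show ?thesis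
    by (simp add: boundary_topology_def topology_inverse')
qed

lemma topspace_boundary_topology: "topspace (boundary_topology M d) = Gromov_boundary M d"
proof -
  have "{\<gamma> \<in> geodesic_rays M d. asymptotic M d `` {\<gamma>} \<in> Gromov_boundary M d}
      = topspace (ray_topology M d)"
    by (auto simp: Gromov_boundary_def topspace_ray_topology intro: quotientI)
  then have "openin (boundary_topology M d) (Gromov_boundary M d)"
    by (simp only: openin_boundary_topology openin_topspace order_refl)
  then show ?thesis
    unfolding topspace_def openin_boundary_topology by blast
qed

lemma quotient_map_boundary:
  "quotient_map (ray_topology M d) (boundary_topology M d) (\<lambda>\<gamma>. asymptotic M d `` {\<gamma>})"
  unfolding quotient_map_def topspace_ray_topology topspace_boundary_topology
    openin_boundary_topology
  by (auto simp: Gromov_boundary_def quotient_def)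

text \<open>
  If \<^term>\<open>\<phi>\<close> is a quasi-isometry into the hyperbolic space \<^term>\<open>(M, d)\<close>, this map sends the class
  of a ray \<^term>\<open>\<gamma>\<close> to the class of the geodesic rays at finite Hausdorff distance from
  \<^term>\<open>\<phi> \<circ> \<gamma>\<close>.
\<close>

definition boundary_map ::
  "'b set \<Rightarrow> ('b \<Rightarrow> 'b \<Rightarrow> real) \<Rightarrow> ('a \<Rightarrow> 'b) \<Rightarrow> (nat \<Rightarrow> 'a) set \<Rightarrow> (nat \<Rightarrow> 'b) set" where
  "boundary_map M d \<phi> \<xi> =
     {\<gamma>' \<in> geodesic_rays M d. \<exists>\<gamma>\<in>\<xi>. finite_Hausdorff_dist d (range (\<phi> \<circ> \<gamma>)) (range \<gamma>')}"

definition finite_generating_set :: "('a, 'b) monoid_scheme \<Rightarrow> 'a set \<Rightarrow> bool" where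
  "finite_generating_set K S \<longleftrightarrow> finite S \<and> S \<subseteq> carrier K \<and> generate K S = carrier K"

definition word_length :: "('a, 'b) monoid_scheme \<Rightarrow> 'a set \<Rightarrow> 'a \<Rightarrow> nat" where
  "word_length K S x = (LEAST n. \<exists>ws. length ws = n \<and> set ws \<subseteq> S \<union> m_inv K ` S \<and>
     foldr (mult K) ws \<one>\<^bsub>K\<^esub> = x)"

definition word_dist :: "('a, 'b) monoid_scheme \<Rightarrow> 'a set \<Rightarrow> 'a \<Rightarrow> 'a \<Rightarrow> real" where
  "word_dist K S x y = real (word_length K S (inv\<^bsub>K\<^esub> x \<otimes>\<^bsub>K\<^esub> y))"

definition hyperbolic_group :: "('a, 'b) monoid_scheme \<Rightarrow> bool" where
  "hyperbolic_group K \<longleftrightarrow> group K \<and>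
     (\<exists>S. finite_generating_set K S \<and> Gromov_hyperbolic (carrier K) (word_dist K S))"

definition finite_index :: "('a, 'b) monoid_scheme \<Rightarrow> 'a set \<Rightarrow> bool" where
  "finite_index K L \<longleftrightarrow> subgroup L K \<and> finite (rcosets\<^bsub>K\<^esub> L)"

definition virtually_cyclic :: "('a, 'b) monoid_scheme \<Rightarrow> bool" where
  "virtually_cyclic K \<longleftrightarrow> (\<exists>x\<in>carrier K. finite_index K (generate K {x}))"

definition non_elementary :: "('a, 'b) monoid_scheme \<Rightarrow> bool" where
  "non_elementary K \<longleftrightarrow> infinite (carrier K) \<and> \<not> virtually_cyclic K"

definition centralizer :: "('a, 'b) monoid_scheme \<Rightarrow> 'a set \<Rightarrow> 'a set" where
  "centralizer G S = {g \<in> carrier G. \<forall>s\<in>S. g \<otimes>\<^bsub>G\<^esub> s = s \<otimes>\<^bsub>G\<^esub> g}"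

text \<open>
  The boundary of a hyperbolic group depends on the finite generating set only up to canonical
  homeomorphism, so the generating set is kept as an explicit parameter.
\<close>

abbreviation group_boundary :: "('a, 'b) monoid_scheme \<Rightarrow> 'a set \<Rightarrow> (nat \<Rightarrow> 'a) set topology" where
  "group_boundary K S \<equiv> boundary_topology (carrier K) (word_dist K S)"

text \<open>
  Conjugation by \<^term>\<open>h\<close> and left multiplication by \<^term>\<open>h\<close> differ by a right multiplication,
  which moves points by a bounded distance in the word metric, so both induce the same map.
\<close>

definition boundary_action ::
  "('a, 'b) monoid_scheme \<Rightarrow> 'a set \<Rightarrow> 'a \<Rightarrow> (nat \<Rightarrow> 'a) set \<Rightarrow> (nat \<Rightarrow> 'a) set" where
  "boundary_action K S h = restrict
     (boundary_map (carrier K) (word_dist K S) (\<lambda>x. h \<otimes>\<^bsub>K\<^esub> x \<otimes>\<^bsub>K\<^esub> inv\<^bsub>K\<^esub> h))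
     (topspace (group_boundary K S))"

definition homeo_action ::
  "('a, 'c) monoid_scheme \<Rightarrow> 'b topology \<Rightarrow> ('a \<Rightarrow> 'b \<Rightarrow> 'b) \<Rightarrow> bool" where
  "homeo_action G X \<alpha> \<longleftrightarrow>
     group_action G (topspace X) \<alpha> \<and> (\<forall>g\<in>carrier G. homeomorphic_map X X (\<alpha> g))"

definition topologically_free ::
  "('a, 'c) monoid_scheme \<Rightarrow> 'b topology \<Rightarrow> ('a \<Rightarrow> 'b \<Rightarrow> 'b) \<Rightarrow> bool" where
  "topologically_free G X \<alpha> \<longleftrightarrow>
     (\<forall>g\<in>carrier G - {\<one>\<^bsub>G\<^esub>}. X interior_of (invariants (topspace X) \<alpha> g) = {})"

end

theory Submission
  imports Defs "HOL-Real_Asymp.Real_Asymp" "HOL-Library.Diagonal_Subsequence"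
begin

text \<open>
  Left multiplication by \<open>g\<close> maps \<open>H\<close> to \<open>g H\<close>, which by commensuration is at bounded distance
  from \<open>H\<close>. Moving points back by right multiplication with elements of a finite set gives a
  quasi-isometry of \<open>H\<close>, unique up to bounded distance and multiplicative in \<open>g\<close>, so \<open>G\<close> acts
  on the boundary. The Morse lemma makes the boundary maps well defined and continuous.

  For topological freeness let \<open>g\<close> fix a nonempty open set \<open>U\<close> pointwise, and let
  \<open>L = H \<inter> g\<^sup>-\<^sup>1 H g\<close>. If \<open>h \<in> L\<close> moves some point of \<open>U\<close> into \<open>U\<close>, then \<open>h\<close> and
  \<open>g h g\<^sup>-\<^sup>1\<close> agree on a nonempty open set, so \<open>g\<close> commutes with \<open>h\<close> by topological freeness of
  \<open>H\<close>. As \<open>L\<close> has finite index, there are \<open>h n \<in> L\<close> and a boundary point \<open>b\<close> such that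
  \<open>h n \<xi>\<close> is eventually in \<open>U\<close> for every \<open>\<xi> \<noteq> b\<close>. These \<open>h n\<close> eventually commute with
  \<open>g\<close>, so \<open>g\<close> fixes every \<open>\<xi> \<noteq> b\<close>, hence acts trivially, hence centralises \<open>L\<close>.
  (If \<open>U = {b}\<close>, the boundary has at most two points and \<open>b\<close> has trivial stabiliser in \<open>H\<close>,
  so \<open>H\<close> is finite.)
\<close>

section \<open>Stability of quasi-geodesics\<close>

text \<open>\<open>G\<close> is merely countable and may have no word metric, so only
  \<open>H\<close> carries a geometry. Bounded distance in \<open>G\<close> is therefore expressed
  by right multiplication with a finite set of elements; by left invariance of the word metric such
  factors become bounded distances once both points lie in \<open>H\<close>. An element
  \<open>g\<close> acts through a mere quasi-isometry, so the dynamics has to be produced by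
  elements of \<open>H\<close>, which act by isometries. They come from a ray
  \<open>\<gamma>\<close> whose class is in \<open>U\<close>: finite index gives
  \<open>\<gamma> n = h n t n\<close> with \<open>h n\<close> in \<open>L\<close> and
  \<open>t n\<close> in a finite set, so \<open>h n\<close> carries a bounded region along
  \<open>\<gamma>\<close>. The only obstruction to attraction is a limit \<open>b\<close> of the
  rays that the inverses of the \<open>h n\<close> make of \<open>\<gamma>\<close> run backwards.
  Membership of \<open>h\<close> in \<open>L\<close> matters because
  \<open>g h g\<^sup>-\<^sup>1\<close> has to lie in \<open>H\<close> before topological freeness of
  \<open>H\<close> can compare it with \<open>h\<close>.\<close>

definition quasi_geodesic ::
  "'a set \<Rightarrow> ('a \<Rightarrow> 'a \<Rightarrow> real) \<Rightarrow> real \<Rightarrow> nat \<Rightarrow> (nat \<Rightarrow> 'a) \<Rightarrow> bool" where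
  "quasi_geodesic M d \<kappa> n c \<longleftrightarrow> (\<forall>i\<le>n. c i \<in> M) \<and>
     (\<forall>i\<le>n. \<forall>j\<le>n. d (c i) (c j) \<le> \<kappa> * \<bar>real i - real j\<bar> \<and>
        \<bar>real i - real j\<bar> \<le> \<kappa> * (d (c i) (c j) + 1))"

definition geodesic_segment ::
  "'a set \<Rightarrow> ('a \<Rightarrow> 'a \<Rightarrow> real) \<Rightarrow> nat \<Rightarrow> (nat \<Rightarrow> 'a) \<Rightarrow> bool" where
  "geodesic_segment M d n \<sigma> \<longleftrightarrow> (\<forall>i\<le>n. \<sigma> i \<in> M) \<and>
     (\<forall>i\<le>n. \<forall>j\<le>n. d (\<sigma> i) (\<sigma> j) = \<bar>real i - real j\<bar>)"

text \<open>
  Unlike the four-point condition, this form of hyperbolicity is visibly a bi-Lipschitz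
  invariant, hence independent of the generating set of a group.
\<close>

definition stable_quasi_geodesics :: "'a set \<Rightarrow> ('a \<Rightarrow> 'a \<Rightarrow> real) \<Rightarrow> bool" where
  "stable_quasi_geodesics M d \<longleftrightarrow> (\<forall>\<kappa>. \<exists>D. \<forall>m n c c'.
     quasi_geodesic M d \<kappa> m c \<longrightarrow> quasi_geodesic M d \<kappa> n c' \<longrightarrow> c 0 = c' 0 \<longrightarrow> c m = c' n \<longrightarrow>
     (\<forall>i\<le>m. \<exists>j\<le>n. d (c i) (c' j) \<le> D))"

lemma Gromov_product_commute: "Gromov_product d w x y = Gromov_product d w y x"
  if "d x y = d y x"
  using that by (simp add: Gromov_product_def)

section \<open>Geodesics with integer parameters and the Morse lemma\<close>

locale integer_geodesic_space =
  fixes M :: "'a set" and d :: "'a \<Rightarrow> 'a \<Rightarrow> real"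
  assumes d_refl: "x \<in> M \<Longrightarrow> d x x = 0"
    and d_commute: "x \<in> M \<Longrightarrow> y \<in> M \<Longrightarrow> d x y = d y x"
    and d_triangle: "x \<in> M \<Longrightarrow> y \<in> M \<Longrightarrow> z \<in> M \<Longrightarrow> d x z \<le> d x y + d y z"
    and ex_geodesic: "x \<in> M \<Longrightarrow> y \<in> M \<Longrightarrow> \<exists>n \<sigma>. geodesic_segment M d n \<sigma> \<and> \<sigma> 0 = x \<and> \<sigma> n = y"
begin

lemma d_nonneg: "x \<in> M \<Longrightarrow> y \<in> M \<Longrightarrow> 0 \<le> d x y"
  using d_triangle[of x y x] d_refl[of x] d_commute[of x y] by simp

lemma d_nat:
  assumes "x \<in> M" "y \<in> M"
  obtains n where "d x y = real n"
proof -
  obtain n \<sigma> where "geodesic_segment M d n \<sigma>" "\<sigma> 0 = x" "\<sigma> n = y"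
    using ex_geodesic assms by blast
  then have "d x y = real n" unfolding geodesic_segment_def by force
  then show ?thesis using that by blast
qed

lemma quasi_geodesicD:
  assumes "quasi_geodesic M d \<kappa> n c" "i \<le> n" "j \<le> n"
  shows "c i \<in> M" "d (c i) (c j) \<le> \<kappa> * \<bar>real i - real j\<bar>"
    "\<bar>real i - real j\<bar> \<le> \<kappa> * (d (c i) (c j) + 1)"
  using assms unfolding quasi_geodesic_def by blast+

lemma geodesic_segmentD:
  assumes "geodesic_segment M d n \<sigma>" "i \<le> n" "j \<le> n"
  shows "\<sigma> i \<in> M" "d (\<sigma> i) (\<sigma> j) = \<bar>real i - real j\<bar>"
  using assms unfolding geodesic_segment_def by blast+

lemma quasi_geodesic_mono:
  assumes "quasi_geodesic M d \<kappa> n c" "\<kappa> \<le> \<mu>" "m \<le> n"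
  shows "quasi_geodesic M d \<mu> m c"
  unfolding quasi_geodesic_def
proof (intro conjI allI impI)
  fix i j assume ij: "i \<le> m" "j \<le> m"
  then have le: "i \<le> n" "j \<le> n" using assms by auto
  show "c i \<in> M" using quasi_geodesicD(1)[OF assms(1) le] .
  have "c i \<in> M" "c j \<in> M"
    using le assms(1) unfolding quasi_geodesic_def by blast+
  then have nn: "0 \<le> d (c i) (c j)" by (rule d_nonneg)
  note * = quasi_geodesicD[OF assms(1) le]
  have "\<kappa> * \<bar>real i - real j\<bar> \<le> \<mu> * \<bar>real i - real j\<bar>"
    "\<kappa> * (d (c i) (c j) + 1) \<le> \<mu> * (d (c i) (c j) + 1)"
    using assms(2) nn by (auto intro!: mult_right_mono)
  then show "d (c i) (c j) \<le> \<mu> * \<bar>real i - real j\<bar>"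
    "\<bar>real i - real j\<bar> \<le> \<mu> * (d (c i) (c j) + 1)" using * by linarith+
qed

lemma geodesic_imp_quasi_geodesic:
  assumes "geodesic_segment M d n \<sigma>" "1 \<le> \<kappa>"
  shows "quasi_geodesic M d \<kappa> n \<sigma>"
proof -
  have "quasi_geodesic M d 1 n \<sigma>"
    using assms(1) unfolding quasi_geodesic_def geodesic_segment_def by auto
  then show ?thesis using quasi_geodesic_mono assms(2) by blast
qed

text \<open>Bisecting the chain loses one \<open>\<delta>\<close> per halving, so
  \<open>2 ^ k\<close> steps cost only \<open>k * \<delta>\<close>. This logarithmic loss, against a
  path length that is linear in \<open>D\<close>, is what bounds \<open>D\<close> in the Morse
  lemma.\<close>

lemma Gromov_product_chain:
  assumes hyp: "\<And>w x y z. w \<in> M \<Longrightarrow> x \<in> M \<Longrightarrow> y \<in> M \<Longrightarrow> z \<in> M \<Longrightarrow>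
      Gromov_product d w x z \<ge> min (Gromov_product d w x y) (Gromov_product d w y z) - \<delta>"
    and "0 \<le> \<delta>" "w \<in> M"
  shows "\<lbrakk>\<And>i. i \<in> {a..a+m} \<Longrightarrow> c i \<in> M; 0 < m; m \<le> 2 ^ k;
      \<And>i. i \<in> {a..<a+m} \<Longrightarrow> r \<le> Gromov_product d w (c i) (c (Suc i))\<rbrakk>
    \<Longrightarrow> r - real k * \<delta> \<le> Gromov_product d w (c a) (c (a + m))"
proof (induction k arbitrary: a m)
  case 0
  then have "m = 1" by simp
  then show ?case using 0(4)[of a] by simp
next
  case (Suc k)
  show ?case
  proof (cases "m \<le> 2 ^ k")
    case True
    then have "r - real k * \<delta> \<le> Gromov_product d w (c a) (c (a + m))"
      using Suc by blast
    then show ?thesis using \<open>0 \<le> \<delta>\<close> by (simp add: algebra_simps)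
  next
    case False
    define b l where "b = a + 2 ^ k" and "l = m - 2 ^ k"
    have l: "0 < l" "l \<le> 2 ^ k" "b + l = a + m"
      using False Suc.prems(3) by (auto simp: b_def l_def)
    have "r - real k * \<delta> \<le> Gromov_product d w (c a) (c (a + 2 ^ k))"
      by (rule Suc.IH) (use Suc.prems False in auto)
    moreover have "r - real k * \<delta> \<le> Gromov_product d w (c b) (c (b + l))"
      by (rule Suc.IH) (use Suc.prems False l b_def in auto)
    moreover have "c a \<in> M" "c b \<in> M" "c (a+m) \<in> M"
      using Suc.prems(1) False by (auto simp: b_def)
    ultimately show ?thesis
      using hyp[of w "c a" "c b" "c (a+m)"] \<open>w \<in> M\<close> l(3)
      by (simp add: b_def algebra_simps)
  qed
qed

text \<open>
  The points \<open>y, c a, \<dots>, c b, z\<close> below all stay at distance about \<open>D\<close> from \<open>w\<close>, whereas the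
  Gromov product of \<open>y\<close> and \<open>z\<close> at \<open>w\<close> vanishes; bisecting the path loses only \<open>\<delta>\<close> per halving.
\<close>

lemma geodesic_near_quasi_geodesic:
  assumes hyp: "\<And>w x y z. w \<in> M \<Longrightarrow> x \<in> M \<Longrightarrow> y \<in> M \<Longrightarrow> z \<in> M \<Longrightarrow>
      Gromov_product d w x z \<ge> min (Gromov_product d w x y) (Gromov_product d w y z) - \<delta>"
    and \<delta>: "0 \<le> \<delta>"
    and c: "quasi_geodesic M d \<kappa> n c" and \<sigma>: "geodesic_segment M d m \<sigma>"
    and ends: "\<sigma> 0 = c 0" "\<sigma> m = c n"
    and far: "\<And>i. i \<le> n \<Longrightarrow> real D \<le> d (\<sigma> j0) (c i)" "j0 \<le> m"
    and near: "\<And>j. j \<le> m \<Longrightarrow> \<exists>i\<le>n. d (\<sigma> j) (c i) \<le> real D"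
    and \<kappa>: "1 \<le> \<kappa>"
    and k: "\<kappa> * (6 * real D + 1) \<le> 2 ^ k"
  shows "real D \<le> \<kappa> / 2 + (real k + 2) * \<delta>"
proof -
  define w where "w = \<sigma> j0"
  \<comment> \<open>Going \<open>2 * D\<close> along the geodesic makes the Gromov product of
    \<open>y\<close> with a point of \<open>c\<close> within \<open>D\<close> of it at least
    \<open>(2 * D + D - D) / 2 = D\<close>. If the geodesic is too short, truncated subtraction and
    \<open>min\<close> give its endpoint, which itself lies on \<open>c\<close>.\<close>
  define s t where "s = j0 - 2 * D" and "t = min m (j0 + 2 * D)"
  have st: "s \<le> j0" "j0 \<le> t" "s \<le> m" "t \<le> m" using far(2) by (auto simp: s_def t_def)
  define y z where "y = \<sigma> s" and "z = \<sigma> t"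
  have M: "w \<in> M" "y \<in> M" "z \<in> M"
    using geodesic_segmentD(1)[OF \<sigma>] st far(2) by (auto simp: w_def y_def z_def)
  have cM: "c i \<in> M" if "i \<le> n" for i using quasi_geodesicD(1)[OF c] that by blast
  have wy: "d w y = real j0 - real s" "d w z = real t - real j0" "d y z = real t - real s"
    using geodesic_segmentD(2)[OF \<sigma>] st far(2) by (auto simp: w_def y_def z_def)
  have wc: "real D \<le> d w (c i)" if "i \<le> n" for i using far(1)[OF that] by (simp add: w_def)
  have "\<exists>a\<le>n. d y (c a) \<le> real D \<and> real D \<le> Gromov_product d w y (c a)"
  proof (cases "j0 \<le> 2 * D")
    case True
    then have "y = c 0" using ends by (simp add: y_def s_def)
    then show ?thesis using wc[of 0] d_refl[of "c 0"] cM[of 0]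
      by (intro exI[of _ 0]) (simp add: Gromov_product_def)
  next
    case False
    obtain a where a: "a \<le> n" "d y (c a) \<le> real D" using near[of s] st by (auto simp: y_def)
    have "d w y = 2 * real D" using wy False by (simp add: s_def of_nat_diff)
    then show ?thesis using a wc[of a] by (intro exI[of _ a]) (simp add: Gromov_product_def)
  qed
  then obtain a where a: "a \<le> n" "d y (c a) \<le> real D" "real D \<le> Gromov_product d w y (c a)"
    by blast
  have "\<exists>b\<le>n. d z (c b) \<le> real D \<and> real D \<le> Gromov_product d w z (c b)"
  proof (cases "m \<le> j0 + 2 * D")
    case True
    then have "z = c n" using ends by (simp add: z_def t_def)
    then show ?thesis using wc[of n] d_refl[of "c n"] cM[of n]
      by (intro exI[of _ n]) (simp add: Gromov_product_def)
  next
    case False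
    obtain b where b: "b \<le> n" "d z (c b) \<le> real D" using near[of t] st by (auto simp: z_def)
    have "d w z = 2 * real D" using wy False by (simp add: t_def)
    then show ?thesis using b wc[of b] by (intro exI[of _ b]) (simp add: Gromov_product_def)
  qed
  then obtain b where b: "b \<le> n" "d z (c b) \<le> real D" "real D \<le> Gromov_product d w z (c b)"
    by blast
  have step: "real D - \<kappa> / 2 \<le> Gromov_product d w (c i) (c (Suc i))" if "Suc i \<le> n" for i
  proof -
    have "d (c i) (c (Suc i)) \<le> \<kappa>" using quasi_geodesicD(2)[OF c, of i "Suc i"] that by simp
    then show ?thesis using wc[of i] wc[of "Suc i"] that by (simp add: Gromov_product_def)
  qed
  have dyz: "d y z \<le> 4 * real D" using wy st by (simp add: s_def t_def min_def split: if_splits)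
  \<comment> \<open>The bound is \<open>D + 4 * D + D\<close>, the source of the factor 6 in the
    assumption on \<open>k\<close>.\<close>
  have "d (c a) (c b) \<le> d (c a) y + d y z + d z (c b)"
    using d_triangle[of "c a" y "c b"] d_triangle[of y z "c b"] M cM a b by force
  then have dab: "d (c a) (c b) \<le> 6 * real D" using a b dyz d_commute[of y "c a"] M cM by simp
  have "\<bar>real a - real b\<bar> \<le> \<kappa> * (d (c a) (c b) + 1)" using quasi_geodesicD(3)[OF c] a b by blast
  also have "\<dots> \<le> \<kappa> * (6 * real D + 1)" using dab \<kappa> by (intro mult_left_mono) auto
  also have "\<dots> \<le> 2 ^ k" by (rule k)
  finally have abk: "\<bar>real a - real b\<bar> \<le> real (2 ^ k)" by simp
  have mid: "real D - \<kappa> / 2 - real k * \<delta> \<le> Gromov_product d w (c i) (c (i + l))"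
    if "i + l \<le> n" "l \<le> 2 ^ k" for i l
  proof (cases "l = 0")
    case True
    have "0 \<le> real k * \<delta>" using \<delta> by simp
    moreover have "Gromov_product d w (c i) (c (i + l)) = d w (c i)"
      using True that d_refl[of "c i"] cM[of i] by (simp add: Gromov_product_def)
    ultimately show ?thesis using wc[of i] that \<kappa> by linarith
  next
    case False
    show ?thesis
      by (rule Gromov_product_chain[OF hyp \<delta>]) (use that False M cM step in auto)
  qed
  have "real D - \<kappa> / 2 - real k * \<delta> \<le> Gromov_product d w (c a) (c b)"
  proof (cases "a \<le> b")
    case True
    then have "real (b - a) \<le> real (2 ^ k)" using abk by (simp add: of_nat_diff)
    then have "b - a \<le> 2 ^ k" by (simp only: of_nat_le_iff)
    then show ?thesis using mid[of a "b - a"] \<open>a \<le> b\<close> b by simp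
  next
    case False
    then have "real (a - b) \<le> real (2 ^ k)" using abk by (simp add: of_nat_diff)
    then have "a - b \<le> 2 ^ k" by (simp only: of_nat_le_iff)
    then have "real D - \<kappa> / 2 - real k * \<delta> \<le> Gromov_product d w (c b) (c a)"
      using mid[of b "a - b"] \<open>\<not> a \<le> b\<close> a by simp
    then show ?thesis using Gromov_product_commute[of d "c a" "c b" w] d_commute cM a b by simp
  qed
  \<comment> \<open>\<open>w\<close> lies on the geodesic from \<open>y\<close> to \<open>z\<close>.
    The two four-point inequalities that follow join \<open>y\<close> and \<open>z\<close> to the
    chain and cost the extra \<open>2 * \<delta>\<close>.\<close>
  moreover have "Gromov_product d w y z = 0" using wy by (simp add: Gromov_product_def)
  moreover have "min (Gromov_product d w y (c a)) (Gromov_product d w (c a) (c b)) - \<delta>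
      \<le> Gromov_product d w y (c b)" using hyp M cM a b by blast
  moreover have "min (Gromov_product d w y (c b)) (Gromov_product d w (c b) z) - \<delta>
      \<le> Gromov_product d w y z" using hyp M cM a b by blast
  moreover have "Gromov_product d w (c b) z = Gromov_product d w z (c b)"
    using Gromov_product_commute d_commute M cM b by metis
  moreover have "0 \<le> real k * \<delta>" using \<delta> by simp
  moreover have "(real k + 2) * \<delta> = real k * \<delta> + 2 * \<delta>" by (simp add: algebra_simps)
  ultimately show ?thesis using a(3) b(3) \<delta> \<kappa> by linarith
qed

end

text \<open>A number bounded by a constant plus a multiple of the logarithm of a linear function of
  itself is bounded; \<open>k\<close> stands for that logarithm, rounded up.\<close>

lemma logarithmic_bound:
  fixes \<kappa> \<delta> :: real
  assumes \<kappa>: "1 \<le> \<kappa>" and \<delta>: "0 \<le> \<delta>"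
  shows "\<exists>D0. \<forall>D::nat. (\<forall>k. \<kappa> * (6 * real D + 1) \<le> 2 ^ k \<longrightarrow> real D \<le> \<kappa> / 2 + (real k + 2) * \<delta>)
    \<longrightarrow> D \<le> D0"
proof -
  \<comment> \<open>\<open>N \<ge> 2 * \<delta>\<close> gives
    \<open>k * \<delta> \<le> D / 2\<close> for \<open>k = D div N\<close>. The assumed inequality
    then leaves \<open>D \<le> \<kappa> + 4 * \<delta>\<close>, which explains the second entry of
    \<open>D0\<close>; the first makes \<open>k\<close> at least \<open>K\<close>.\<close>
  define N :: nat where "N = nat \<lceil>2 * \<delta>\<rceil> + 1"
  have N: "0 < N" "2 * \<delta> \<le> real N" by (auto simp: N_def) linarith
  have "eventually (\<lambda>k::nat. \<kappa> * (6 * (real N * (real k + 1)) + 1) \<le> 2 ^ k) at_top"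
    using \<kappa> N(1) by real_asymp
  then obtain K where K: "\<And>k. K \<le> k \<Longrightarrow> \<kappa> * (6 * (real N * (real k + 1)) + 1) \<le> 2 ^ k"
    by (auto simp: eventually_at_top_linorder)
  define D0 where "D0 = max (N * K) (nat \<lceil>\<kappa> + 4 * \<delta>\<rceil>)"
  have "D \<le> D0"
    if *: "\<And>k. \<kappa> * (6 * real D + 1) \<le> 2 ^ k \<Longrightarrow> real D \<le> \<kappa> / 2 + (real k + 2) * \<delta>" for D :: nat
  proof (rule ccontr)
    assume "\<not> D \<le> D0"
    then have D: "N * K \<le> D" "\<kappa> + 4 * \<delta> < real D" unfolding D0_def by linarith+
    define k where "k = D div N"
    have "K \<le> k" using D(1) N(1) by (simp add: k_def less_eq_div_iff_mult_less_eq mult.commute)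
    have "D < N * (k + 1)" using N(1) by (simp add: k_def dividend_less_times_div)
    then have "real D < real (N * (k + 1))" using of_nat_less_iff by blast
    then have "real D < real N * (real k + 1)" by (simp add: algebra_simps)
    then have "\<kappa> * (6 * real D + 1) \<le> \<kappa> * (6 * (real N * (real k + 1)) + 1)"
      using \<kappa> by (intro mult_left_mono) auto
    also have "\<dots> \<le> 2 ^ k" using K \<open>K \<le> k\<close> by blast
    finally have "real D \<le> \<kappa> / 2 + (real k + 2) * \<delta>" by (rule *)
    moreover have "real k * (2 * \<delta>) \<le> real D"
    proof -
      have "real k * (2 * \<delta>) \<le> real k * real N" using N by (intro mult_left_mono) auto
      also have "\<dots> = real (D div N * N)" by (simp add: k_def)
      also have "\<dots> \<le> real D" by (simp only: of_nat_le_iff div_times_less_eq_dividend)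
      finally show ?thesis .
    qed
    ultimately show False using D(2) by (simp add: algebra_simps)
  qed
  then show ?thesis by blast
qed

context integer_geodesic_space
begin

text \<open>\<open>geodesic_near_quasi_geodesic\<close>, applied at the point of
  \<open>\<sigma>\<close> farthest from \<open>c\<close>, keeps \<open>\<sigma>\<close> near
  \<open>c\<close>. The converse is a discrete connectedness argument: somewhere along
  \<open>\<sigma>\<close> the nearby points of \<open>c\<close> pass from before \<open>t\<close> to
  after \<open>t\<close>, so two points of \<open>c\<close> on either side of \<open>t\<close> are
  close in space and hence in the parameter.\<close>

theorem Morse_lemma:
  assumes "Gromov_hyperbolic M d"
  shows "\<exists>D. \<forall>n m c \<sigma>. quasi_geodesic M d \<kappa> n c \<longrightarrow> geodesic_segment M d m \<sigma> \<longrightarrow>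
    \<sigma> 0 = c 0 \<longrightarrow> \<sigma> m = c n \<longrightarrow>
    (\<forall>j\<le>m. \<exists>i\<le>n. d (\<sigma> j) (c i) \<le> D) \<and> (\<forall>i\<le>n. \<exists>j\<le>m. d (c i) (\<sigma> j) \<le> D)"
proof -
  obtain \<delta>0 where \<delta>0: "\<forall>w\<in>M. \<forall>x\<in>M. \<forall>y\<in>M. \<forall>z\<in>M.
      Gromov_product d w x z \<ge> min (Gromov_product d w x y) (Gromov_product d w y z) - \<delta>0"
    using assms unfolding Gromov_hyperbolic_def by blast
  define \<delta> where "\<delta> = max 0 \<delta>0"
  have \<delta>: "0 \<le> \<delta>" by (simp add: \<delta>_def)
  have hyp: "Gromov_product d w x z \<ge> min (Gromov_product d w x y) (Gromov_product d w y z) - \<delta>"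
    if "w \<in> M" "x \<in> M" "y \<in> M" "z \<in> M" for w x y z
  proof -
    have "Gromov_product d w x z \<ge> min (Gromov_product d w x y) (Gromov_product d w y z) - \<delta>0"
      using \<delta>0 that by blast
    then show ?thesis unfolding \<delta>_def by linarith
  qed
  define \<mu> where "\<mu> = max 1 \<kappa>"
  have \<mu>: "1 \<le> \<mu>" "\<kappa> \<le> \<mu>" by (auto simp: \<mu>_def)
  obtain D0 :: nat where D0: "\<And>D::nat. (\<And>k. \<mu> * (6 * real D + 1) \<le> 2 ^ k \<Longrightarrow>
      real D \<le> \<mu> / 2 + (real k + 2) * \<delta>) \<Longrightarrow> D \<le> D0"
    using logarithmic_bound[OF \<mu>(1) \<delta>] by blast
  \<comment> \<open>Points of \<open>c\<close> on either side of \<open>t\<close> will be within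
    \<open>2 * D0 + 1\<close>, hence within \<open>\<mu> * (2 * D0 + 2)\<close> in the parameter;
    another factor \<open>\<mu>\<close> turns this back into a distance, and \<open>D0\<close> leads
    on to \<open>\<sigma>\<close>.\<close>
  define E where "E = \<mu> * (\<mu> * (2 * real D0 + 2)) + real D0"
  have "(\<forall>j\<le>m. \<exists>i\<le>n. d (\<sigma> j) (c i) \<le> E) \<and> (\<forall>i\<le>n. \<exists>j\<le>m. d (c i) (\<sigma> j) \<le> E)"
    if c0: "quasi_geodesic M d \<kappa> n c" and \<sigma>: "geodesic_segment M d m \<sigma>"
      and ends: "\<sigma> 0 = c 0" "\<sigma> m = c n" for n m c \<sigma>
  proof -
    have c: "quasi_geodesic M d \<mu> n c" using quasi_geodesic_mono[OF c0] \<mu> by blast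
    have M: "\<And>i. i \<le> n \<Longrightarrow> c i \<in> M" "\<And>j. j \<le> m \<Longrightarrow> \<sigma> j \<in> M"
      using quasi_geodesicD(1)[OF c] geodesic_segmentD(1)[OF \<sigma>] by blast+
    define \<rho> where "\<rho> j = Min ((\<lambda>i. d (\<sigma> j) (c i)) ` {..n})" for j
    have \<rho>: "\<rho> j \<le> d (\<sigma> j) (c i)" if "i \<le> n" for i j using that by (simp add: \<rho>_def)
    have \<rho>_ex: "\<exists>i\<le>n. d (\<sigma> j) (c i) = \<rho> j" for j
    proof -
      have "\<rho> j \<in> (\<lambda>i. d (\<sigma> j) (c i)) ` {..n}" unfolding \<rho>_def by (rule Min_in) auto
      then show ?thesis by auto
    qed
    obtain j0 where j0: "j0 \<le> m" "\<And>j. j \<le> m \<Longrightarrow> \<rho> j \<le> \<rho> j0"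
    proof -
      have "Max (\<rho> ` {..m}) \<in> \<rho> ` {..m}" by (rule Max_in) auto
      then obtain j0 where "j0 \<le> m" "\<rho> j0 = Max (\<rho> ` {..m})" by (metis atMost_iff imageE)
      then show ?thesis using that[of j0] by simp
    qed
    obtain i0 where i0: "i0 \<le> n" "d (\<sigma> j0) (c i0) = \<rho> j0" using \<rho>_ex by blast
    obtain D :: nat where D: "\<rho> j0 = real D"
      using d_nat[OF M(2)[OF j0(1)] M(1)[OF i0(1)]] i0(2) by metis
    have "D \<le> D0"
    proof (rule D0)
      fix k assume k: "\<mu> * (6 * real D + 1) \<le> 2 ^ k"
      show "real D \<le> \<mu> / 2 + (real k + 2) * \<delta>"
      proof (rule geodesic_near_quasi_geodesic[OF hyp \<delta> c \<sigma> ends _ j0(1) _ \<mu>(1) k])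
        show "real D \<le> d (\<sigma> j0) (c i)" if "i \<le> n" for i using \<rho>[OF that, of j0] D by simp
        show "\<exists>i\<le>n. d (\<sigma> j) (c i) \<le> real D" if "j \<le> m" for j
          using \<rho>_ex[of j] j0(2)[OF that] D by auto
      qed
    qed
    have near: "\<exists>i\<le>n. d (\<sigma> j) (c i) \<le> real D0" if "j \<le> m" for j
    proof -
      have "\<rho> j \<le> real D0" using j0(2)[OF that] D \<open>D \<le> D0\<close> by simp
      then show ?thesis using \<rho>_ex[of j] by auto
    qed
    have "0 \<le> \<mu> * (\<mu> * (2 * real D0 + 2))" using \<mu> by simp
    then have D0E: "real D0 \<le> E" by (simp add: E_def)
    have "\<exists>j\<le>m. d (c t) (\<sigma> j) \<le> E" if t: "t \<le> n" for t
    proof -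
      \<comment> \<open>The greatest such \<open>j\<close> is the last time at which
        \<open>\<sigma>\<close> is near the part of \<open>c\<close> up to \<open>t\<close>. One
        step later it can only be near the part after \<open>t\<close>, unless \<open>j = m\<close>,
        when \<open>c n\<close> itself serves.\<close>
      define Q where "Q j \<longleftrightarrow> j \<le> m \<and> (\<exists>i\<le>t. d (\<sigma> j) (c i) \<le> real D0)" for j
      have "Q 0" using ends d_refl M by (auto simp: Q_def intro!: exI[of _ 0])
      moreover have Qm: "\<forall>j. Q j \<longrightarrow> j \<le> m" by (simp add: Q_def)
      ultimately have "Q (Greatest Q)" using GreatestI_nat[of Q 0 m] by blast
      moreover have "j' \<le> Greatest Q" if "Q j'" for j' using that Qm Greatest_le_nat[of Q j' m] by blast
      ultimately obtain j where j: "Q j" "\<And>j'. Q j' \<Longrightarrow> j' \<le> j" by blast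
      then obtain i where i: "i \<le> t" "d (\<sigma> j) (c i) \<le> real D0" and jm: "j \<le> m" by (auto simp: Q_def)
      have "\<exists>i'\<le>n. t \<le> i' \<and> d (c i) (c i') \<le> 2 * real D0 + 1"
      proof (cases "j = m")
        case True
        then have "d (c i) (c n) \<le> 2 * real D0 + 1" using i t ends d_commute[of "c i" "c n"] M by simp
        then show ?thesis using t by blast
      next
        case False
        then have Sj: "Suc j \<le> m" using jm by simp
        then obtain i' where i': "i' \<le> n" "d (\<sigma> (Suc j)) (c i') \<le> real D0" using near by blast
        have "\<not> i' \<le> t" using j(2)[of "Suc j"] i' Sj by (auto simp: Q_def)
        moreover have "d (c i) (c i') \<le> d (c i) (\<sigma> j) + d (\<sigma> j) (\<sigma> (Suc j)) + d (\<sigma> (Suc j)) (c i')"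
          using d_triangle[of "c i" "\<sigma> j" "c i'"] d_triangle[of "\<sigma> j" "\<sigma> (Suc j)" "c i'"] M i t jm Sj i'
          by force
        moreover have "d (\<sigma> j) (\<sigma> (Suc j)) = 1" using geodesic_segmentD(2)[OF \<sigma>, of j "Suc j"] Sj by simp
        ultimately show ?thesis using i i' d_commute[of "c i" "\<sigma> j"] M t jm
          by (intro exI[of _ i']) simp
      qed
      then obtain i' where i': "i' \<le> n" "t \<le> i'" "d (c i) (c i') \<le> 2 * real D0 + 1" by blast
      have "\<bar>real t - real i\<bar> \<le> \<bar>real i - real i'\<bar>" using i i' by simp
      also have "\<dots> \<le> \<mu> * (d (c i) (c i') + 1)" using quasi_geodesicD(3)[OF c, of i i'] i i' t by simp
      also have "\<dots> \<le> \<mu> * (2 * real D0 + 2)" using i' \<mu> by (intro mult_left_mono) auto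
      finally have *: "\<bar>real t - real i\<bar> \<le> \<mu> * (2 * real D0 + 2)" .
      have "d (c t) (c i) \<le> \<mu> * \<bar>real t - real i\<bar>" using quasi_geodesicD(2)[OF c, of t i] i t by simp
      also have "\<dots> \<le> \<mu> * (\<mu> * (2 * real D0 + 2))" using * \<mu> by (intro mult_left_mono) auto
      finally have "d (c t) (\<sigma> j) \<le> E"
        using d_triangle[of "c t" "c i" "\<sigma> j"] d_commute[of "c i" "\<sigma> j"] M i t jm by (simp add: E_def)
      then show ?thesis using jm by blast
    qed
    moreover have "\<exists>i\<le>n. d (\<sigma> j) (c i) \<le> E" if "j \<le> m" for j
      using near[OF that] D0E by force
    ultimately show ?thesis by blast
  qed
  then show ?thesis by blast
qed

text \<open>A geodesic with the same endpoints mediates between the two quasi-geodesics.\<close>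

lemma Gromov_hyperbolic_imp_stable:
  assumes "Gromov_hyperbolic M d"
  shows "stable_quasi_geodesics M d"
  unfolding stable_quasi_geodesics_def
proof
  fix \<kappa>
  obtain D where D: "\<And>n m c \<sigma>. quasi_geodesic M d \<kappa> n c \<Longrightarrow> geodesic_segment M d m \<sigma> \<Longrightarrow>
    \<sigma> 0 = c 0 \<Longrightarrow> \<sigma> m = c n \<Longrightarrow>
    (\<forall>j\<le>m. \<exists>i\<le>n. d (\<sigma> j) (c i) \<le> D) \<and> (\<forall>i\<le>n. \<exists>j\<le>m. d (c i) (\<sigma> j) \<le> D)"
    using Morse_lemma[OF assms] by metis
  have "\<exists>j\<le>n. d (c i) (c' j) \<le> D + D"
    if c: "quasi_geodesic M d \<kappa> m c" "quasi_geodesic M d \<kappa> n c'"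
      and e: "c 0 = c' 0" "c m = c' n" and i: "i \<le> m" for m n c c' i
  proof -
    have M: "c 0 \<in> M" "c m \<in> M" "c i \<in> M" using quasi_geodesicD(1)[OF c(1)] i by blast+
    obtain l \<sigma> where \<sigma>: "geodesic_segment M d l \<sigma>" "\<sigma> 0 = c 0" "\<sigma> l = c m"
      using ex_geodesic M by blast
    obtain k where k: "k \<le> l" "d (c i) (\<sigma> k) \<le> D" using D[OF c(1) \<sigma>] i by blast
    obtain j where j: "j \<le> n" "d (\<sigma> k) (c' j) \<le> D" using D[OF c(2) \<sigma>(1)] \<sigma>(2,3) e k by metis
    have "\<sigma> k \<in> M" "c' j \<in> M" using geodesic_segmentD(1)[OF \<sigma>(1)] quasi_geodesicD(1)[OF c(2)] k j by blast+
    then show ?thesis using j k d_triangle[of "c i" "\<sigma> k" "c' j"] M by (intro exI[of _ j]) simp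
  qed
  then show "\<exists>D. \<forall>m n c c'. quasi_geodesic M d \<kappa> m c \<longrightarrow> quasi_geodesic M d \<kappa> n c' \<longrightarrow>
      c 0 = c' 0 \<longrightarrow> c m = c' n \<longrightarrow> (\<forall>i\<le>m. \<exists>j\<le>n. d (c i) (c' j) \<le> D)"
    by blast
qed

end

section \<open>Change of metric\<close>

lemma stable_quasi_geodesics_bilipschitz:
  assumes st: "stable_quasi_geodesics M d'" and A: "0 \<le> A"
    and le: "\<And>x y. x \<in> M \<Longrightarrow> y \<in> M \<Longrightarrow> d x y \<le> A * d' x y"
    and le': "\<And>x y. x \<in> M \<Longrightarrow> y \<in> M \<Longrightarrow> d' x y \<le> A * d x y"
    and nn: "\<And>x y. x \<in> M \<Longrightarrow> y \<in> M \<Longrightarrow> 0 \<le> d x y" "\<And>x y. x \<in> M \<Longrightarrow> y \<in> M \<Longrightarrow> 0 \<le> d' x y"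
  shows "stable_quasi_geodesics M d"
  unfolding stable_quasi_geodesics_def
proof
  fix \<kappa> :: real
  \<comment> \<open>\<open>max 0 \<kappa>\<close> because \<open>\<kappa>\<close> is arbitrary and
    may be negative; \<open>A + 1\<close> covers both the factor \<open>A\<close> and the additive 1
    in the lower bound.\<close>
  define \<mu> where "\<mu> = max 0 \<kappa> * (A + 1)"
  have qg: "quasi_geodesic M d' \<mu> n c" if c: "quasi_geodesic M d \<kappa> n c" for n c
    unfolding quasi_geodesic_def
  proof (intro conjI allI impI)
    fix i j assume ij: "i \<le> n" "j \<le> n"
    show M: "c i \<in> M" using c ij unfolding quasi_geodesic_def by blast
    have M': "c j \<in> M" using c ij unfolding quasi_geodesic_def by blast
    have 1: "d (c i) (c j) \<le> \<kappa> * \<bar>real i - real j\<bar>" "\<bar>real i - real j\<bar> \<le> \<kappa> * (d (c i) (c j) + 1)"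
      using c ij unfolding quasi_geodesic_def by blast+
    have "d' (c i) (c j) \<le> A * (\<kappa> * \<bar>real i - real j\<bar>)"
      using le'[OF M M'] 1(1) A by (meson mult_left_mono order_trans)
    also have "\<dots> \<le> \<mu> * \<bar>real i - real j\<bar>"
    proof -
      have "A * \<kappa> \<le> A * max 0 \<kappa>" using A by (intro mult_left_mono) auto
      also have "\<dots> \<le> \<mu>" by (simp add: \<mu>_def algebra_simps)
      finally show ?thesis by (metis abs_ge_zero mult.assoc mult_right_mono)
    qed
    finally show "d' (c i) (c j) \<le> \<mu> * \<bar>real i - real j\<bar>" .
    have dd: "d (c i) (c j) + 1 \<le> (A + 1) * (d' (c i) (c j) + 1)"
      using le[OF M M'] nn(2)[OF M M'] A by (simp add: algebra_simps)
    have "\<kappa> * (d (c i) (c j) + 1) \<le> max 0 \<kappa> * (d (c i) (c j) + 1)"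
      using nn(1)[OF M M'] by (intro mult_right_mono) auto
    also have "\<dots> \<le> max 0 \<kappa> * ((A + 1) * (d' (c i) (c j) + 1))"
      using dd by (intro mult_left_mono) auto
    finally show "\<bar>real i - real j\<bar> \<le> \<mu> * (d' (c i) (c j) + 1)"
      using 1(2) by (simp add: \<mu>_def mult.assoc)
  qed
  obtain D where D: "\<And>m n c c'. quasi_geodesic M d' \<mu> m c \<Longrightarrow> quasi_geodesic M d' \<mu> n c' \<Longrightarrow>
     c 0 = c' 0 \<Longrightarrow> c m = c' n \<Longrightarrow> \<forall>i\<le>m. \<exists>j\<le>n. d' (c i) (c' j) \<le> D"
    using st unfolding stable_quasi_geodesics_def by metis
  have "\<exists>j\<le>n. d (c i) (c' j) \<le> A * D"
    if c: "quasi_geodesic M d \<kappa> m c" "quasi_geodesic M d \<kappa> n c'"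
      and e: "c 0 = c' 0" "c m = c' n" and i: "i \<le> m" for m n c c' i
  proof -
    obtain j where j: "j \<le> n" "d' (c i) (c' j) \<le> D" using D[OF qg[OF c(1)] qg[OF c(2)] e] i by blast
    have "c i \<in> M" "c' j \<in> M" using c i j unfolding quasi_geodesic_def by blast+
    then show ?thesis using le j A by (meson mult_left_mono order_trans)
  qed
  then show "\<exists>D. \<forall>m n c c'. quasi_geodesic M d \<kappa> m c \<longrightarrow> quasi_geodesic M d \<kappa> n c' \<longrightarrow>
      c 0 = c' 0 \<longrightarrow> c m = c' n \<longrightarrow> (\<forall>i\<le>m. \<exists>j\<le>n. d (c i) (c' j) \<le> D)"
    by blast
qed

section \<open>Rays and the boundary\<close>

lemma geodesic_raysD:
  assumes "\<gamma> \<in> geodesic_rays M d"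
  shows "\<gamma> i \<in> M" "d (\<gamma> i) (\<gamma> j) = \<bar>real i - real j\<bar>" "geodesic_segment M d n \<gamma>"
  using assms by (auto simp: geodesic_rays_def geodesic_segment_def)

text \<open>A basic open set of the product restricts finitely many coordinates, all below some
  \<open>k\<close>; conversely, with discrete factors the sequences that agree with
  \<open>\<gamma>\<close> up to \<open>k\<close> form an open set. Openness becomes a statement
  about initial segments, which suits arguments by sequences.\<close>

lemma openin_ray_topology:
  "openin (ray_topology M d) W \<longleftrightarrow> W \<subseteq> geodesic_rays M d \<and>
     (\<forall>\<gamma>\<in>W. \<exists>k. \<forall>\<gamma>'\<in>geodesic_rays M d. (\<forall>i\<le>k. \<gamma>' i = \<gamma> i) \<longrightarrow> \<gamma>' \<in> W)"
  (is "_ \<longleftrightarrow> ?R")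
proof
  assume "openin (ray_topology M d) W"
  then obtain T where T: "openin (product_topology (\<lambda>_. discrete_topology M) UNIV) T"
    "W = T \<inter> geodesic_rays M d"
    unfolding ray_topology_def openin_subtopology by blast
  have "\<exists>k. \<forall>\<gamma>'\<in>geodesic_rays M d. (\<forall>i\<le>k. \<gamma>' i = \<gamma> i) \<longrightarrow> \<gamma>' \<in> W" if "\<gamma> \<in> W" for \<gamma>
  proof -
    have "\<gamma> \<in> T" using that T by blast
    then obtain U where U: "finite {i. U i \<noteq> M}" "\<gamma> \<in> Pi\<^sub>E UNIV U" "Pi\<^sub>E UNIV U \<subseteq> T"
      using T(1) unfolding openin_product_topology_alt by auto
    obtain k where k: "\<And>i. U i \<noteq> M \<Longrightarrow> i \<le> k"
      using U(1) unfolding finite_nat_set_iff_bounded_le by auto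
    have "\<gamma>' \<in> W" if "\<gamma>' \<in> geodesic_rays M d" "\<forall>i\<le>k. \<gamma>' i = \<gamma> i" for \<gamma>'
    proof -
      have "\<gamma>' i \<in> U i" for i
      proof (cases "U i = M")
        case True
        then show ?thesis using geodesic_raysD(1)[OF that(1)] by blast
      next
        case False
        then have "\<gamma>' i = \<gamma> i" using k that(2) by blast
        then show ?thesis using U(2) by (metis PiE_E UNIV_I)
      qed
      then have "\<gamma>' \<in> T" using U(3) by auto
      then show ?thesis using T(2) that by blast
    qed
    then show ?thesis by blast
  qed
  then show ?R using T(2) by blast
next
  assume R: ?R
  then obtain k where k: "\<And>\<gamma> \<gamma>'. \<lbrakk>\<gamma> \<in> W; \<gamma>' \<in> geodesic_rays M d; \<forall>i\<le>k \<gamma>. \<gamma>' i = \<gamma> i\<rbrakk> \<Longrightarrow> \<gamma>' \<in> W"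
    by metis
  define T where "T = (\<Union>\<gamma>\<in>W. Pi\<^sub>E UNIV (\<lambda>i. if i \<le> k \<gamma> then {\<gamma> i} else M))"
  have "openin (product_topology (\<lambda>_. discrete_topology M) UNIV) T"
    unfolding T_def
  proof (intro openin_Union ballI, clarify)
    fix \<gamma> assume "\<gamma> \<in> W"
    then have "\<gamma> \<in> geodesic_rays M d" using R by blast
    then have "\<gamma> i \<in> M" for i by (rule geodesic_raysD)
    moreover have "{i. (if i \<le> k \<gamma> then {\<gamma> i} else M) \<noteq> M} \<subseteq> {..k \<gamma>}" by auto
    then have "finite {i. (if i \<le> k \<gamma> then {\<gamma> i} else M) \<noteq> M}"
      using finite_subset by blast
    ultimately show "openin (product_topology (\<lambda>_. discrete_topology M) UNIV)
      (Pi\<^sub>E UNIV (\<lambda>i. if i \<le> k \<gamma> then {\<gamma> i} else M))"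
      by (intro product_topology_basis) auto
  qed
  moreover have "W = T \<inter> geodesic_rays M d"
  proof
    show "W \<subseteq> T \<inter> geodesic_rays M d"
    proof
      fix \<gamma> assume "\<gamma> \<in> W"
      then have ray: "\<gamma> \<in> geodesic_rays M d" using R by blast
      then have "\<gamma> \<in> Pi\<^sub>E UNIV (\<lambda>i. if i \<le> k \<gamma> then {\<gamma> i} else M)"
        using geodesic_raysD(1)[OF ray] by auto
      then show "\<gamma> \<in> T \<inter> geodesic_rays M d" using ray \<open>\<gamma> \<in> W\<close> by (auto simp: T_def)
    qed
    show "T \<inter> geodesic_rays M d \<subseteq> W"
    proof
      fix \<gamma>' assume "\<gamma>' \<in> T \<inter> geodesic_rays M d"
      then obtain \<gamma> where \<gamma>: "\<gamma> \<in> W" "\<gamma>' \<in> geodesic_rays M d"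
        "\<And>i. \<gamma>' i \<in> (if i \<le> k \<gamma> then {\<gamma> i} else M)" by (auto simp: T_def PiE_iff)
      have "\<gamma>' i = \<gamma> i" if "i \<le> k \<gamma>" for i using \<gamma>(3)[of i] that by simp
      then show "\<gamma>' \<in> W" using k \<gamma> by blast
    qed
  qed
  ultimately show "openin (ray_topology M d) W"
    unfolding ray_topology_def openin_subtopology by blast
qed

section \<open>Hausdorff distance, limit classes and quasi-rays\<close>

context integer_geodesic_space
begin

lemma finite_Hausdorff_dist_commute:
  assumes "A \<subseteq> M" "B \<subseteq> M" "finite_Hausdorff_dist d A B"
  shows "finite_Hausdorff_dist d B A"
proof -
  obtain C where C: "\<forall>a\<in>A. \<exists>b\<in>B. d a b \<le> C" "\<forall>b\<in>B. \<exists>a\<in>A. d a b \<le> C"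
    using assms unfolding finite_Hausdorff_dist_def by blast
  have "\<forall>a\<in>A. \<exists>b\<in>B. d b a \<le> C" "\<forall>b\<in>B. \<exists>a\<in>A. d b a \<le> C"
    using C assms d_commute by (metis subsetD)+
  then show ?thesis unfolding finite_Hausdorff_dist_def by blast
qed

lemma finite_Hausdorff_dist_refl: "A \<subseteq> M \<Longrightarrow> finite_Hausdorff_dist d A A"
  unfolding finite_Hausdorff_dist_def using d_refl by (intro exI[of _ 0]) force

lemma finite_Hausdorff_dist_trans:
  assumes M: "A \<subseteq> M" "B \<subseteq> M" "C \<subseteq> M"
    and AB: "finite_Hausdorff_dist d A B" and BC: "finite_Hausdorff_dist d B C"
  shows "finite_Hausdorff_dist d A C"
proof -
  obtain K where K: "\<And>a. a \<in> A \<Longrightarrow> \<exists>b\<in>B. d a b \<le> K" "\<And>b. b \<in> B \<Longrightarrow> \<exists>a\<in>A. d a b \<le> K"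
    using AB unfolding finite_Hausdorff_dist_def by blast
  obtain L where L: "\<And>b. b \<in> B \<Longrightarrow> \<exists>c\<in>C. d b c \<le> L" "\<And>c. c \<in> C \<Longrightarrow> \<exists>b\<in>B. d b c \<le> L"
    using BC unfolding finite_Hausdorff_dist_def by blast
  have "\<exists>c\<in>C. d a c \<le> K + L" if aA: "a \<in> A" for a
  proof -
    obtain b where b: "b \<in> B" "d a b \<le> K" using K(1) aA by blast
    obtain c where c: "c \<in> C" "d b c \<le> L" using L(1) b by blast
    have "d a c \<le> d a b + d b c" using d_triangle M aA b c by blast
    then show ?thesis using b c by (intro bexI[of _ c]) auto
  qed
  moreover have "\<exists>a\<in>A. d a c \<le> K + L" if cC: "c \<in> C" for c
  proof -
    obtain b where b: "b \<in> B" "d b c \<le> L" using L(2) cC by blast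
    obtain a where a: "a \<in> A" "d a b \<le> K" using K(2) b by blast
    have "d a c \<le> d a b + d b c" using d_triangle M cC b a by blast
    then show ?thesis using b a by (intro bexI[of _ a]) auto
  qed
  ultimately show ?thesis unfolding finite_Hausdorff_dist_def by blast
qed

lemma finite_Hausdorff_dist_range:
  assumes "\<And>i::nat. \<exists>j::nat. d (c i) (c' j) \<le> C" "\<And>j. \<exists>i. d (c i) (c' j) \<le> C"
  shows "finite_Hausdorff_dist d (range c) (range c')"
  using assms unfolding finite_Hausdorff_dist_def by (intro exI[of _ C]) auto

text \<open>Defined for every sequence, so that the image of a ray under a quasi-isometry has a
  class before any geodesic near it is chosen; on geodesic rays it is the asymptotic class. It is
  empty when no geodesic ray is near.\<close>

definition limit_class :: "(nat \<Rightarrow> 'a) \<Rightarrow> (nat \<Rightarrow> 'a) set" where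
  "limit_class c = {\<gamma> \<in> geodesic_rays M d. finite_Hausdorff_dist d (range c) (range \<gamma>)}"

lemma range_geodesic_ray: "\<gamma> \<in> geodesic_rays M d \<Longrightarrow> range \<gamma> \<subseteq> M"
  by (simp add: geodesic_rays_def)

lemma asymptotic_image: "\<gamma> \<in> geodesic_rays M d \<Longrightarrow> asymptotic M d `` {\<gamma>} = limit_class \<gamma>"
  by (auto simp: asymptotic_def limit_class_def)

lemma Gromov_boundary_eq: "Gromov_boundary M d = limit_class ` geodesic_rays M d"
  unfolding Gromov_boundary_def quotient_def using asymptotic_image by auto

lemma limit_class_self: "\<gamma> \<in> geodesic_rays M d \<Longrightarrow> \<gamma> \<in> limit_class \<gamma>"
  by (simp add: limit_class_def finite_Hausdorff_dist_refl range_geodesic_ray)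

lemma limit_class_cong:
  assumes "range c \<subseteq> M" "range c' \<subseteq> M" "finite_Hausdorff_dist d (range c) (range c')"
  shows "limit_class c = limit_class c'"
proof -
  have "finite_Hausdorff_dist d (range c) (range \<gamma>) \<longleftrightarrow> finite_Hausdorff_dist d (range c') (range \<gamma>)"
    if "\<gamma> \<in> geodesic_rays M d" for \<gamma>
    using finite_Hausdorff_dist_trans[OF assms(1,2) range_geodesic_ray[OF that] assms(3)]
      finite_Hausdorff_dist_trans[OF assms(2,1) range_geodesic_ray[OF that]
        finite_Hausdorff_dist_commute[OF assms]] by blast
  then show ?thesis unfolding limit_class_def by blast
qed

lemma limit_class_eq_iff:
  assumes "range c \<subseteq> M" "\<gamma> \<in> geodesic_rays M d"
  shows "limit_class c = limit_class \<gamma> \<longleftrightarrow> finite_Hausdorff_dist d (range c) (range \<gamma>)"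
proof
  assume "limit_class c = limit_class \<gamma>"
  then have "\<gamma> \<in> limit_class c" using limit_class_self[OF assms(2)] by simp
  then show "finite_Hausdorff_dist d (range c) (range \<gamma>)" by (simp add: limit_class_def)
qed (use assms limit_class_cong range_geodesic_ray in blast)

lemma openin_boundary:
  "openin (boundary_topology M d) U \<longleftrightarrow> U \<subseteq> Gromov_boundary M d \<and>
     (\<forall>\<gamma>\<in>geodesic_rays M d. limit_class \<gamma> \<in> U \<longrightarrow>
        (\<exists>k. \<forall>\<gamma>'\<in>geodesic_rays M d. (\<forall>i\<le>k. \<gamma>' i = \<gamma> i) \<longrightarrow> limit_class \<gamma>' \<in> U))"
proof -
  have "{\<gamma> \<in> geodesic_rays M d. asymptotic M d `` {\<gamma>} \<in> U}
      = {\<gamma> \<in> geodesic_rays M d. limit_class \<gamma> \<in> U}"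
    using asymptotic_image by auto
  then show ?thesis unfolding openin_boundary_topology openin_ray_topology by auto
qed

definition quasi_ray :: "real \<Rightarrow> (nat \<Rightarrow> 'a) \<Rightarrow> bool" where
  "quasi_ray \<kappa> c \<longleftrightarrow> (\<forall>n. quasi_geodesic M d \<kappa> n c)"

lemma quasi_rayD:
  assumes "quasi_ray \<kappa> c"
  shows "c i \<in> M" "range c \<subseteq> M" "d (c i) (c j) \<le> \<kappa> * \<bar>real i - real j\<bar>"
    "\<bar>real i - real j\<bar> \<le> \<kappa> * (d (c i) (c j) + 1)"
proof -
  have *: "quasi_geodesic M d \<kappa> (max i j) c" for i j using assms by (simp add: quasi_ray_def)
  have "c i \<in> M" for i using quasi_geodesicD(1)[OF *[of i i], of i i] by simp
  then show "c i \<in> M" "range c \<subseteq> M" by auto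
  show "d (c i) (c j) \<le> \<kappa> * \<bar>real i - real j\<bar>"
    "\<bar>real i - real j\<bar> \<le> \<kappa> * (d (c i) (c j) + 1)"
    using quasi_geodesicD(2,3)[OF *[of i j], of i j] by auto
qed

lemma quasi_geodesicI:
  assumes M: "\<And>i. i \<le> n \<Longrightarrow> c i \<in> M"
    and "\<And>i j. i \<le> j \<Longrightarrow> j \<le> n \<Longrightarrow> d (c i) (c j) \<le> \<kappa> * (real j - real i)"
    and "\<And>i j. i \<le> j \<Longrightarrow> j \<le> n \<Longrightarrow> real j - real i \<le> \<kappa> * (d (c i) (c j) + 1)"
  shows "quasi_geodesic M d \<kappa> n c"
  unfolding quasi_geodesic_def
proof (intro conjI allI impI M)
  fix i j assume ij: "i \<le> n" "j \<le> n"
  show "d (c i) (c j) \<le> \<kappa> * \<bar>real i - real j\<bar>" "\<bar>real i - real j\<bar> \<le> \<kappa> * (d (c i) (c j) + 1)"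
    using assms(2,3)[of i j] assms(2,3)[of j i] ij d_commute[OF M[OF ij(1)] M[OF ij(2)]]
    by (cases "i \<le> j"; simp)+
qed

lemma quasi_rayI:
  assumes "\<And>i. c i \<in> M"
    and "\<And>i j. i \<le> j \<Longrightarrow> d (c i) (c j) \<le> \<kappa> * (real j - real i)"
    and "\<And>i j. i \<le> j \<Longrightarrow> real j - real i \<le> \<kappa> * (d (c i) (c j) + 1)"
  shows "quasi_ray \<kappa> c"
  unfolding quasi_ray_def using quasi_geodesicI assms by blast

lemma quasi_ray_mono: "quasi_ray \<kappa> c \<Longrightarrow> \<kappa> \<le> \<mu> \<Longrightarrow> quasi_ray \<mu> c"
  unfolding quasi_ray_def using quasi_geodesic_mono by blast

lemma geodesic_ray_imp_quasi_ray: "\<gamma> \<in> geodesic_rays M d \<Longrightarrow> 1 \<le> \<kappa> \<Longrightarrow> quasi_ray \<kappa> \<gamma>"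
  unfolding quasi_ray_def using geodesic_raysD(3) geodesic_imp_quasi_geodesic by blast

end

section \<open>Compactness arguments in proper spaces\<close>

locale proper_stable_space = integer_geodesic_space +
  assumes finite_ball: "x \<in> M \<Longrightarrow> finite {y \<in> M. d x y \<le> r}"
    and stable: "stable_quasi_geodesics M d"
begin

text \<open>Arzela-Ascoli in a discrete proper space: at each time only finitely many positions
  occur, so a diagonal subsequence makes every coordinate eventually constant. A finite set of
  origins is allowed because \<open>attracting_subsequence\<close> controls the origins only up to a
  finite set.\<close>

lemma geodesic_subsequence:
  assumes \<sigma>: "\<And>n. geodesic_segment M d (l n) (\<sigma> n)"
    and B: "\<And>n. \<sigma> n 0 \<in> B" "finite B" "B \<subseteq> M"
    and l: "\<And>k. eventually (\<lambda>n. k \<le> l n) sequentially"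
  obtains r \<gamma> where "strict_mono (r :: nat \<Rightarrow> nat)" "\<gamma> \<in> geodesic_rays M d"
    "\<And>k. eventually (\<lambda>n. \<forall>i\<le>k. \<sigma> (r n) i = \<gamma> i) sequentially"
proof -
  \<comment> \<open>Freezing the path at its endpoint keeps every coordinate inside
    \<open>M\<close>; as \<open>l n\<close> grows, the freezing ceases to matter at each fixed
    time.\<close>
  define \<tau> where "\<tau> n k = \<sigma> n (min k (l n))" for n k
  have "\<tau> n k \<in> (\<Union>b\<in>B. {y \<in> M. d b y \<le> real k})" for n k
    using geodesic_segmentD[OF \<sigma>[of n], of 0 "min k (l n)"] geodesic_segmentD[OF \<sigma>[of n], of "min k (l n)"] B(1)[of n]
    by (auto simp: \<tau>_def intro!: bexI[of _ "\<sigma> n 0"])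
  moreover have "finite (\<Union>b\<in>B. {y \<in> M. d b y \<le> real k})" for k
    using B finite_ball by auto
  ultimately have fin: "finite (range (\<lambda>n. \<tau> (s n) k))" for s :: "nat \<Rightarrow> nat" and k
    by (meson finite_subset image_subsetI)
  interpret subseqs "\<lambda>k s. \<exists>v. \<forall>n. \<tau> (s n) k = v"
  proof
    fix k and s :: "nat \<Rightarrow> nat" assume "strict_mono s"
    obtain n0 where "infinite {n \<in> UNIV. \<tau> (s n) k = \<tau> (s n0) k}"
      using pigeonhole_infinite[OF infinite_UNIV_nat fin] by blast
    then obtain r :: "nat \<Rightarrow> nat" where "strict_mono r" "\<forall>n. r n \<in> {n \<in> UNIV. \<tau> (s n) k = \<tau> (s n0) k}"
      using infinite_enumerate by blast
    then have "strict_mono r \<and> (\<exists>v. \<forall>n. \<tau> ((s \<circ> r) n) k = v)"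
      by (intro conjI exI[of _ "\<tau> (s n0) k"]) auto
    then show "\<exists>r'::nat \<Rightarrow> nat. strict_mono r' \<and> (\<exists>v. \<forall>n. \<tau> ((s \<circ> r') n) k = v)" by (rule exI[of _ r])
  qed
  \<comment> \<open>From index \<open>k + 1\<close> on, the diagonal sequence runs inside the stage
    that settled coordinate \<open>k\<close>.\<close>
  have "\<exists>v. \<forall>n. \<tau> ((diagseq \<circ> (+) (Suc k)) n) k = v" for k
    by (rule diagseq_holds) auto
  then obtain \<gamma> where \<gamma>: "\<And>k n. \<tau> (diagseq (Suc k + n)) k = \<gamma> k" by (auto simp: o_def) metis
  have "eventually (\<lambda>n. \<sigma> (diagseq n) k = \<gamma> k) sequentially" for k
  proof -
    have "eventually (\<lambda>n. k \<le> l (diagseq n)) sequentially"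
      using eventually_subseq[OF subseq_diagseq l] .
    moreover have "eventually (\<lambda>n. Suc k \<le> n) sequentially" by (rule eventually_ge_at_top)
    ultimately show ?thesis
    proof eventually_elim
      case (elim n)
      then show ?case using \<gamma>[of k "n - Suc k"] by (simp add: \<tau>_def)
    qed
  qed
  then have ev: "eventually (\<lambda>n. \<forall>i\<in>{..k}. \<sigma> (diagseq n) i = \<gamma> i) sequentially" for k
    by (intro eventually_ball_finite) auto
  have "\<gamma> i \<in> M \<and> d (\<gamma> i) (\<gamma> j) = \<bar>real i - real j\<bar>" for i j
  proof -
    have "eventually (\<lambda>n. max i j \<le> l (diagseq n)) sequentially"
      using eventually_subseq[OF subseq_diagseq l] .
    then have "eventually (\<lambda>n. max i j \<le> l (diagseq n) \<and> (\<forall>i\<in>{..max i j}. \<sigma> (diagseq n) i = \<gamma> i)) sequentially"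
      using ev eventually_conj by blast
    then obtain n where n: "max i j \<le> l (diagseq n)" "\<forall>i\<in>{..max i j}. \<sigma> (diagseq n) i = \<gamma> i"
      using eventually_happens'[OF sequentially_bot] by blast
    then have "\<sigma> (diagseq n) i = \<gamma> i" "\<sigma> (diagseq n) j = \<gamma> j" by auto
    then show ?thesis using geodesic_segmentD[OF \<sigma>[of "diagseq n"], of i j] n(1) by simp
  qed
  then have "\<gamma> \<in> geodesic_rays M d" by (auto simp: geodesic_rays_def)
  moreover have "eventually (\<lambda>n. \<forall>i\<le>k. \<sigma> (diagseq n) i = \<gamma> i) sequentially" for k
    using ev[of k] by (simp add: Ball_def)
  ultimately show thesis by (rule that[OF subseq_diagseq])
qed

text \<open>\<open>\<gamma>\<close> is a limit of geodesics from \<open>c 0\<close> to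
  \<open>c n\<close>, each uniformly close to \<open>c\<close> by stability. That \<open>D\<close>
  depends on \<open>\<kappa>\<close> alone matters where a whole sequence of quasi-rays is treated
  at once.\<close>

lemma quasi_ray_near_geodesic_ray:
  obtains D where "0 \<le> D" "\<And>c. quasi_ray \<kappa> c \<Longrightarrow> \<exists>\<gamma>\<in>geodesic_rays M d. \<gamma> 0 = c 0 \<and>
    (\<forall>i. \<exists>j. d (\<gamma> i) (c j) \<le> D) \<and> (\<forall>i. \<exists>j. d (c i) (\<gamma> j) \<le> D)"
proof -
  define \<mu> where "\<mu> = max 1 \<kappa>"
  obtain D0 where D0: "\<And>m n c c'. quasi_geodesic M d \<mu> m c \<Longrightarrow> quasi_geodesic M d \<mu> n c' \<Longrightarrow>
     c 0 = c' 0 \<Longrightarrow> c m = c' n \<Longrightarrow> \<forall>i\<le>m. \<exists>j\<le>n. d (c i) (c' j) \<le> D0"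
    using stable unfolding stable_quasi_geodesics_def by metis
  define D where "D = max 0 D0"
  have "\<exists>\<gamma>\<in>geodesic_rays M d. \<gamma> 0 = c 0 \<and>
    (\<forall>i. \<exists>j. d (\<gamma> i) (c j) \<le> D) \<and> (\<forall>i. \<exists>j. d (c i) (\<gamma> j) \<le> D)" if c0: "quasi_ray \<kappa> c" for c
  proof -
    have c: "quasi_ray \<mu> c" using quasi_ray_mono[OF c0] by (simp add: \<mu>_def)
    note cM = quasi_rayD(1)[OF c]
    have "\<exists>l \<sigma>. geodesic_segment M d l \<sigma> \<and> \<sigma> 0 = c 0 \<and> \<sigma> l = c n" for n
      using ex_geodesic cM by blast
    then obtain l \<sigma> where \<sigma>: "\<And>n. geodesic_segment M d (l n) (\<sigma> n)" "\<And>n. \<sigma> n 0 = c 0"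
      "\<And>n. \<sigma> n (l n) = c n" by metis
    have ln: "d (c 0) (c n) = real (l n)" for n
      using geodesic_segmentD(2)[OF \<sigma>(1)[of n], of 0 "l n"] \<sigma>(2,3)[of n] by simp
    have "eventually (\<lambda>n. k \<le> l n) sequentially" for k
    proof -
      \<comment> \<open>The lower quasi-geodesic bound \<open>n \<le> \<mu> * (l n + 1)\<close>
        forces the lengths to infinity.\<close>
      have "k \<le> l n" if "nat \<lceil>\<mu> * (real k + 1)\<rceil> \<le> n" for n
      proof (rule ccontr)
        assume "\<not> k \<le> l n"
        then have "\<mu> * (real (l n) + 1) < \<mu> * (real k + 1)"
          by (intro mult_strict_left_mono) (auto simp: \<mu>_def)
        moreover have "real n \<le> \<mu> * (real (l n) + 1)"
          using quasi_rayD(4)[OF c, of 0 n] ln[of n] by simp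
        ultimately show False using that by linarith
      qed
      then show ?thesis unfolding eventually_sequentially by blast
    qed
    then obtain r \<gamma> where r: "strict_mono r" and \<gamma>: "\<gamma> \<in> geodesic_rays M d"
      and ev: "\<And>k. eventually (\<lambda>n. \<forall>i\<le>k. \<sigma> (r n) i = \<gamma> i) sequentially"
      using geodesic_subsequence[of l \<sigma> "{c 0}"] \<sigma> cM by auto
    have close: "\<forall>i\<le>l n. \<exists>j\<le>n. d (\<sigma> n i) (c j) \<le> D" "\<forall>i\<le>n. \<exists>j\<le>l n. d (c i) (\<sigma> n j) \<le> D" for n
    proof -
      have "quasi_geodesic M d \<mu> (l n) (\<sigma> n)" "quasi_geodesic M d \<mu> n c"
        using geodesic_imp_quasi_geodesic[OF \<sigma>(1)] c by (auto simp: \<mu>_def quasi_ray_def)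
      then have "\<forall>i\<le>l n. \<exists>j\<le>n. d (\<sigma> n i) (c j) \<le> D0" "\<forall>i\<le>n. \<exists>j\<le>l n. d (c i) (\<sigma> n j) \<le> D0"
        using D0[of "l n" "\<sigma> n" n c] D0[of n c "l n" "\<sigma> n"] \<sigma>(2,3) by simp_all
      then show "\<forall>i\<le>l n. \<exists>j\<le>n. d (\<sigma> n i) (c j) \<le> D" "\<forall>i\<le>n. \<exists>j\<le>l n. d (c i) (\<sigma> n j) \<le> D"
        unfolding D_def by (meson max.coboundedI2)+
    qed
    have at: "\<exists>n. (\<forall>i\<le>k. \<sigma> (r n) i = \<gamma> i) \<and> k \<le> r n \<and> k \<le> l (r n)" for k
    proof -
      have "eventually (\<lambda>n. k \<le> l (r n)) sequentially"
        using eventually_subseq[OF r \<open>eventually (\<lambda>n. k \<le> l n) sequentially\<close>] .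
      moreover have "eventually (\<lambda>n. k \<le> r n) sequentially"
        using eventually_subseq[OF r eventually_ge_at_top[of k]] .
      ultimately have "eventually (\<lambda>n. (\<forall>i\<le>k. \<sigma> (r n) i = \<gamma> i) \<and> k \<le> r n \<and> k \<le> l (r n)) sequentially"
        using ev[of k] by eventually_elim auto
      then show ?thesis using eventually_happens'[OF sequentially_bot] by blast
    qed
    have "\<gamma> 0 = c 0" using at[of 0] \<sigma>(2) by auto
    moreover have "\<exists>j. d (\<gamma> i) (c j) \<le> D" for i
    proof -
      obtain n where "\<forall>i'\<le>i. \<sigma> (r n) i' = \<gamma> i'" "i \<le> l (r n)" using at by blast
      then show ?thesis using close(1)[of "r n"] by (metis order_refl)
    qed
    moreover have "\<exists>j. d (c i) (\<gamma> j) \<le> D" for i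
    proof -
      \<comment> \<open>A point of a geodesic near \<open>c i\<close> has its parameter bounded in
        terms of \<open>i\<close>, so it stays in the initial segment on which that geodesic agrees
        with \<open>\<gamma>\<close>.\<close>
      define k where "k = nat \<lceil>\<mu> * real i + D\<rceil>"
      obtain n where n: "\<forall>i'\<le>max i k. \<sigma> (r n) i' = \<gamma> i'" "max i k \<le> r n" using at by blast
      then obtain j where j: "j \<le> l (r n)" "d (c i) (\<sigma> (r n) j) \<le> D" using close(2)[of "r n"] by auto
      have "real j = d (\<sigma> (r n) 0) (\<sigma> (r n) j)" using geodesic_segmentD(2)[OF \<sigma>(1)] j by simp
      also have "\<dots> \<le> d (c 0) (c i) + D"
        using d_triangle[of "c 0" "c i" "\<sigma> (r n) j"] cM geodesic_segmentD(1)[OF \<sigma>(1)] j \<sigma>(2) by force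
      also have "\<dots> \<le> \<mu> * real i + D" using quasi_rayD(3)[OF c, of 0 i] by simp
      finally have "j \<le> k" unfolding k_def by linarith
      then have "\<sigma> (r n) j = \<gamma> j" using n(1) by simp
      then show ?thesis using j by auto
    qed
    ultimately show ?thesis using \<gamma> by blast
  qed
  then show ?thesis using that[of D] by (simp add: D_def)
qed

lemma ex_geodesic_ray_in_limit_class:
  assumes "quasi_ray \<kappa> c"
  obtains \<gamma> where "\<gamma> \<in> geodesic_rays M d" "\<gamma> 0 = c 0" "finite_Hausdorff_dist d (range c) (range \<gamma>)"
    "limit_class c = limit_class \<gamma>"
proof -
  obtain D \<gamma> where \<gamma>: "\<gamma> \<in> geodesic_rays M d" "\<gamma> 0 = c 0" "\<forall>i. \<exists>j. d (\<gamma> i) (c j) \<le> D"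
    "\<forall>i. \<exists>j. d (c i) (\<gamma> j) \<le> D" using quasi_ray_near_geodesic_ray[of \<kappa>] assms by metis
  note cM = quasi_rayD(1)[OF assms]
  have "\<exists>i. d (c i) (\<gamma> j) \<le> D" for j
    using \<gamma>(3) d_commute[OF geodesic_raysD(1)[OF \<gamma>(1)] cM] by metis
  then have "finite_Hausdorff_dist d (range c) (range \<gamma>)"
    using \<gamma>(4) by (intro finite_Hausdorff_dist_range[where C=D]) auto
  then show ?thesis using that[of \<gamma>] \<gamma> limit_class_cong[of c \<gamma>] quasi_rayD(2)[OF assms] range_geodesic_ray
    by blast
qed

lemma limit_class_in_boundary: "quasi_ray \<kappa> c \<Longrightarrow> limit_class c \<in> Gromov_boundary M d"
  by (metis Gromov_boundary_eq ex_geodesic_ray_in_limit_class imageI)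

text \<open>Openness can be tested only on geodesic rays that share an initial segment, while the
  \<open>c n\<close> are quasi-rays. If infinitely many of their classes stayed outside
  \<open>U\<close>, geodesic rays close to these \<open>c n\<close> would subconverge to a ray close
  to \<open>e\<close>, hence in the class of \<open>e\<close>, and openness of \<open>U\<close> at
  that ray would be violated.\<close>

lemma eventually_limit_class_in_open:
  assumes \<kappa>: "1 \<le> \<kappa>" and c: "eventually (\<lambda>n. quasi_ray \<kappa> (c n)) sequentially" and e: "quasi_ray \<kappa> e"
    and lim: "\<And>k. eventually (\<lambda>n. \<forall>i\<le>k. c n i = e i) sequentially"
    and U: "openin (boundary_topology M d) U" "limit_class e \<in> U"
  shows "eventually (\<lambda>n. limit_class (c n) \<in> U) sequentially"
proof (rule ccontr)
  assume not_ev: "\<not> eventually (\<lambda>n. limit_class (c n) \<in> U) sequentially"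
  \<comment> \<open>Asking also for \<open>c n 0 = e 0\<close> gives the nearby geodesic rays a
    common origin, from which a limit ray can be extracted.\<close>
  define A where "A = {n. quasi_ray \<kappa> (c n) \<and> c n 0 = e 0 \<and> limit_class (c n) \<notin> U}"
  have "infinite A"
  proof (rule notI)
    assume "finite A"
    then obtain N where N: "\<And>n. n \<in> A \<Longrightarrow> n < N" unfolding finite_nat_set_iff_bounded by auto
    have "eventually (\<lambda>n. limit_class (c n) \<in> U) sequentially"
      using c lim[of 0] eventually_ge_at_top[of N]
    proof eventually_elim
      case (elim n)
      have "n \<notin> A" using N[of n] elim(3) by auto
      then show ?case using elim by (simp add: A_def)
    qed
    then show False using not_ev by blast
  qed
  then obtain r :: "nat \<Rightarrow> nat" where r: "strict_mono r" "\<And>n. r n \<in> A"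
    using infinite_enumerate by blast
  obtain D where D: "0 \<le> D" "\<And>c. quasi_ray \<kappa> c \<Longrightarrow> \<exists>\<gamma>\<in>geodesic_rays M d. \<gamma> 0 = c 0 \<and>
    (\<forall>i. \<exists>j. d (\<gamma> i) (c j) \<le> D) \<and> (\<forall>i. \<exists>j. d (c i) (\<gamma> j) \<le> D)"
    using quasi_ray_near_geodesic_ray by metis
  have qr: "quasi_ray \<kappa> (c (r n))" for n using r(2) by (simp add: A_def)
  then have "\<exists>\<gamma>\<in>geodesic_rays M d. \<gamma> 0 = c (r n) 0 \<and>
    (\<forall>i. \<exists>j. d (\<gamma> i) (c (r n) j) \<le> D) \<and> (\<forall>i. \<exists>j. d (c (r n) i) (\<gamma> j) \<le> D)" for n
    using D(2) by blast
  then obtain \<sigma> where \<sigma>: "\<And>n. \<sigma> n \<in> geodesic_rays M d" "\<And>n. \<sigma> n 0 = c (r n) 0"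
    "\<And>n i. \<exists>j. d (\<sigma> n i) (c (r n) j) \<le> D" "\<And>n i. \<exists>j. d (c (r n) i) (\<sigma> n j) \<le> D" by metis
  have \<sigma>0: "\<sigma> n 0 = e 0" for n using \<sigma>(2) r(2)[of n] by (simp add: A_def)
  have seg: "geodesic_segment M d n (\<sigma> n)" for n using geodesic_raysD(3)[OF \<sigma>(1)] .
  have inB: "\<sigma> n 0 \<in> {e 0}" for n using \<sigma>0 by simp
  obtain s \<gamma> where s: "strict_mono s" and \<gamma>: "\<gamma> \<in> geodesic_rays M d"
      and ev: "\<And>k. eventually (\<lambda>n. \<forall>i\<le>k. \<sigma> (s n) i = \<gamma> i) sequentially"
    using geodesic_subsequence[of "\<lambda>n. n" \<sigma> "{e 0}", OF seg inB] quasi_rayD(1)[OF e] eventually_ge_at_top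
    by blast
  have at: "\<exists>n. (\<forall>i\<le>k. \<sigma> (s n) i = \<gamma> i) \<and> (\<forall>i\<le>k. c (r (s n)) i = e i)" for k
  proof -
    have "eventually (\<lambda>n. \<forall>i\<le>k. c (r (s n)) i = e i) sequentially"
      using eventually_subseq[OF s eventually_subseq[OF r(1) lim]] .
    then have "eventually (\<lambda>n. (\<forall>i\<le>k. \<sigma> (s n) i = \<gamma> i) \<and> (\<forall>i\<le>k. c (r (s n)) i = e i)) sequentially"
      using ev eventually_conj by blast
    then show ?thesis using eventually_happens'[OF sequentially_bot] by blast
  qed
  note cM = quasi_rayD(1)[OF qr]
  have \<sigma>M: "\<sigma> n i \<in> M" for n i using geodesic_raysD(1)[OF \<sigma>(1)] .
  have near1: "\<exists>j. d (e j) (\<gamma> i) \<le> D" for i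
  proof -
    \<comment> \<open>Bounds, uniformly in \<open>n\<close>, the index at which the quasi-ray comes
      near the \<open>i\<close>-th point of the geodesic ray, so that agreement with
      \<open>e\<close> up to \<open>k\<close> is enough. The next estimate is the mirror
      image.\<close>
    define k where "k = max i (nat \<lceil>\<kappa> * (real i + D + 1)\<rceil>)"
    obtain n where n: "\<forall>i\<le>k. \<sigma> (s n) i = \<gamma> i" "\<forall>i\<le>k. c (r (s n)) i = e i" using at by blast
    obtain j where j: "d (\<sigma> (s n) i) (c (r (s n)) j) \<le> D" using \<sigma>(3) by blast
    have "d (c (r (s n)) 0) (c (r (s n)) j) \<le> d (\<sigma> (s n) 0) (\<sigma> (s n) i) + D"
      using d_triangle[of "\<sigma> (s n) 0" "\<sigma> (s n) i" "c (r (s n)) j"] \<sigma>M cM j \<sigma>(2) by force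
    also have "\<dots> = real i + D" using geodesic_raysD(2)[OF \<sigma>(1)] by simp
    finally have "\<kappa> * (d (c (r (s n)) 0) (c (r (s n)) j) + 1) \<le> \<kappa> * (real i + D + 1)"
      using \<kappa> by (intro mult_left_mono) auto
    then have "real j \<le> \<kappa> * (real i + D + 1)"
      using quasi_rayD(4)[OF qr[of "s n"], of 0 j] by simp
    then have "j \<le> k" unfolding k_def by linarith
    then have "c (r (s n)) j = e j" "\<sigma> (s n) i = \<gamma> i" using n by (auto simp: k_def)
    then show ?thesis using j d_commute[OF \<sigma>M cM] by metis
  qed
  have near2: "\<exists>j. d (e i) (\<gamma> j) \<le> D" for i
  proof -
    define k where "k = max i (nat \<lceil>\<kappa> * real i + D\<rceil>)"
    obtain n where n: "\<forall>i\<le>k. \<sigma> (s n) i = \<gamma> i" "\<forall>i\<le>k. c (r (s n)) i = e i" using at by blast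
    obtain j where j: "d (c (r (s n)) i) (\<sigma> (s n) j) \<le> D" using \<sigma>(4) by blast
    have "real j = d (\<sigma> (s n) 0) (\<sigma> (s n) j)" using geodesic_raysD(2)[OF \<sigma>(1)] by simp
    also have "\<dots> \<le> d (c (r (s n)) 0) (c (r (s n)) i) + D"
      using d_triangle[of "c (r (s n)) 0" "c (r (s n)) i" "\<sigma> (s n) j"] \<sigma>M cM j \<sigma>(2) by force
    also have "\<dots> \<le> \<kappa> * real i + D" using quasi_rayD(3)[OF qr, of "s n" 0 i] by simp
    finally have "j \<le> k" unfolding k_def by linarith
    then have "\<sigma> (s n) j = \<gamma> j" "c (r (s n)) i = e i" using n by (auto simp: k_def)
    then show ?thesis using j by metis
  qed
  have "limit_class e = limit_class \<gamma>"
    using near1 near2 limit_class_eq_iff[OF quasi_rayD(2)[OF e] \<gamma>] finite_Hausdorff_dist_range by blast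
  then have "limit_class \<gamma> \<in> U" using U by simp
  then obtain k where k: "\<And>\<gamma>'. \<gamma>' \<in> geodesic_rays M d \<Longrightarrow> \<forall>i\<le>k. \<gamma>' i = \<gamma> i \<Longrightarrow> limit_class \<gamma>' \<in> U"
    using U(1) \<gamma> unfolding openin_boundary by blast
  obtain n where "\<forall>i\<le>k. \<sigma> (s n) i = \<gamma> i" using at by blast
  then have "limit_class (\<sigma> (s n)) \<in> U" using k \<sigma>(1) by blast
  moreover have "finite_Hausdorff_dist d (range (c (r (s n)))) (range (\<sigma> (s n)))"
  proof (rule finite_Hausdorff_dist_range)
    show "\<exists>j. d (c (r (s n)) i) (\<sigma> (s n) j) \<le> D" for i using \<sigma>(4) .
    show "\<exists>i. d (c (r (s n)) i) (\<sigma> (s n) j) \<le> D" for j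
      using \<sigma>(3)[of "s n" j] d_commute[OF \<sigma>M cM] by metis
  qed
  then have "limit_class (c (r (s n))) = limit_class (\<sigma> (s n))"
    using limit_class_eq_iff[OF quasi_rayD(2)[OF qr] \<sigma>(1)] by blast
  moreover have "limit_class (c (r (s n))) \<notin> U" using r(2)[of "s n"] by (simp add: A_def)
  ultimately show False by simp
qed

end

section \<open>Maps of the boundary and its dynamics\<close>

context proper_stable_space
begin

text \<open>The upper bound carries no additive constant. Since distances are integral and vanish
  only on the diagonal, a general quasi-isometric embedding of such a space satisfies it after
  enlarging \<open>A\<close>.\<close>

definition quasi_isometric_embedding :: "real \<Rightarrow> ('a \<Rightarrow> 'a) \<Rightarrow> bool" where
  "quasi_isometric_embedding A f \<longleftrightarrow> (\<forall>x\<in>M. f x \<in> M) \<and>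
     (\<forall>x\<in>M. \<forall>y\<in>M. d (f x) (f y) \<le> A * d x y \<and> d x y \<le> A * (d (f x) (f y) + 1))"

lemma quasi_isometric_embeddingD:
  assumes "quasi_isometric_embedding A f" "x \<in> M"
  shows "f x \<in> M" "y \<in> M \<Longrightarrow> d (f x) (f y) \<le> A * d x y"
    "y \<in> M \<Longrightarrow> d x y \<le> A * (d (f x) (f y) + 1)"
  using assms by (auto simp: quasi_isometric_embedding_def)

lemma quasi_ray_compose:
  assumes f: "quasi_isometric_embedding A f" and c: "quasi_ray \<kappa> c" and "0 \<le> A" "0 \<le> \<kappa>"
  shows "quasi_ray (\<kappa> * (A + 1)) (f \<circ> c)"
proof (rule quasi_rayI)
  note M = quasi_rayD(1)[OF c]
  fix i j :: nat
  show fM: "(f \<circ> c) i \<in> M" for i using M quasi_isometric_embeddingD(1)[OF f] by simp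
  assume ij: "i \<le> j"
  have "d ((f \<circ> c) i) ((f \<circ> c) j) \<le> A * d (c i) (c j)"
    using quasi_isometric_embeddingD(2)[OF f M M] by simp
  also have "\<dots> \<le> A * (\<kappa> * (real j - real i))"
    using quasi_rayD(3)[OF c, of i j] ij assms by (intro mult_left_mono) auto
  also have "\<dots> \<le> \<kappa> * (A + 1) * (real j - real i)" using assms ij by (simp add: algebra_simps mult_left_mono)
  finally show "d ((f \<circ> c) i) ((f \<circ> c) j) \<le> \<kappa> * (A + 1) * (real j - real i)" .
  have nn: "0 \<le> d ((f \<circ> c) i) ((f \<circ> c) j)" using d_nonneg fM by blast
  have "real j - real i \<le> \<kappa> * (d (c i) (c j) + 1)" using quasi_rayD(4)[OF c, of i j] ij by simp
  also have "\<dots> \<le> \<kappa> * (A * (d ((f \<circ> c) i) ((f \<circ> c) j) + 1) + 1)"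
    using quasi_isometric_embeddingD(3)[OF f M M, of i j] assms by (intro mult_left_mono) auto
  also have "\<dots> \<le> \<kappa> * ((A + 1) * (d ((f \<circ> c) i) ((f \<circ> c) j) + 1))"
    using nn assms by (intro mult_left_mono) (auto simp: algebra_simps)
  finally show "real j - real i \<le> \<kappa> * (A + 1) * (d ((f \<circ> c) i) ((f \<circ> c) j) + 1)"
    by (simp add: mult.assoc)
qed

lemma finite_Hausdorff_dist_image:
  assumes f: "quasi_isometric_embedding A f" and "0 \<le> A" and M: "X \<subseteq> M" "Y \<subseteq> M"
    and "finite_Hausdorff_dist d X Y"
  shows "finite_Hausdorff_dist d (f ` X) (f ` Y)"
proof -
  obtain C where C: "\<And>a. a \<in> X \<Longrightarrow> \<exists>b\<in>Y. d a b \<le> C" "\<And>b. b \<in> Y \<Longrightarrow> \<exists>a\<in>X. d a b \<le> C"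
    using assms unfolding finite_Hausdorff_dist_def by blast
  have *: "d (f x) (f y) \<le> A * C" if "x \<in> X" "y \<in> Y" "d x y \<le> C" for x y
  proof -
    have "d (f x) (f y) \<le> A * d x y" using quasi_isometric_embeddingD(2)[OF f] that M by blast
    also have "\<dots> \<le> A * C" using that assms(2) by (intro mult_left_mono)
    finally show ?thesis .
  qed
  have "\<exists>y\<in>Y. d (f x) (f y) \<le> A * C" if "x \<in> X" for x using C(1)[OF that] * that by blast
  moreover have "\<exists>x\<in>X. d (f x) (f y) \<le> A * C" if "y \<in> Y" for y using C(2)[OF that] * that by blast
  ultimately show ?thesis unfolding finite_Hausdorff_dist_def by (intro exI[of _ "A * C"]) auto
qed

text \<open>\<open>boundary_map\<close> collects the rays near the image of some member of the
  class. All these images are at finite Hausdorff distance from \<open>f \<circ> c\<close>, so the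
  union is taken over equal sets, and the index set is nonempty because the class of a quasi-ray
  contains a geodesic ray.\<close>

lemma boundary_map_limit_class:
  assumes f: "quasi_isometric_embedding A f" and "0 \<le> A" and c: "quasi_ray \<kappa> c"
  shows "boundary_map M d f (limit_class c) = limit_class (f \<circ> c)"
proof -
  note cM = quasi_rayD(2)[OF c]
  have fM: "range (f \<circ> e) \<subseteq> M" if "range e \<subseteq> M" for e :: "nat \<Rightarrow> 'a"
    using that quasi_isometric_embeddingD(1)[OF f] by auto
  have same: "limit_class (f \<circ> c) = limit_class (f \<circ> \<gamma>)" if "\<gamma> \<in> limit_class c" for \<gamma>
  proof -
    have \<gamma>: "range \<gamma> \<subseteq> M" "finite_Hausdorff_dist d (range c) (range \<gamma>)"
      using that range_geodesic_ray by (auto simp: limit_class_def)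
    have "finite_Hausdorff_dist d (range (f \<circ> c)) (range (f \<circ> \<gamma>))"
      using finite_Hausdorff_dist_image[OF f \<open>0 \<le> A\<close> cM \<gamma>] by (simp add: image_comp)
    then show ?thesis using limit_class_cong fM cM \<gamma>(1) by blast
  qed
  obtain \<gamma>0 where \<gamma>0: "\<gamma>0 \<in> geodesic_rays M d" "limit_class c = limit_class \<gamma>0"
    using ex_geodesic_ray_in_limit_class[OF c] by metis
  have "\<gamma>0 \<in> limit_class c" using limit_class_self \<gamma>0 by blast
  moreover have "boundary_map M d f (limit_class c) = (\<Union>\<gamma>\<in>limit_class c. limit_class (f \<circ> \<gamma>))"
    by (auto simp: boundary_map_def limit_class_def)
  moreover have "(\<Union>\<gamma>\<in>limit_class c. limit_class (f \<circ> \<gamma>)) = (\<Union>\<gamma>\<in>limit_class c. limit_class (f \<circ> c))"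
    using same by simp
  ultimately show ?thesis by auto
qed

lemma limit_class_bounded_distance:
  assumes "\<And>i. c i \<in> M" "\<And>i. c' i \<in> M" "\<And>i. d (c i) (c' i) \<le> C"
  shows "limit_class c = limit_class c'"
  using assms by (intro limit_class_cong finite_Hausdorff_dist_range[where C=C]) auto

lemma boundary_point_cases:
  assumes "\<xi> \<in> Gromov_boundary M d"
  obtains \<gamma> where "\<gamma> \<in> geodesic_rays M d" "\<xi> = limit_class \<gamma>"
  using assms by (auto simp: Gromov_boundary_eq)

text \<open>A failure of openness at \<open>\<gamma>\<close> yields rays that agree with
  \<open>\<gamma>\<close> on ever longer pieces. Their images are quasi-rays with one common
  constant that agree with \<open>f \<circ> \<gamma>\<close> on the same pieces, so
  \<open>eventually_limit_class_in_open\<close> applies.\<close>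

lemma continuous_map_boundary_map:
  assumes f: "quasi_isometric_embedding A f" and "0 \<le> A"
  shows "continuous_map (boundary_topology M d) (boundary_topology M d) (boundary_map M d f)"
  unfolding continuous_map_def topspace_boundary_topology
proof (intro conjI allI impI)
  define B where "B = A + 1"
  have ray: "quasi_ray B (f \<circ> \<gamma>)" "boundary_map M d f (limit_class \<gamma>) = limit_class (f \<circ> \<gamma>)"
    if "\<gamma> \<in> geodesic_rays M d" for \<gamma>
    using quasi_ray_compose[OF f geodesic_ray_imp_quasi_ray[OF that order_refl]]
      boundary_map_limit_class[OF f \<open>0 \<le> A\<close> geodesic_ray_imp_quasi_ray[OF that order_refl]] \<open>0 \<le> A\<close>
    by (simp_all add: B_def)
  show maps: "boundary_map M d f \<in> Gromov_boundary M d \<rightarrow> Gromov_boundary M d"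
  proof
    fix \<xi> assume "\<xi> \<in> Gromov_boundary M d"
    then obtain \<gamma> where "\<gamma> \<in> geodesic_rays M d" "\<xi> = limit_class \<gamma>" by (rule boundary_point_cases)
    then show "boundary_map M d f \<xi> \<in> Gromov_boundary M d"
      using ray limit_class_in_boundary by metis
  qed
  fix U assume U: "openin (boundary_topology M d) U"
  show "openin (boundary_topology M d) {\<xi> \<in> Gromov_boundary M d. boundary_map M d f \<xi> \<in> U}"
    unfolding openin_boundary
  proof (intro conjI ballI impI)
    fix \<gamma> assume \<gamma>: "\<gamma> \<in> geodesic_rays M d"
      "limit_class \<gamma> \<in> {\<xi> \<in> Gromov_boundary M d. boundary_map M d f \<xi> \<in> U}"
    show "\<exists>k. \<forall>\<gamma>'\<in>geodesic_rays M d. (\<forall>i\<le>k. \<gamma>' i = \<gamma> i) \<longrightarrow>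
      limit_class \<gamma>' \<in> {\<xi> \<in> Gromov_boundary M d. boundary_map M d f \<xi> \<in> U}"
    proof (rule ccontr)
      assume "\<not> ?thesis"
      then have "\<forall>k. \<exists>\<gamma>'\<in>geodesic_rays M d. (\<forall>i\<le>k. \<gamma>' i = \<gamma> i) \<and> limit_class (f \<circ> \<gamma>') \<notin> U"
        using ray by (auto simp: Gromov_boundary_eq)
      then obtain c where c: "\<And>k. c k \<in> geodesic_rays M d" "\<And>k i. i \<le> k \<Longrightarrow> c k i = \<gamma> i"
        "\<And>k. limit_class (f \<circ> c k) \<notin> U" by metis
      have "eventually (\<lambda>n. limit_class (f \<circ> c n) \<in> U) sequentially"
      proof (rule eventually_limit_class_in_open[OF _ _ _ _ U])
        show "1 \<le> B" using \<open>0 \<le> A\<close> by (simp add: B_def)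
        show "eventually (\<lambda>n. quasi_ray B (f \<circ> c n)) sequentially"
          using ray c(1) by (intro always_eventually) blast
        show "quasi_ray B (f \<circ> \<gamma>)" "limit_class (f \<circ> \<gamma>) \<in> U" using ray \<gamma> by auto
        show "eventually (\<lambda>n. \<forall>i\<le>k. (f \<circ> c n) i = (f \<circ> \<gamma>) i) sequentially" for k
          using eventually_ge_at_top[of k] by eventually_elim (auto simp: c(2))
      qed
      then show False using c(3) by simp
    qed
  qed auto
qed

section \<open>Change of origin and convergence dynamics\<close>

lemma finite_Hausdorff_dist_insert:
  assumes "x \<in> M" "X \<subseteq> M" "X \<noteq> {}"
  shows "finite_Hausdorff_dist d (insert x X) X"
proof -
  obtain y where y: "y \<in> X" using assms by blast
  have nn: "0 \<le> d x y" using d_nonneg y assms by blast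
  have "\<exists>b\<in>X. d a b \<le> d x y" if "a \<in> insert x X" for a
  proof (cases "a = x")
    case True
    then show ?thesis using y by (intro bexI[of _ y]) auto
  next
    case False
    then have "a \<in> X" "a \<in> M" using that assms by auto
    then show ?thesis using d_refl[of a] nn by (intro bexI[of _ a]) auto
  qed
  moreover have "\<exists>a\<in>insert x X. d a b \<le> d x y" if "b \<in> X" for b
    using that d_refl[of b] nn assms by (intro bexI[of _ b]) auto
  ultimately show ?thesis unfolding finite_Hausdorff_dist_def by blast
qed

lemma finite_Hausdorff_dist_Un:
  assumes "finite Y" "Y \<subseteq> M" "X \<subseteq> M" "X \<noteq> {}"
  shows "finite_Hausdorff_dist d (Y \<union> X) X"
  using assms
proof (induction Y rule: finite_induct)
  case empty
  then show ?case by (simp add: finite_Hausdorff_dist_refl)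
next
  case (insert y Y)
  have M: "insert y (Y \<union> X) \<subseteq> M" "Y \<union> X \<subseteq> M" "X \<subseteq> M" using insert.prems by auto
  have "finite_Hausdorff_dist d (insert y (Y \<union> X)) (Y \<union> X)"
    by (rule finite_Hausdorff_dist_insert) (use insert.prems in auto)
  moreover have "finite_Hausdorff_dist d (Y \<union> X) X" using insert M by blast
  ultimately have "finite_Hausdorff_dist d (insert y (Y \<union> X)) X"
    by (rule finite_Hausdorff_dist_trans[OF M])
  then show ?case by simp
qed

text \<open>Prepending \<open>x\<close> to a representing ray creates one jump of length
  \<open>J\<close>, which the quasi-ray constant absorbs; a geodesic ray near the result can then be
  taken to start at \<open>x\<close>. This is for linear divergence, which compares paths with a
  common origin.\<close>

lemma boundary_point_from:
  assumes x: "x \<in> M" and "\<xi> \<in> Gromov_boundary M d"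
  obtains \<gamma> where "\<gamma> \<in> geodesic_rays M d" "\<gamma> 0 = x" "\<xi> = limit_class \<gamma>"
proof -
  obtain \<eta> where \<eta>: "\<eta> \<in> geodesic_rays M d" "\<xi> = limit_class \<eta>"
    by (rule boundary_point_cases[OF assms(2)])
  note \<eta>M = geodesic_raysD(1)[OF \<eta>(1)] and \<eta>d = geodesic_raysD(2)[OF \<eta>(1)]
  define J where "J = d x (\<eta> 0)"
  have J: "0 \<le> J" using d_nonneg x \<eta>M by (simp add: J_def)
  define c where "c = case_nat x \<eta>"
  have "quasi_ray (J + 2) c"
  proof (rule quasi_rayI)
    show cM: "c i \<in> M" for i using x \<eta>M by (simp add: c_def split: nat.split)
    have from_x: "d x (\<eta> j) \<le> J + real j" "real j \<le> d x (\<eta> j) + J" for j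
      using d_triangle[of x "\<eta> 0" "\<eta> j"] d_triangle[of "\<eta> 0" x "\<eta> j"] d_commute[of x "\<eta> 0"] x \<eta>M \<eta>d[of 0 j]
      by (auto simp: J_def)
    fix i j :: nat assume ij: "i \<le> j"
    have dcc: "d (c i) (c j) \<le> (J + 2) * (real j - real i) \<and>
      real j - real i \<le> (J + 2) * (d (c i) (c j) + 1)"
    proof (cases j)
      case 0
      then show ?thesis using ij d_refl[OF x] J by (simp add: c_def)
    next
      case (Suc j')
      show ?thesis
      proof (cases i)
        case 0
        have nn: "0 \<le> d x (\<eta> j')" using d_nonneg x \<eta>M by blast
        define q where "q = d x (\<eta> j')"
        have "J + real j' \<le> (J + 2) * (real j' + 1)" "q + J + 1 \<le> (J + 2) * (q + 1)"
          using nn J by (simp_all add: q_def algebra_simps add_nonneg_nonneg)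
        then have "d x (\<eta> j') \<le> (J + 2) * (real j' + 1)"
          "real j' + 1 \<le> (J + 2) * (d x (\<eta> j') + 1)"
          using from_x[of j'] unfolding q_def by linarith+
        moreover have "c i = x" "c j = \<eta> j'" "real j - real i = real j' + 1"
          using Suc 0 by (simp_all add: c_def)
        ultimately show ?thesis by simp
      next
        case (Suc i')
        have "1 * (real j' - real i') \<le> (J + 2) * (real j' - real i')"
          using J ij Suc \<open>j = Suc j'\<close> by (intro mult_right_mono) auto
        moreover have "1 * (real j' - real i') \<le> (J + 2) * (real j' - real i' + 1)"
          using J ij Suc \<open>j = Suc j'\<close> by (intro mult_mono) auto
        ultimately show ?thesis using ij Suc \<open>j = Suc j'\<close> \<eta>d[of i' j'] by (simp add: c_def)
      qed
    qed
    then show "d (c i) (c j) \<le> (J + 2) * (real j - real i)"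
      "real j - real i \<le> (J + 2) * (d (c i) (c j) + 1)" by auto
  qed
  then obtain \<gamma> where \<gamma>: "\<gamma> \<in> geodesic_rays M d" "\<gamma> 0 = c 0" "limit_class c = limit_class \<gamma>"
    using ex_geodesic_ray_in_limit_class by metis
  have "range c = insert x (range \<eta>)"
    unfolding c_def by (subst UNIV_nat_eq) (simp add: image_image)
  then have "limit_class c = limit_class \<eta>"
    using finite_Hausdorff_dist_insert[of x "range \<eta>"] x range_geodesic_ray[OF \<eta>(1)]
    by (intro limit_class_cong) auto
  then show ?thesis using that[of \<gamma>] \<gamma> \<eta>(2) by (simp add: c_def)
qed

text \<open>
  A geodesic followed up to the point nearest to \<open>u\<close> and then left towards \<open>u\<close> is a
  3-quasi-geodesic, so stability makes it follow any other geodesic to \<open>u\<close>.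
\<close>

lemma linear_divergence:
  assumes D: "\<And>m n c c'. quasi_geodesic M d 3 m c \<Longrightarrow> quasi_geodesic M d 3 n c' \<Longrightarrow>
      c 0 = c' 0 \<Longrightarrow> c m = c' n \<Longrightarrow> \<forall>i\<le>m. \<exists>j\<le>n. d (c i) (c' j) \<le> D"
    and \<beta>: "geodesic_segment M d m \<beta>" and \<eta>: "\<eta> \<in> geodesic_rays M d" and start: "\<beta> 0 = \<eta> 0"
    and R: "2 * D < d (\<beta> R) (\<eta> R)" "R \<le> m" and a: "a \<le> m"
  shows "real a + real b \<le> 3 * d (\<beta> a) (\<eta> b) + 2 * real R"
proof -
  have \<beta>M: "\<beta> i \<in> M" if "i \<le> m" for i using geodesic_segmentD(1)[OF \<beta> that that] .
  note \<beta>d = geodesic_segmentD(2)[OF \<beta>]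
    and \<eta>M = geodesic_raysD(1)[OF \<eta>] and \<eta>d = geodesic_raysD(2)[OF \<eta>]
  define u where "u = \<eta> b"
  obtain k where k: "k \<le> m" "\<And>i. i \<le> m \<Longrightarrow> d (\<beta> k) u \<le> d (\<beta> i) u"
  proof -
    have "Min ((\<lambda>i. d (\<beta> i) u) ` {..m}) \<in> (\<lambda>i. d (\<beta> i) u) ` {..m}" by (rule Min_in) auto
    then obtain k where "k \<le> m" "d (\<beta> k) u = Min ((\<lambda>i. d (\<beta> i) u) ` {..m})" by force
    then show ?thesis using that[of k] by simp
  qed
  have M: "\<And>i. i \<le> m \<Longrightarrow> \<beta> i \<in> M" "u \<in> M" using \<beta>M \<eta>M by (auto simp: u_def)
  obtain e \<tau> where \<tau>: "geodesic_segment M d e \<tau>" "\<tau> 0 = \<beta> k" "\<tau> e = u"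
    using ex_geodesic[OF M(1)[OF k(1)] M(2)] by blast
  note \<tau>d = geodesic_segmentD(2)[OF \<tau>(1)]
  have \<tau>M: "\<tau> l \<in> M" if "l \<le> e" for l using geodesic_segmentD(1)[OF \<tau>(1) that that] .
  have dk: "d (\<beta> k) u = real e" using \<tau>d[of 0 e] \<tau>(2,3) by simp
  \<comment> \<open>Since \<open>\<beta> k\<close> is nearest to \<open>u\<close>,
    \<open>d (\<beta> i) (\<tau> l)\<close> is at least \<open>l\<close>; the triangle inequality
    also makes it at least \<open>k - i - l\<close>. Adding twice the first bound to the second
    yields the factor 3.\<close>
  have proj: "real l + (real k - real i) \<le> 3 * d (\<beta> i) (\<tau> l)" if "i \<le> k" "l \<le> e" for i l
  proof -
    have i: "i \<le> m" using that k by simp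
    have "d (\<beta> i) u \<le> d (\<beta> i) (\<tau> l) + d (\<tau> l) u" 
      using d_triangle[OF M(1)[OF i] \<tau>M[OF that(2)] M(2)] .
    then have 1: "real l \<le> d (\<beta> i) (\<tau> l)"
      using k(2)[OF i] dk \<tau>d[of l e] \<tau>(3) that by simp
    have "d (\<beta> i) (\<beta> k) \<le> d (\<beta> i) (\<tau> l) + d (\<tau> l) (\<beta> k)" 
      using d_triangle[OF M(1)[OF i] \<tau>M[OF that(2)] M(1)[OF k(1)]] .
    then have "real k - real i \<le> d (\<beta> i) (\<tau> l) + real l"
      using \<beta>d[OF i k(1)] \<tau>d[of l 0] \<tau>(2) that by simp
    then show ?thesis using 1 by simp
  qed
  define B where "B i = (if i \<le> k then \<beta> i else \<tau> (i - k))" for i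
  have Bgt: "B i = \<tau> (i - k)" if "k \<le> i" for i using that \<tau>(2) by (auto simp: B_def)
  have BM: "B i \<in> M" if "i \<le> k + e" for i using that M k \<tau>M[of "i - k"] by (auto simp: B_def)
  have "quasi_geodesic M d 3 (k + e) B"
  proof (rule quasi_geodesicI[OF BM])
    fix i j assume ij: "i \<le> j" "j \<le> k + e"
    have "d (B i) (B j) \<le> real j - real i \<and> real j - real i \<le> 3 * d (B i) (B j)"
    proof (cases "j \<le> k")
      case True
      then show ?thesis using ij k \<beta>d[of i j] by (simp add: B_def)
    next
      case False
      show ?thesis
      proof (cases "k \<le> i")
        case True
        then show ?thesis using ij False \<tau>d[of "i - k" "j - k"] by (simp add: Bgt of_nat_diff)
      next
        case ik: False
        have "real (j - k) + (real k - real i) \<le> 3 * d (\<beta> i) (\<tau> (j - k))"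
          using proj[of i "j - k"] ik ij by simp
        moreover have "d (\<beta> i) (\<tau> (j - k)) \<le> d (\<beta> i) (\<beta> k) + d (\<beta> k) (\<tau> (j - k))"
          using d_triangle M k ik ij \<tau>M[of "j - k"] by simp
        moreover have "d (\<beta> i) (\<beta> k) = real k - real i" using \<beta>d[of i k] ik k by simp
        moreover have "d (\<beta> k) (\<tau> (j - k)) = real (j - k)" using \<tau>d[of 0 "j - k"] \<tau>(2) ij by simp
        ultimately show ?thesis using False ik by (simp add: B_def of_nat_diff)
      qed
    qed
    then show "d (B i) (B j) \<le> 3 * (real j - real i)" "real j - real i \<le> 3 * (d (B i) (B j) + 1)"
      using ij by auto
  qed
  moreover have "quasi_geodesic M d 3 b \<eta>"
    using geodesic_imp_quasi_geodesic[OF geodesic_raysD(3)[OF \<eta>]] by simp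
  moreover have "B 0 = \<eta> 0" "B (k + e) = \<eta> b" using start \<tau>(3) Bgt[of "k + e"]
    by (simp_all add: u_def, simp add: B_def)
  ultimately have near: "\<forall>i\<le>k + e. \<exists>j\<le>b. d (B i) (\<eta> j) \<le> D" using D by blast
  \<comment> \<open>Otherwise \<open>\<beta> R\<close> lies on the broken path, so it is within
    \<open>D\<close> of some \<open>\<eta> j\<close>. Comparing distances to the common origin gives
    \<open>\<bar>j - R\<bar> \<le> D\<close>, and \<open>\<beta> R\<close> would be within
    \<open>2 * D\<close> of \<open>\<eta> R\<close>.\<close>
  have "k < R"
  proof (rule ccontr)
    assume "\<not> k < R"
    then have "B R = \<beta> R" by (simp add: B_def)
    then obtain j where j: "d (\<beta> R) (\<eta> j) \<le> D" using near \<open>\<not> k < R\<close> by (metis linorder_not_less trans_le_add1)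
    have bR: "\<beta> R \<in> M" "\<beta> 0 \<in> M" using M R by auto
    have "d (\<beta> 0) (\<beta> R) = real R" "d (\<eta> 0) (\<eta> j) = real j" using \<beta>d[of 0 R] \<eta>d[of 0 j] R by auto
    then have "\<bar>real j - real R\<bar> \<le> D"
      using d_triangle[of "\<beta> 0" "\<beta> R" "\<eta> j"] d_triangle[of "\<eta> 0" "\<eta> j" "\<beta> R"] d_commute[of "\<eta> j" "\<beta> R"] bR \<eta>M j start
      by simp
    then have "d (\<eta> j) (\<eta> R) \<le> D" using \<eta>d by simp
    then show False using d_triangle[of "\<beta> R" "\<eta> j" "\<eta> R"] bR \<eta>M j R by simp
  qed
  \<comment> \<open>The three estimates give
    \<open>a + b \<le> 2 * k + 2 * e + d (\<beta> a) u\<close>, where \<open>e\<close> is at most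
    \<open>d (\<beta> a) u\<close>.\<close>
  have "real b \<le> real k + real e"
    using d_triangle[of "\<beta> 0" "\<beta> k" u] M k \<beta>d[of 0 k] dk \<eta>d[of 0 b] start \<eta>M[of 0] by (simp add: u_def)
  moreover have "real e \<le> d (\<beta> a) u" using k(2)[OF a] dk by simp
  moreover have "real a \<le> real k + (d (\<beta> a) u + real e)"
    using d_triangle[of "\<beta> k" u "\<beta> a"] M k a \<beta>d[of k a] dk d_commute[of u "\<beta> a"] by simp
  ultimately show ?thesis using \<open>k < R\<close> by (simp add: u_def)
qed

text \<open>
  \<open>b\<close> is the limit of the reversed rays \<open>i \<mapsto> S n (\<gamma> (n - i))\<close>. By linear divergence, \<open>\<gamma>\<close>
  up to time \<open>r n\<close> followed by the image of \<open>\<eta>\<close> is a quasi-geodesic, uniformly in \<open>n\<close>.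
\<close>

theorem attracting_subsequence:
  fixes T S :: "nat \<Rightarrow> 'a \<Rightarrow> 'a"
  assumes \<gamma>: "\<gamma> \<in> geodesic_rays M d"
    and TM: "\<And>n x. x \<in> M \<Longrightarrow> T n x \<in> M" and SM: "\<And>n x. x \<in> M \<Longrightarrow> S n x \<in> M"
    and iso: "\<And>n x y. x \<in> M \<Longrightarrow> y \<in> M \<Longrightarrow> d (T n x) (T n y) = d x y"
    and TS: "\<And>n x. x \<in> M \<Longrightarrow> T n (S n x) = x"
    and B: "\<And>n. S n (\<gamma> n) \<in> B" "finite B" "B \<subseteq> M"
  obtains r b where "strict_mono (r :: nat \<Rightarrow> nat)" "b \<in> Gromov_boundary M d"
    "\<And>U \<eta>. openin (boundary_topology M d) U \<Longrightarrow> limit_class \<gamma> \<in> U \<Longrightarrow> \<eta> \<in> geodesic_rays M d \<Longrightarrow>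
       limit_class \<eta> \<noteq> b \<Longrightarrow> eventually (\<lambda>n. limit_class (T (r n) \<circ> \<eta>) \<in> U) sequentially"
proof -
  note \<gamma>M = geodesic_raysD(1)[OF \<gamma>] and \<gamma>d = geodesic_raysD(2)[OF \<gamma>]
  have iso_S: "d (S n x) (S n y) = d x y" if "x \<in> M" "y \<in> M" for n x y
    using iso[of "S n x" "S n y" n] SM TS that by simp
  \<comment> \<open>\<open>T n\<close> maps this segment onto \<open>\<gamma>\<close> run backwards
    from time \<open>n\<close>, while its origin \<open>S n (\<gamma> n)\<close> stays in the finite
    set \<open>B\<close>, so that a limit ray exists.\<close>
  define \<beta> where "\<beta> n i = S n (\<gamma> (n - i))" for n i
  have seg: "geodesic_segment M d n (\<beta> n)" for n
    unfolding geodesic_segment_def \<beta>_def using SM \<gamma>M iso_S \<gamma>d by (auto simp: of_nat_diff)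
  obtain r \<beta>' where r: "strict_mono r" and \<beta>': "\<beta>' \<in> geodesic_rays M d"
    and lim: "\<And>k. eventually (\<lambda>n. \<forall>i\<le>k. \<beta> (r n) i = \<beta>' i) sequentially"
    using geodesic_subsequence[of "\<lambda>n. n" \<beta> B] seg B eventually_ge_at_top by (auto simp: \<beta>_def)
  have "eventually (\<lambda>n. limit_class (T (r n) \<circ> \<eta>0) \<in> U) sequentially"
    if U: "openin (boundary_topology M d) U" "limit_class \<gamma> \<in> U" and \<eta>0: "\<eta>0 \<in> geodesic_rays M d"
      and ne: "limit_class \<eta>0 \<noteq> limit_class \<beta>'" for U \<eta>0
  proof -
    have "limit_class \<eta>0 \<in> Gromov_boundary M d" using \<eta>0 by (simp add: Gromov_boundary_eq)
    then obtain \<eta> where \<eta>: "\<eta> \<in> geodesic_rays M d" "\<eta> 0 = \<beta>' 0" "limit_class \<eta>0 = limit_class \<eta>"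
      using boundary_point_from[OF geodesic_raysD(1)[OF \<beta>', of 0]] by metis
    note \<eta>M = geodesic_raysD(1)[OF \<eta>(1)] and \<eta>d = geodesic_raysD(2)[OF \<eta>(1)]
    obtain D where D: "\<And>m n c c'. quasi_geodesic M d 3 m c \<Longrightarrow> quasi_geodesic M d 3 n c' \<Longrightarrow>
      c 0 = c' 0 \<Longrightarrow> c m = c' n \<Longrightarrow> \<forall>i\<le>m. \<exists>j\<le>n. d (c i) (c' j) \<le> D"
      using stable unfolding stable_quasi_geodesics_def by metis
    have "\<exists>R. 2 * D < d (\<beta>' R) (\<eta> R)"
    proof (rule ccontr)
      assume "\<not> ?thesis"
      then have "d (\<beta>' i) (\<eta> i) \<le> 2 * D" for i by (simp add: not_less)
      then have "limit_class \<beta>' = limit_class \<eta>"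
        using limit_class_bounded_distance geodesic_raysD(1)[OF \<beta>'] \<eta>M by blast
      then show False using ne \<eta>(3) by simp
    qed
    then obtain R where R: "2 * D < d (\<beta>' R) (\<eta> R)" by blast
    \<comment> \<open>Linear divergence has factor 3 and additive error \<open>2 * R\<close>. As
      \<open>R\<close> depends on \<open>\<eta>\<close> and \<open>\<beta>'\<close> but not on
      \<open>n\<close>, the constant is uniform.\<close>
    define \<kappa> where "\<kappa> = 3 + 2 * real R"
    define c where "c n i = (if i \<le> r n then \<gamma> i else T (r n) (\<eta> (i - r n)))" for n i
    define good where "good n \<longleftrightarrow> R \<le> r n \<and> (\<forall>i\<le>R. \<beta> (r n) i = \<beta>' i)" for n
    have ev_r: "eventually (\<lambda>n. k \<le> r n) sequentially" for k
      using eventually_subseq[OF r eventually_ge_at_top[of k]] .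
    have ev_good: "eventually good sequentially"
      unfolding good_def using ev_r[of R] lim[of R] by (rule eventually_conj)
    have cM: "c n i \<in> M" for n i using \<gamma>M \<eta>M TM by (simp add: c_def)
    have qr: "quasi_ray \<kappa> (c n)" if "good n" for n
    proof (rule quasi_rayI[OF cM])
      have div: "real a + real b \<le> 3 * d (\<beta> (r n) a) (\<eta> b) + 2 * real R" if "a \<le> r n" for a b
      proof (rule linear_divergence[OF _ seg \<eta>(1) _ _ _ that])
        show "\<forall>i\<le>m. \<exists>j\<le>n'. d (e i) (e' j) \<le> D" if "quasi_geodesic M d 3 m e"
          "quasi_geodesic M d 3 n' e'" "e 0 = e' 0" "e m = e' n'" for m n' e e'
          using that by (rule D)
        show "\<beta> (r n) 0 = \<eta> 0" "2 * D < d (\<beta> (r n) R) (\<eta> R)" "R \<le> r n"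
          using \<open>good n\<close> \<eta>(2) R by (simp_all add: good_def)
      qed
      have \<beta>0: "\<beta> (r n) 0 = \<eta> 0" using \<open>good n\<close> \<eta>(2) by (simp add: good_def)
      have T\<beta>: "T (r n) (\<beta> (r n) a) = \<gamma> (r n - a)" for a using TS \<gamma>M by (simp add: \<beta>_def)
      \<comment> \<open>At \<open>i = r n\<close> the two clauses of \<open>c\<close> agree, since
        \<open>\<eta> 0 = \<beta> (r n) 0\<close> and \<open>T (r n)\<close> sends this point to
        \<open>\<gamma> (r n)\<close>.\<close>
      have cge: "c n i = T (r n) (\<eta> (i - r n))" if "r n \<le> i" for i
        using that T\<beta>[of 0] \<beta>0 by (auto simp: c_def)
      fix i j :: nat assume ij: "i \<le> j"
      have "d (c n i) (c n j) \<le> real j - real i \<and> real j - real i \<le> 3 * d (c n i) (c n j) + 2 * real R"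
      proof (cases "j \<le> r n")
        case True
        then show ?thesis using ij \<gamma>d[of i j] by (simp add: c_def)
      next
        case False
        show ?thesis
        proof (cases "r n \<le> i")
          case True
          then show ?thesis using ij False iso[OF \<eta>M \<eta>M] \<eta>d[of "i - r n" "j - r n"]
            by (simp add: cge of_nat_diff)
        next
          case ir: False
          define a b where "a = r n - i" and "b = j - r n"
          have ab: "real j - real i = real a + real b" "a \<le> r n" using False ir by (auto simp: a_def b_def of_nat_diff)
          have \<beta>aM: "\<beta> (r n) a \<in> M" "\<beta> (r n) 0 \<in> M"
            using geodesic_segmentD(1)[OF seg, of _ "r n"] ab(2) by blast+
          have "c n i = T (r n) (\<beta> (r n) a)" "c n j = T (r n) (\<eta> b)"
            using ir False T\<beta>[of a] by (auto simp: c_def a_def b_def)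
          then have eq: "d (c n i) (c n j) = d (\<beta> (r n) a) (\<eta> b)" using iso \<beta>aM \<eta>M by simp
          have "d (\<beta> (r n) a) (\<eta> b) \<le> d (\<beta> (r n) a) (\<beta> (r n) 0) + d (\<eta> 0) (\<eta> b)"
            using d_triangle[of "\<beta> (r n) a" "\<eta> 0" "\<eta> b"] \<beta>aM \<eta>M \<beta>0 by simp
          also have "\<dots> = real a + real b"
            using geodesic_segmentD(2)[OF seg[of "r n"] ab(2), of 0] \<eta>d by simp
          finally show ?thesis using eq ab div[OF ab(2), of b] by simp
        qed
      qed
      moreover have "0 \<le> real R * d (c n i) (c n j)" "0 \<le> real R * (real j - real i)"
        using d_nonneg[OF cM cM] ij by auto
      ultimately show "d (c n i) (c n j) \<le> \<kappa> * (real j - real i)"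
        "real j - real i \<le> \<kappa> * (d (c n i) (c n j) + 1)"
        using ij by (auto simp: \<kappa>_def algebra_simps)
    qed
    have "eventually (\<lambda>n. limit_class (c n) \<in> U) sequentially"
    proof (rule eventually_limit_class_in_open[OF _ _ _ _ U])
      show "1 \<le> \<kappa>" by (simp add: \<kappa>_def)
      then show "quasi_ray \<kappa> \<gamma>" using geodesic_ray_imp_quasi_ray \<gamma> by blast
      show "eventually (\<lambda>n. quasi_ray \<kappa> (c n)) sequentially"
        using ev_good by eventually_elim (rule qr)
      show "eventually (\<lambda>n. \<forall>i\<le>k. c n i = \<gamma> i) sequentially" for k
        using ev_r[of k] by eventually_elim (auto simp: c_def)
    qed
    moreover have "limit_class (c n) = limit_class (T (r n) \<circ> \<eta>0)" if "good n" for n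
    proof -
      have T: "quasi_isometric_embedding 1 (T (r n))"
        using TM iso by (auto simp: quasi_isometric_embedding_def)
      have "limit_class (T (r n) \<circ> \<eta>0) = limit_class (T (r n) \<circ> \<eta>)"
        using boundary_map_limit_class[OF T _ geodesic_ray_imp_quasi_ray[OF \<eta>(1) order_refl]]
          boundary_map_limit_class[OF T _ geodesic_ray_imp_quasi_ray[OF \<eta>0 order_refl]] \<eta>(3) by simp
      \<comment> \<open>The initial piece of \<open>\<gamma>\<close> is finite, hence invisible to
        the limit class.\<close>
      moreover have "range (c n) = \<gamma> ` {..r n} \<union> range (T (r n) \<circ> \<eta>)"
      proof -
        have "T (r n) (\<eta> 0) = c n (r n)"
          using TS \<gamma>M that \<eta>(2) unfolding good_def \<beta>_def c_def by (metis diff_zero le0 order_refl)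
        then have "(T (r n) \<circ> \<eta>) i = c n (r n + i)" for i by (cases "i = 0") (auto simp: c_def)
        then have "range (T (r n) \<circ> \<eta>) \<subseteq> range (c n)" by auto
        moreover have "\<gamma> ` {..r n} \<subseteq> range (c n)" by (auto simp: c_def image_iff intro!: exI)
        moreover have "range (c n) \<subseteq> \<gamma> ` {..r n} \<union> range (T (r n) \<circ> \<eta>)" by (auto simp: c_def)
        ultimately show ?thesis by blast
      qed
      then have "finite_Hausdorff_dist d (range (c n)) (range (T (r n) \<circ> \<eta>))"
        using finite_Hausdorff_dist_Un[of "\<gamma> ` {..r n}" "range (T (r n) \<circ> \<eta>)"] \<gamma>M \<eta>M TM
        by (simp add: image_subset_iff)
      then have "limit_class (c n) = limit_class (T (r n) \<circ> \<eta>)"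
        using cM \<eta>M TM by (intro limit_class_cong) auto
      ultimately show ?thesis by simp
    qed
    ultimately show ?thesis using ev_good by (auto elim: eventually_elim2)
  qed
  moreover have "limit_class \<beta>' \<in> Gromov_boundary M d" using \<beta>' by (simp add: Gromov_boundary_eq)
  ultimately show ?thesis using that[of r "limit_class \<beta>'"] r by blast
qed

end

section \<open>Word metrics\<close>

text \<open>Summing along a geodesic of unit steps reduces a Lipschitz bound to neighbouring points;
  in a word metric these differ by one of finitely many group elements.\<close>

lemma (in integer_geodesic_space) lipschitz_from_unit_steps:
  assumes "integer_geodesic_space M' d'" and f: "\<And>x. x \<in> M \<Longrightarrow> f x \<in> M'"
    and step: "\<And>x y. x \<in> M \<Longrightarrow> y \<in> M \<Longrightarrow> d x y = 1 \<Longrightarrow> d' (f x) (f y) \<le> A"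
    and xy: "x \<in> M" "y \<in> M"
  shows "d' (f x) (f y) \<le> A * d x y"
proof -
  interpret M': integer_geodesic_space M' d' by fact
  obtain n \<sigma> where \<sigma>: "geodesic_segment M d n \<sigma>" "\<sigma> 0 = x" "\<sigma> n = y"
    using ex_geodesic[OF xy] by blast
  have \<sigma>M: "\<sigma> i \<in> M" if "i \<le> n" for i using geodesic_segmentD(1)[OF \<sigma>(1) that that] .
  have "i \<le> n \<Longrightarrow> d' (f (\<sigma> 0)) (f (\<sigma> i)) \<le> A * real i" for i
  proof (induction i)
    case 0
    then show ?case using M'.d_refl f \<sigma>M by simp
  next
    case (Suc i)
    have "d (\<sigma> i) (\<sigma> (Suc i)) = 1" using geodesic_segmentD(2)[OF \<sigma>(1), of i "Suc i"] Suc.prems by simp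
    then have "d' (f (\<sigma> i)) (f (\<sigma> (Suc i))) \<le> A" using step \<sigma>M Suc.prems by simp
    moreover have "d' (f (\<sigma> 0)) (f (\<sigma> (Suc i))) \<le> d' (f (\<sigma> 0)) (f (\<sigma> i)) + d' (f (\<sigma> i)) (f (\<sigma> (Suc i)))"
      using M'.d_triangle f \<sigma>M Suc.prems by simp
    ultimately show ?case using Suc by (simp add: algebra_simps)
  qed
  then have "d' (f (\<sigma> 0)) (f (\<sigma> n)) \<le> A * real n" by blast
  moreover have "d x y = real n" using geodesic_segmentD(2)[OF \<sigma>(1), of 0 n] \<sigma>(2,3) by simp
  ultimately show ?thesis using \<sigma>(2,3) by simp
qed

section \<open>Words, word length and the word metric\<close>

locale finitely_generated_group = group G for G (structure) +
  fixes S :: "'a set"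
  assumes generating: "finite_generating_set G S"
begin

definition letters :: "'a set" where "letters = S \<union> m_inv G ` S"

definition word_value :: "'a list \<Rightarrow> 'a" where "word_value ws = foldr (mult G) ws \<one>"

lemma letters_closed: "letters \<subseteq> carrier G" and finite_letters: "finite letters"
  using generating by (auto simp: letters_def finite_generating_set_def)

lemma inv_letters: "a \<in> letters \<Longrightarrow> inv a \<in> letters"
  using generating by (auto simp: letters_def finite_generating_set_def)

lemma word_value_simps [simp]: "word_value [] = \<one>" "word_value (a # ws) = a \<otimes> word_value ws"
  by (simp_all add: word_value_def)

lemma word_value_closed: "set ws \<subseteq> letters \<Longrightarrow> word_value ws \<in> carrier G"
  using letters_closed by (induction ws) auto

lemma word_value_append:
  "set us \<subseteq> letters \<Longrightarrow> set vs \<subseteq> letters \<Longrightarrow> word_value (us @ vs) = word_value us \<otimes> word_value vs"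
proof (induction us)
  case (Cons a us)
  then show ?case using letters_closed word_value_closed by (auto simp: m_assoc)
qed (simp add: word_value_closed)

lemma word_value_rev:
  "set ws \<subseteq> letters \<Longrightarrow> word_value (rev (map (m_inv G) ws)) = inv (word_value ws)"
proof (induction ws)
  case (Cons a ws)
  have "set (rev (map (m_inv G) ws)) \<subseteq> letters" "set [inv a] \<subseteq> letters"
    using Cons.prems inv_letters by auto
  then have "word_value (rev (map (m_inv G) ws) @ [inv a]) = inv (word_value ws) \<otimes> word_value [inv a]"
    using Cons word_value_append by simp
  moreover have "a \<in> carrier G" using Cons.prems letters_closed by auto
  ultimately show ?case using Cons.prems word_value_closed[of ws] by (simp add: inv_mult_group)
qed simp

lemma ex_word:
  assumes "x \<in> carrier G"
  shows "\<exists>ws. set ws \<subseteq> letters \<and> word_value ws = x"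
proof -
  have "x \<in> generate G S" using assms generating by (simp add: finite_generating_set_def)
  then show ?thesis
  proof (induction rule: generate.induct)
    case one
    then show ?case by (intro exI[of _ "[]"]) simp
  next
    case (incl h)
    then have "h \<in> letters" by (simp add: letters_def)
    then show ?case using letters_closed by (intro exI[of _ "[h]"]) auto
  next
    case (inv h)
    then have "inv h \<in> letters" by (simp add: letters_def)
    then show ?case using letters_closed by (intro exI[of _ "[inv h]"]) auto
  next
    case (eng h1 h2)
    then obtain us vs where "set us \<subseteq> letters" "word_value us = h1" "set vs \<subseteq> letters" "word_value vs = h2"
      by blast
    then show ?case using word_value_append by (intro exI[of _ "us @ vs"]) simp
  qed
qed

lemma word_length_eq:
  "word_length G S x = (LEAST n. \<exists>ws. length ws = n \<and> set ws \<subseteq> letters \<and> word_value ws = x)"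
  by (simp add: word_length_def letters_def word_value_def)

lemma word_length_le: "set ws \<subseteq> letters \<Longrightarrow> word_length G S (word_value ws) \<le> length ws"
  unfolding word_length_eq by (rule Least_le) blast

lemma ex_shortest_word:
  assumes "x \<in> carrier G"
  obtains ws where "length ws = word_length G S x" "set ws \<subseteq> letters" "word_value ws = x"
proof -
  have "\<exists>n ws. length ws = n \<and> set ws \<subseteq> letters \<and> word_value ws = x" using ex_word[OF assms] by blast
  then have "\<exists>ws. length ws = word_length G S x \<and> set ws \<subseteq> letters \<and> word_value ws = x"
    unfolding word_length_eq by (rule LeastI_ex)
  then show ?thesis using that by blast
qed

lemma word_length_one: "word_length G S \<one> = 0"
  using word_length_le[of "[]"] by simp

lemma word_length_mult:
  assumes "x \<in> carrier G" "y \<in> carrier G"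
  shows "word_length G S (x \<otimes> y) \<le> word_length G S x + word_length G S y"
proof -
  obtain us where us: "length us = word_length G S x" "set us \<subseteq> letters" "word_value us = x"
    using ex_shortest_word assms by blast
  obtain vs where vs: "length vs = word_length G S y" "set vs \<subseteq> letters" "word_value vs = y"
    using ex_shortest_word assms by blast
  show ?thesis using word_length_le[of "us @ vs"] word_value_append us vs by simp
qed

lemma word_length_inv_le:
  assumes "x \<in> carrier G"
  shows "word_length G S (inv x) \<le> word_length G S x"
proof -
  obtain us where us: "length us = word_length G S x" "set us \<subseteq> letters" "word_value us = x"
    using ex_shortest_word assms by blast
  have "set (rev (map (m_inv G) us)) \<subseteq> letters" using us inv_letters by auto
  then show ?thesis using word_length_le[of "rev (map (m_inv G) us)"] word_value_rev us by simp
qed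

lemma word_length_inv: "x \<in> carrier G \<Longrightarrow> word_length G S (inv x) = word_length G S x"
  using word_length_inv_le[of x] word_length_inv_le[of "inv x"] by simp

lemma finite_word_length_le: "finite {x \<in> carrier G. word_length G S x \<le> n}"
proof (rule finite_subset)
  show "{x \<in> carrier G. word_length G S x \<le> n} \<subseteq> word_value ` {ws. set ws \<subseteq> letters \<and> length ws \<le> n}"
    using ex_shortest_word by (smt (verit) image_iff mem_Collect_eq subsetI)
  show "finite (word_value ` {ws. set ws \<subseteq> letters \<and> length ws \<le> n})"
    using finite_lists_length_le[OF finite_letters] by simp
qed

lemma word_dist_triangle:
  assumes "x \<in> carrier G" "y \<in> carrier G" "z \<in> carrier G"
  shows "word_dist G S x z \<le> word_dist G S x y + word_dist G S y z"
proof -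
  have "(inv x \<otimes> y) \<otimes> (inv y \<otimes> z) = inv x \<otimes> z"
    using assms by (simp add: m_assoc) (simp flip: m_assoc)
  then show ?thesis using word_length_mult[of "inv x \<otimes> y" "inv y \<otimes> z"] assms
    by (simp add: word_dist_def)
qed

lemma word_dist_commute:
  assumes "x \<in> carrier G" "y \<in> carrier G"
  shows "word_dist G S x y = word_dist G S y x"
  using word_length_inv[of "inv x \<otimes> y"] assms by (simp add: word_dist_def inv_mult_group)

lemma word_dist_left_mult:
  assumes "h \<in> carrier G" "x \<in> carrier G" "y \<in> carrier G"
  shows "word_dist G S (h \<otimes> x) (h \<otimes> y) = word_dist G S x y"
proof -
  have "inv h \<otimes> (h \<otimes> y) = y" using assms by (simp flip: m_assoc)
  then have "inv (h \<otimes> x) \<otimes> (h \<otimes> y) = inv x \<otimes> y"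
    using assms by (simp add: inv_mult_group m_assoc)
  then show ?thesis using assms by (simp add: word_dist_def)
qed

text \<open>The prefixes of a shortest word form the geodesic. A piece of the word bounds the
  distance from above, and no distance can be smaller since the pieces together account for the full
  length.\<close>

lemma ex_geodesic_word_dist:
  assumes xy: "x \<in> carrier G" "y \<in> carrier G"
  shows "\<exists>n \<sigma>. geodesic_segment (carrier G) (word_dist G S) n \<sigma> \<and> \<sigma> 0 = x \<and> \<sigma> n = y"
proof -
  obtain ws where ws: "length ws = word_length G S (inv x \<otimes> y)" "set ws \<subseteq> letters" "word_value ws = inv x \<otimes> y"
    using ex_shortest_word[of "inv x \<otimes> y"] assms by blast
  define n where "n = length ws"
  define \<sigma> where "\<sigma> i = x \<otimes> word_value (take i ws)" for i
  have sub: "set (take i ws) \<subseteq> letters" "set (drop i ws) \<subseteq> letters" for i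
    using ws(2) by (meson order_trans set_take_subset set_drop_subset)+
  have \<sigma>M: "\<sigma> i \<in> carrier G" for i using xy word_value_closed[OF sub(1)] by (simp add: \<sigma>_def)
  have ends: "\<sigma> 0 = x" "\<sigma> n = y" using xy ws(3) by (simp_all add: \<sigma>_def n_def flip: m_assoc)
  have le: "word_dist G S (\<sigma> i) (\<sigma> j) \<le> real j - real i" if "i \<le> j" "j \<le> n" for i j
  proof -
    have s: "set (take (j - i) (drop i ws)) \<subseteq> letters" using sub(2) by (meson order_trans set_take_subset)
    have "take j ws = take i ws @ take (j - i) (drop i ws)"
      using that by (metis le_add_diff_inverse take_add)
    then have "\<sigma> j = \<sigma> i \<otimes> word_value (take (j - i) (drop i ws))"
      using word_value_append[OF sub(1) s] xy word_value_closed[OF s] word_value_closed[OF sub(1)]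
      by (simp add: \<sigma>_def m_assoc)
    then have "inv (\<sigma> i) \<otimes> \<sigma> j = word_value (take (j - i) (drop i ws))"
      using \<sigma>M word_value_closed[OF s] by (simp flip: m_assoc)
    then have "word_dist G S (\<sigma> i) (\<sigma> j) \<le> real (j - i)"
      using word_length_le[OF s] by (simp add: word_dist_def)
    then show ?thesis using that by (simp add: of_nat_diff)
  qed
  have dn: "word_dist G S x y = real n" using ws(1) by (simp add: word_dist_def n_def)
  have eq: "word_dist G S (\<sigma> i) (\<sigma> j) = real j - real i" if "i \<le> j" "j \<le> n" for i j
    using word_dist_triangle[of x "\<sigma> i" y] word_dist_triangle[of "\<sigma> i" "\<sigma> j" y] xy \<sigma>M ends dn
      le[of 0 i] le[of i j] le[of j n] that by simp
  have "word_dist G S (\<sigma> i) (\<sigma> j) = \<bar>real i - real j\<bar>" if "i \<le> n" "j \<le> n" for i j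
    using eq[of i j] eq[of j i] word_dist_commute[OF \<sigma>M \<sigma>M] that by (cases "i \<le> j") auto
  then show ?thesis using \<sigma>M ends unfolding geodesic_segment_def by blast
qed

sublocale word: integer_geodesic_space "carrier G" "word_dist G S"
proof
  show "word_dist G S x x = 0" if "x \<in> carrier G" for x
    using that by (simp add: word_dist_def word_length_one)
qed (simp_all add: word_dist_commute word_dist_triangle ex_geodesic_word_dist)

lemma finite_word_ball:
  assumes "x \<in> carrier G"
  shows "finite {y \<in> carrier G. word_dist G S x y \<le> r}"
proof (rule finite_subset)
  show "{y \<in> carrier G. word_dist G S x y \<le> r}
    \<subseteq> (\<lambda>z. x \<otimes> z) ` {z \<in> carrier G. word_length G S z \<le> nat \<lfloor>r\<rfloor>}"
  proof
    fix y assume y: "y \<in> {y \<in> carrier G. word_dist G S x y \<le> r}"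
    then have "word_length G S (inv x \<otimes> y) \<le> nat \<lfloor>r\<rfloor>" by (simp add: word_dist_def le_nat_floor)
    moreover have "y = x \<otimes> (inv x \<otimes> y)" using assms y by (simp flip: m_assoc)
    ultimately show "y \<in> (\<lambda>z. x \<otimes> z) ` {z \<in> carrier G. word_length G S z \<le> nat \<lfloor>r\<rfloor>}"
      using assms y by blast
  qed
qed (simp add: finite_word_length_le)

lemma word_length_bounded_on_finite:
  assumes "finite F"
  obtains A where "0 \<le> A" "\<And>z. z \<in> F \<Longrightarrow> real (word_length G S z) \<le> A"
  using assms that[of "real (Max (insert 0 (word_length G S ` F)))"] by simp

lemma word_dist_change_generators:
  assumes "finite_generating_set G S'"
  obtains A where "0 \<le> A"
    "\<And>x y. x \<in> carrier G \<Longrightarrow> y \<in> carrier G \<Longrightarrow> word_dist G S' x y \<le> A * word_dist G S x y"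
proof -
  interpret S': finitely_generated_group G S' by unfold_locales fact
  obtain A where A: "0 \<le> A"
    "\<And>z. z \<in> {x \<in> carrier G. word_length G S x \<le> 1} \<Longrightarrow> real (word_length G S' z) \<le> A"
    using S'.word_length_bounded_on_finite[OF finite_word_length_le] by blast
  have "word_dist G S' x y \<le> A * word_dist G S x y" if "x \<in> carrier G" "y \<in> carrier G" for x y
    by (rule word.lipschitz_from_unit_steps[OF S'.word.integer_geodesic_space_axioms _ _ that, where f = "\<lambda>x. x"])
      (use A(2) in \<open>auto simp: word_dist_def\<close>)
  then show ?thesis using that A(1) by blast
qed

text \<open>Hyperbolicity is given for some \<open>S'\<close>, while the boundary is formed with
  \<open>S\<close>; stability passes between the two bi-Lipschitz equivalent word metrics.\<close>

lemma hyperbolic_imp_proper_stable: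
  assumes "hyperbolic_group G"
  shows "proper_stable_space (carrier G) (word_dist G S)"
proof
  show "finite {y \<in> carrier G. word_dist G S x y \<le> r}" if "x \<in> carrier G" for x r
    using finite_word_ball that .
  obtain S' where S': "finite_generating_set G S'" "Gromov_hyperbolic (carrier G) (word_dist G S')"
    using assms unfolding hyperbolic_group_def by blast
  interpret S': finitely_generated_group G S' by unfold_locales fact
  obtain A where A: "0 \<le> A"
    "\<And>x y. x \<in> carrier G \<Longrightarrow> y \<in> carrier G \<Longrightarrow> word_dist G S' x y \<le> A * word_dist G S x y"
    using word_dist_change_generators[OF S'(1)] by blast
  obtain A' where A': "0 \<le> A'"
    "\<And>x y. x \<in> carrier G \<Longrightarrow> y \<in> carrier G \<Longrightarrow> word_dist G S x y \<le> A' * word_dist G S' x y"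
    using S'.word_dist_change_generators[OF generating] by blast
  show "stable_quasi_geodesics (carrier G) (word_dist G S)"
  proof (rule stable_quasi_geodesics_bilipschitz)
    show "stable_quasi_geodesics (carrier G) (word_dist G S')"
      using S'.word.Gromov_hyperbolic_imp_stable S'(2) .
    show "0 \<le> max A A'" using A(1) by simp
    fix x y assume xy: "x \<in> carrier G" "y \<in> carrier G"
    show nn: "0 \<le> word_dist G S x y" "0 \<le> word_dist G S' x y" by (simp_all add: word_dist_def)
    have "A' * word_dist G S' x y \<le> max A A' * word_dist G S' x y"
      "A * word_dist G S x y \<le> max A A' * word_dist G S x y"
      using nn by (auto intro!: mult_right_mono)
    then show "word_dist G S x y \<le> max A A' * word_dist G S' x y"
      "word_dist G S' x y \<le> max A A' * word_dist G S x y"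
      using A(2)[OF xy] A'(2)[OF xy] by linarith+
  qed
qed

end

text \<open>Choosing a representative in each right coset splits \<open>x\<close> into an element of
  \<open>L\<close> times a right factor from a finite set, the shape in which finite index serves
  both the construction of the action and the attracting elements.\<close>

lemma (in group) finite_index_cover:
  assumes "finite_index G L"
  obtains T where "finite T" "T \<subseteq> carrier G" "\<And>x. x \<in> carrier G \<Longrightarrow> \<exists>t\<in>T. x \<otimes> inv t \<in> L"
proof -
  have L: "subgroup L G" and fin: "finite (rcosets L)" using assms by (auto simp: finite_index_def)
  define T where "T = (\<lambda>R. SOME t. t \<in> R) ` (rcosets L)"
  have rep: "(SOME t. t \<in> L #> x) \<in> L #> x" if "x \<in> carrier G" for x
    using rcos_self[OF that L] by (rule someI)
  have "T \<subseteq> carrier G"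
  proof
    fix t assume "t \<in> T"
    then obtain x where x: "x \<in> carrier G" "t = (SOME t. t \<in> L #> x)" by (auto simp: T_def RCOSETS_def)
    then have "t \<in> L #> x" using rep by simp
    then show "t \<in> carrier G" using r_coset_subset_G[OF subgroup.subset[OF L] x(1)] by blast
  qed
  moreover have "\<exists>t\<in>T. x \<otimes> inv t \<in> L" if x: "x \<in> carrier G" for x
  proof -
    define t where "t = (SOME t. t \<in> L #> x)"
    have "t \<in> T" using x by (auto simp: T_def t_def RCOSETS_def)
    have "t \<in> L #> x" unfolding t_def by (rule rep[OF x])
    then obtain l where l: "l \<in> L" "t = l \<otimes> x" by (auto simp: r_coset_def)
    have lc: "l \<in> carrier G" using l(1) subgroup.mem_carrier[OF L] by blast
    have "x \<otimes> inv t = x \<otimes> (inv x \<otimes> inv l)" using l(2) lc x by (simp add: inv_mult_group)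
    also have "\<dots> = inv l" using lc x by (simp flip: m_assoc)
    finally have "x \<otimes> inv t \<in> L" using subgroup.m_inv_closed[OF L l(1)] by simp
    then show ?thesis using \<open>t \<in> T\<close> by blast
  qed
  ultimately show ?thesis using that[of T] fin by (simp add: T_def)
qed

section \<open>Commensurated hyperbolic subgroups\<close>

locale commensurated_hyperbolic_subgroup = group G for G (structure) +
  fixes H S :: "'a set"
  assumes H: "subgroup H G" and hyperbolic: "hyperbolic_group (G\<lparr>carrier := H\<rparr>)"
    and generates: "finite_generating_set (G\<lparr>carrier := H\<rparr>) S"
    and commensurated: "\<And>g. g \<in> carrier G \<Longrightarrow>
      finite_index (G\<lparr>carrier := H\<rparr>) (H \<inter> (g <# H #> inv g))"
begin

abbreviation "K \<equiv> G\<lparr>carrier := H\<rparr>"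
abbreviation d :: "'a \<Rightarrow> 'a \<Rightarrow> real" where "d \<equiv> word_dist K S"
abbreviation bdry :: "(nat \<Rightarrow> 'a) set set" where "bdry \<equiv> Gromov_boundary H d"

lemma group_K: "group K"
  using H subgroup.subgroup_is_group is_group by blast

lemma inv_K: "x \<in> H \<Longrightarrow> inv\<^bsub>K\<^esub> x = inv x"
  using m_inv_consistent[OF H] by simp

lemma H_closed: "x \<in> H \<Longrightarrow> x \<in> carrier G" "x \<in> H \<Longrightarrow> y \<in> H \<Longrightarrow> x \<otimes> y \<in> H"
  "x \<in> H \<Longrightarrow> inv x \<in> H" "\<one> \<in> H"
  using subgroup.mem_carrier[OF H] subgroup.m_closed[OF H] subgroup.m_inv_closed[OF H]
    subgroup.one_closed[OF H] by blast+

lemma finitely_generated_K: "finitely_generated_group K S"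
  unfolding finitely_generated_group_def finitely_generated_group_axioms_def
  using group_K generates by blast

sublocale proper_stable_space H d
  using finitely_generated_group.hyperbolic_imp_proper_stable[OF finitely_generated_K hyperbolic] by simp

lemma d_left_mult: "h \<in> H \<Longrightarrow> x \<in> H \<Longrightarrow> y \<in> H \<Longrightarrow> d (h \<otimes> x) (h \<otimes> y) = d x y"
  using finitely_generated_group.word_dist_left_mult[OF finitely_generated_K, of h x y] by simp

text \<open>By left invariance the distance depends only on \<open>inv x \<otimes> y\<close>, so
  finitely many such quotients mean bounded distance, even when \<open>F\<close> is computed in
  \<open>G\<close> from factors outside \<open>H\<close>.\<close>

lemma d_bounded_if_finite:
  assumes "finite F"
  obtains A where "0 \<le> A" "\<And>x y. x \<in> H \<Longrightarrow> y \<in> H \<Longrightarrow> inv x \<otimes> y \<in> F \<Longrightarrow> d x y \<le> A"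
proof -
  obtain A where "0 \<le> A" "\<And>z. z \<in> F \<Longrightarrow> real (word_length K S z) \<le> A"
    using finitely_generated_group.word_length_bounded_on_finite[OF finitely_generated_K assms] by blast
  then show ?thesis using that[of A] by (simp add: word_dist_def inv_K)
qed

text \<open>
  \<open>coarsely_left_mult g f\<close> says that \<open>f\<close> is at bounded distance from left multiplication
  by \<open>g\<close>, which does not preserve \<open>H\<close>; commensuration is used only to produce such maps.
\<close>

definition coarsely_left_mult :: "'a \<Rightarrow> ('a \<Rightarrow> 'a) \<Rightarrow> bool" where
  "coarsely_left_mult g f \<longleftrightarrow> (\<forall>x\<in>H. f x \<in> H) \<and>
     (\<exists>C. finite C \<and> C \<subseteq> carrier G \<and> (\<forall>x\<in>H. \<exists>c\<in>C. f x = g \<otimes> x \<otimes> c))"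

lemma coarsely_left_multI:
  assumes "\<And>x. x \<in> H \<Longrightarrow> f x \<in> H" "finite C" "C \<subseteq> carrier G"
    "\<And>x. x \<in> H \<Longrightarrow> \<exists>c\<in>C. f x = g \<otimes> x \<otimes> c"
  shows "coarsely_left_mult g f"
  using assms unfolding coarsely_left_mult_def by blast

lemma coarsely_left_multE:
  assumes "coarsely_left_mult g f"
  obtains C where "\<And>x. x \<in> H \<Longrightarrow> f x \<in> H" "finite C" "C \<subseteq> carrier G"
    "\<And>x. x \<in> H \<Longrightarrow> \<exists>c\<in>C. f x = g \<otimes> x \<otimes> c"
  using assms unfolding coarsely_left_mult_def by blast

lemma mult_inv_cancel:
  assumes "g \<in> carrier G" "x \<in> carrier G"
  shows "g \<otimes> (inv g \<otimes> x) = x"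
  using assms by (simp flip: m_assoc)

lemma conjugate_memE:
  assumes "g \<in> carrier G" "x \<in> g <# H #> inv g"
  obtains h where "h \<in> H" "x = g \<otimes> h \<otimes> inv g"
  using assms by (auto simp: l_coset_def r_coset_def)

lemma finite_coset_representatives:
  assumes g: "g \<in> carrier G"
  obtains T where "finite T" "T \<subseteq> H" "\<And>x. x \<in> H \<Longrightarrow> \<exists>t\<in>T. x \<otimes> inv t \<in> H \<inter> (g <# H #> inv g)"
proof -
  obtain T where T: "finite T" "T \<subseteq> H"
    "\<And>x. x \<in> H \<Longrightarrow> \<exists>t\<in>T. x \<otimes> inv\<^bsub>K\<^esub> t \<in> H \<inter> (g <# H #> inv g)"
    using group.finite_index_cover[OF group_K commensurated[OF g]] by auto
  have "\<exists>t\<in>T. x \<otimes> inv t \<in> H \<inter> (g <# H #> inv g)" if "x \<in> H" for x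
    using T(2,3) inv_K that by (metis subsetD)
  then show ?thesis using that T by blast
qed

text \<open>Commensuration for \<open>inv g\<close> writes \<open>x\<close> as
  \<open>l \<otimes> t\<close> with \<open>l\<close> in the part of \<open>H\<close> that
  conjugation by \<open>g\<close> carries into \<open>H\<close>. Then
  \<open>g \<otimes> l \<otimes> inv g\<close> is in \<open>H\<close> and equals
  \<open>g \<otimes> x\<close> times the right factor \<open>inv t \<otimes> inv g\<close>, which
  takes finitely many values.\<close>

lemma ex_coarsely_left_mult:
  assumes g: "g \<in> carrier G"
  shows "\<exists>f. coarsely_left_mult g f"
proof -
  obtain T where T: "finite T" "T \<subseteq> H"
    "\<And>x. x \<in> H \<Longrightarrow> \<exists>t\<in>T. x \<otimes> inv t \<in> H \<inter> (inv g <# H #> inv (inv g))"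
    using finite_coset_representatives[of "inv g"] g by blast
  have "\<exists>t\<in>T. g \<otimes> x \<otimes> (inv t \<otimes> inv g) \<in> H" if x: "x \<in> H" for x
  proof -
    obtain t where t: "t \<in> T" "x \<otimes> inv t \<in> inv g <# H #> inv (inv g)" using T(3)[OF x] by blast
    then obtain h where h: "h \<in> H" "x \<otimes> inv t = inv g \<otimes> h \<otimes> inv (inv g)"
      using conjugate_memE[of "inv g"] g by blast
    have c: "x \<in> carrier G" "t \<in> carrier G" "h \<in> carrier G" using x t(1) T(2) h(1) H_closed by auto
    have "g \<otimes> x \<otimes> (inv t \<otimes> inv g) = g \<otimes> (x \<otimes> inv t) \<otimes> inv g" using c g by (simp add: m_assoc)
    also have "\<dots> = h" unfolding h(2) using c g by (simp add: m_assoc mult_inv_cancel)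
    finally show ?thesis using t(1) h(1) by auto
  qed
  then obtain t where t: "\<And>x. x \<in> H \<Longrightarrow> t x \<in> T" "\<And>x. x \<in> H \<Longrightarrow> g \<otimes> x \<otimes> (inv (t x) \<otimes> inv g) \<in> H"
    by metis
  have "coarsely_left_mult g (\<lambda>x. g \<otimes> x \<otimes> (inv (t x) \<otimes> inv g))"
  proof (rule coarsely_left_multI)
    show "finite ((\<lambda>t. inv t \<otimes> inv g) ` T)" using T(1) by simp
    show "(\<lambda>t. inv t \<otimes> inv g) ` T \<subseteq> carrier G" using T(2) g H_closed by auto
  qed (use t in auto)
  then show ?thesis by blast
qed

lemma coarsely_left_mult_compose:
  assumes "g \<in> carrier G" "h \<in> carrier G" "coarsely_left_mult g f" "coarsely_left_mult h f'"
  shows "coarsely_left_mult (g \<otimes> h) (f \<circ> f')"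
proof -
  obtain C where C: "\<And>x. x \<in> H \<Longrightarrow> f x \<in> H" "finite C" "C \<subseteq> carrier G"
    "\<And>x. x \<in> H \<Longrightarrow> \<exists>c\<in>C. f x = g \<otimes> x \<otimes> c" using coarsely_left_multE[OF assms(3)] by blast
  obtain C' where C': "\<And>x. x \<in> H \<Longrightarrow> f' x \<in> H" "finite C'" "C' \<subseteq> carrier G"
    "\<And>x. x \<in> H \<Longrightarrow> \<exists>c\<in>C'. f' x = h \<otimes> x \<otimes> c" using coarsely_left_multE[OF assms(4)] by blast
  show ?thesis
  proof (rule coarsely_left_multI)
    show "finite ((\<lambda>(c', c). c' \<otimes> c) ` (C' \<times> C))" using C(2) C'(2) by simp
    show "(\<lambda>(c', c). c' \<otimes> c) ` (C' \<times> C) \<subseteq> carrier G" using C(3) C'(3) by auto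
    fix x assume x: "x \<in> H"
    show "(f \<circ> f') x \<in> H" using C(1) C'(1) x by simp
    obtain c' where c': "c' \<in> C'" "f' x = h \<otimes> x \<otimes> c'" using C'(4)[OF x] by blast
    obtain c where c: "c \<in> C" "f (f' x) = g \<otimes> f' x \<otimes> c" using C(4)[OF C'(1)[OF x]] by blast
    have "c \<in> carrier G" "c' \<in> carrier G" "x \<in> carrier G" using c c' C(3) C'(3) x H_closed by auto
    then have "(f \<circ> f') x = g \<otimes> h \<otimes> x \<otimes> (c' \<otimes> c)" using c(2) c'(2) assms(1,2) by (simp add: m_assoc)
    then show "\<exists>c\<in>(\<lambda>(c', c). c' \<otimes> c) ` (C' \<times> C). (f \<circ> f') x = g \<otimes> h \<otimes> x \<otimes> c"
      using c(1) c'(1) by force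
  qed
qed

lemma coarsely_left_mult_mult:
  assumes "h \<in> H"
  shows "coarsely_left_mult h (\<lambda>x. h \<otimes> x)"
  by (rule coarsely_left_multI[where C="{\<one>}"]) (use assms H_closed in auto)

text \<open>The link to \<open>boundary_action\<close>, which is defined by conjugation: conjugation
  and left multiplication differ by one right factor, so they induce the same boundary map.\<close>

lemma coarsely_left_mult_conjugation:
  assumes "h \<in> H"
  shows "coarsely_left_mult h (\<lambda>x. h \<otimes> x \<otimes> inv h)"
  by (rule coarsely_left_multI[where C="{inv h}"]) (use assms H_closed in auto)

text \<open>The left factor \<open>g\<close> cancels in \<open>inv (g \<otimes> x \<otimes> c)
  \<otimes> (g \<otimes> y \<otimes> c')\<close>, leaving
  \<open>inv c \<otimes> (inv x \<otimes> y) \<otimes> c'\<close>. With \<open>F\<close> the unit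
  ball and \<open>f = f'\<close> this gives the Lipschitz bound; with \<open>F = {\<one>}\<close> it
  shows that \<open>g\<close> determines \<open>f\<close> up to bounded distance.\<close>

lemma coarsely_left_mult_steps:
  assumes g: "g \<in> carrier G" and f: "coarsely_left_mult g f" and f': "coarsely_left_mult g f'"
    and F: "finite F"
  obtains E where "finite E"
    "\<And>x y. x \<in> H \<Longrightarrow> y \<in> H \<Longrightarrow> inv x \<otimes> y \<in> F \<Longrightarrow> inv (f x) \<otimes> f' y \<in> E"
proof -
  obtain C where C: "\<And>x. x \<in> H \<Longrightarrow> f x \<in> H" "finite C" "C \<subseteq> carrier G"
    "\<And>x. x \<in> H \<Longrightarrow> \<exists>c\<in>C. f x = g \<otimes> x \<otimes> c" using coarsely_left_multE[OF f] by blast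
  obtain C' where C': "\<And>x. x \<in> H \<Longrightarrow> f' x \<in> H" "finite C'" "C' \<subseteq> carrier G"
    "\<And>x. x \<in> H \<Longrightarrow> \<exists>c\<in>C'. f' x = g \<otimes> x \<otimes> c" using coarsely_left_multE[OF f'] by blast
  define E where "E = (\<lambda>(c, z, c'). inv c \<otimes> z \<otimes> c') ` (C \<times> F \<times> C')"
  have "inv (f x) \<otimes> f' y \<in> E" if xy: "x \<in> H" "y \<in> H" "inv x \<otimes> y \<in> F" for x y
  proof -
    obtain c where c: "c \<in> C" "f x = g \<otimes> x \<otimes> c" using C(4)[OF xy(1)] by blast
    obtain c' where c': "c' \<in> C'" "f' y = g \<otimes> y \<otimes> c'" using C'(4)[OF xy(2)] by blast
    have M: "c \<in> carrier G" "c' \<in> carrier G" "x \<in> carrier G" "y \<in> carrier G"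
      using c c' C(3) C'(3) xy H_closed by auto
    have "inv g \<otimes> (g \<otimes> (y \<otimes> c')) = y \<otimes> c'" using M g by (simp flip: m_assoc)
    then have "inv (f x) \<otimes> f' y = inv c \<otimes> (inv x \<otimes> y) \<otimes> c'"
      unfolding c(2) c'(2) using M g by (simp add: inv_mult_group m_assoc)
    then show ?thesis using c(1) c'(1) xy(3) unfolding E_def by force
  qed
  moreover have "finite E" using C(2) C'(2) F by (simp add: E_def)
  ultimately show ?thesis using that by blast
qed

lemma coarsely_left_mult_lipschitz:
  assumes g: "g \<in> carrier G" and f: "coarsely_left_mult g f"
  obtains A where "0 \<le> A" "\<And>x y. x \<in> H \<Longrightarrow> y \<in> H \<Longrightarrow> d (f x) (f y) \<le> A * d x y"
proof -
  have fH: "\<And>x. x \<in> H \<Longrightarrow> f x \<in> H" using f by (simp add: coarsely_left_mult_def)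
  define F where "F = {z \<in> H. word_length K S z \<le> 1}"
  have "finite F" unfolding F_def
    using finitely_generated_group.finite_word_length_le[OF finitely_generated_K, of 1] by simp
  then obtain E where E: "finite E"
    "\<And>x y. x \<in> H \<Longrightarrow> y \<in> H \<Longrightarrow> inv x \<otimes> y \<in> F \<Longrightarrow> inv (f x) \<otimes> f y \<in> E"
    using coarsely_left_mult_steps[OF g f f] by blast
  obtain A where A: "0 \<le> A" "\<And>x y. x \<in> H \<Longrightarrow> y \<in> H \<Longrightarrow> inv x \<otimes> y \<in> E \<Longrightarrow> d x y \<le> A"
    using d_bounded_if_finite[OF E(1)] by blast
  have step: "d (f x) (f y) \<le> A" if xy: "x \<in> H" "y \<in> H" "d x y = 1" for x y
  proof -
    have "inv x \<otimes> y \<in> F" using xy H_closed by (simp add: F_def word_dist_def inv_K)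
    then show ?thesis using A(2) E(2) fH xy by blast
  qed
  have "d (f x) (f y) \<le> A * d x y" if "x \<in> H" "y \<in> H" for x y
    by (rule lipschitz_from_unit_steps[OF integer_geodesic_space_axioms fH step that])
  then show ?thesis using that A(1) by blast
qed

lemma coarsely_left_mult_close:
  assumes g: "g \<in> carrier G" and f: "coarsely_left_mult g f" "coarsely_left_mult g f'"
  obtains A where "0 \<le> A" "\<And>x. x \<in> H \<Longrightarrow> d (f x) (f' x) \<le> A"
proof -
  obtain E where E: "finite E"
    "\<And>x y. x \<in> H \<Longrightarrow> y \<in> H \<Longrightarrow> inv x \<otimes> y \<in> {\<one>} \<Longrightarrow> inv (f x) \<otimes> f' y \<in> E"
    using coarsely_left_mult_steps[OF g f, of "{\<one>}"] by auto
  obtain A where A: "0 \<le> A" "\<And>x y. x \<in> H \<Longrightarrow> y \<in> H \<Longrightarrow> inv x \<otimes> y \<in> E \<Longrightarrow> d x y \<le> A"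
    using d_bounded_if_finite[OF E(1)] by blast
  have "d (f x) (f' x) \<le> A" if "x \<in> H" for x
  proof -
    have "inv x \<otimes> x \<in> {\<one>}" using that H_closed by simp
    then show ?thesis using A(2) E(2) f that unfolding coarsely_left_mult_def by blast
  qed
  then show ?thesis using that A(1) by blast
qed

text \<open>The lower bound comes from a Lipschitz map \<open>f'\<close> for \<open>inv g\<close>:
  the composite \<open>f' \<circ> f\<close> is coarsely left multiplication by
  \<open>\<one>\<close>, hence close to the identity. The term \<open>2 * B\<close> in the constant
  pays for moving both points back.\<close>

lemma coarsely_left_mult_quasi_isometric:
  assumes g: "g \<in> carrier G" and f: "coarsely_left_mult g f"
  obtains A where "0 \<le> A" "quasi_isometric_embedding A f"
proof -
  obtain f' where f': "coarsely_left_mult (inv g) f'" using ex_coarsely_left_mult g by blast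
  obtain A where A: "0 \<le> A" "\<And>x y. x \<in> H \<Longrightarrow> y \<in> H \<Longrightarrow> d (f x) (f y) \<le> A * d x y"
    using coarsely_left_mult_lipschitz[OF g f] by blast
  obtain A' where A': "0 \<le> A'" "\<And>x y. x \<in> H \<Longrightarrow> y \<in> H \<Longrightarrow> d (f' x) (f' y) \<le> A' * d x y"
    using coarsely_left_mult_lipschitz[OF _ f'] g by blast
  have "coarsely_left_mult \<one> (f' \<circ> f)" using coarsely_left_mult_compose[OF _ g f' f] g by simp
  moreover have "coarsely_left_mult \<one> (\<lambda>x. \<one> \<otimes> x)" using coarsely_left_mult_mult H_closed by blast
  ultimately obtain B where B: "0 \<le> B" "\<And>x. x \<in> H \<Longrightarrow> d ((f' \<circ> f) x) (\<one> \<otimes> x) \<le> B"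
    using coarsely_left_mult_close[OF one_closed] by blast
  have fH: "f x \<in> H" "f' x \<in> H" if "x \<in> H" for x
    using that f f' by (simp_all add: coarsely_left_mult_def)
  define E where "E = max A (max A' (2 * B))"
  have E: "0 \<le> E" "A \<le> E" "A' \<le> E" "2 * B \<le> E" using A(1) by (auto simp: E_def)
  have "quasi_isometric_embedding E f"
    unfolding quasi_isometric_embedding_def
  proof (intro conjI ballI)
    fix x y assume xy: "x \<in> H" "y \<in> H"
    show "f x \<in> H" using fH xy by blast
    have "A * d x y \<le> E * d x y" using E(2) d_nonneg[OF xy] by (rule mult_right_mono)
    then show "d (f x) (f y) \<le> E * d x y" using A(2)[OF xy] by linarith
    have near: "d (f' (f z)) z \<le> B" if "z \<in> H" for z using B(2)[OF that] that H_closed by simp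
    have ff: "f' (f x) \<in> H" "f' (f y) \<in> H" using fH xy by auto
    have "d x y \<le> d x (f' (f x)) + d (f' (f x)) (f' (f y)) + d (f' (f y)) y"
      using d_triangle[OF xy(1) ff(1) xy(2)] d_triangle[OF ff xy(2)] by linarith
    also have "\<dots> \<le> B + A' * d (f x) (f y) + B"
      using near[OF xy(1)] near[OF xy(2)] d_commute[OF xy(1) ff(1)] A'(2)[of "f x" "f y"] fH xy by simp
    also have "\<dots> \<le> E * d (f x) (f y) + E"
      using mult_right_mono[OF E(3) d_nonneg[of "f x" "f y"]] fH xy E(4) by simp
    finally show "d x y \<le> E * (d (f x) (f y) + 1)" by (simp add: algebra_simps)
  qed
  then show ?thesis using that E(1) by blast
qed

section \<open>The induced action on the boundary\<close>

definition act :: "'a \<Rightarrow> (nat \<Rightarrow> 'a) set \<Rightarrow> (nat \<Rightarrow> 'a) set" where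
  "act g = restrict (boundary_map H d (SOME f. coarsely_left_mult g f)) bdry"

lemma boundary_map_coarsely_left_mult:
  assumes g: "g \<in> carrier G" and f: "coarsely_left_mult g f" and c: "quasi_ray \<kappa> c"
  shows "boundary_map H d f (limit_class c) = limit_class (f \<circ> c)"
    "\<exists>\<mu>. quasi_ray \<mu> (f \<circ> c)"
proof -
  obtain A where A: "0 \<le> A" "quasi_isometric_embedding A f"
    using coarsely_left_mult_quasi_isometric[OF g f] by blast
  show "boundary_map H d f (limit_class c) = limit_class (f \<circ> c)"
    using boundary_map_limit_class[OF A(2,1) c] .
  have "quasi_ray (max 0 \<kappa>) c" using quasi_ray_mono[OF c] by simp
  then show "\<exists>\<mu>. quasi_ray \<mu> (f \<circ> c)" using quasi_ray_compose[OF A(2) _ A(1)] by force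
qed

text \<open>Any map that is coarsely left multiplication by \<open>g\<close> stays at bounded
  distance from the chosen one, so the choice is immaterial; the action law rests on this.
  Quasi-rays appear because the image of a geodesic ray need not be geodesic.\<close>

lemma act_limit_class:
  assumes g: "g \<in> carrier G" and f: "coarsely_left_mult g f" and c: "quasi_ray \<kappa> c"
  shows "act g (limit_class c) = limit_class (f \<circ> c)"
proof -
  define f0 where "f0 = (SOME f. coarsely_left_mult g f)"
  have f0: "coarsely_left_mult g f0" unfolding f0_def using ex_coarsely_left_mult[OF g] by (rule someI_ex)
  have "act g (limit_class c) = limit_class (f0 \<circ> c)"
    using boundary_map_coarsely_left_mult(1)[OF g f0 c] limit_class_in_boundary[OF c]
    by (simp add: act_def f0_def)
  moreover obtain A where "\<And>x. x \<in> H \<Longrightarrow> d (f0 x) (f x) \<le> A"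
    using coarsely_left_mult_close[OF g f0 f] by blast
  then have "limit_class (f0 \<circ> c) = limit_class (f \<circ> c)"
    using f f0 quasi_rayD(1)[OF c]
    by (intro limit_class_bounded_distance[where C=A]) (auto simp: coarsely_left_mult_def)
  ultimately show ?thesis by simp
qed

lemma bdry_quasi_ray:
  assumes "\<xi> \<in> bdry"
  obtains \<gamma> where "\<gamma> \<in> geodesic_rays H d" "\<xi> = limit_class \<gamma>" "quasi_ray 1 \<gamma>"
  using boundary_point_cases[OF assms] geodesic_ray_imp_quasi_ray by (metis order_refl)

lemma act_eq_boundary_map:
  assumes "g \<in> carrier G" "coarsely_left_mult g f" "\<xi> \<in> bdry"
  shows "act g \<xi> = boundary_map H d f \<xi>"
  using bdry_quasi_ray[OF assms(3)] act_limit_class[OF assms(1,2)]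
    boundary_map_coarsely_left_mult(1)[OF assms(1,2)] by metis

lemma act_closed:
  assumes g: "g \<in> carrier G" and "\<xi> \<in> bdry"
  shows "act g \<xi> \<in> bdry"
proof -
  obtain f where f: "coarsely_left_mult g f" using ex_coarsely_left_mult[OF g] by blast
  obtain \<gamma> where \<gamma>: "\<xi> = limit_class \<gamma>" "quasi_ray 1 \<gamma>" using bdry_quasi_ray assms(2) by metis
  then show ?thesis using act_limit_class[OF g f \<gamma>(2)] boundary_map_coarsely_left_mult(2)[OF g f \<gamma>(2)]
    limit_class_in_boundary by auto
qed

lemma act_mult:
  assumes g: "g \<in> carrier G" and h: "h \<in> carrier G" and "\<xi> \<in> bdry"
  shows "act (g \<otimes> h) \<xi> = act g (act h \<xi>)"
proof -
  obtain f f' where f: "coarsely_left_mult g f" "coarsely_left_mult h f'"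
    using ex_coarsely_left_mult g h by blast
  obtain \<gamma> where \<gamma>: "\<xi> = limit_class \<gamma>" "quasi_ray 1 \<gamma>" using bdry_quasi_ray assms(3) by metis
  obtain \<mu> where "quasi_ray \<mu> (f' \<circ> \<gamma>)" using boundary_map_coarsely_left_mult(2)[OF h f(2) \<gamma>(2)] by blast
  then have "act g (act h \<xi>) = limit_class (f \<circ> (f' \<circ> \<gamma>))"
    using act_limit_class[OF h f(2) \<gamma>(2)] act_limit_class[OF g f(1)] \<gamma>(1) by simp
  moreover have "act (g \<otimes> h) \<xi> = limit_class ((f \<circ> f') \<circ> \<gamma>)"
    using act_limit_class[OF _ coarsely_left_mult_compose[OF g h f] \<gamma>(2)] g h \<gamma>(1) by simp
  ultimately show ?thesis by (simp add: comp_assoc)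
qed

lemma act_left_mult:
  assumes "h \<in> H" "\<gamma> \<in> geodesic_rays H d"
  shows "act h (limit_class \<gamma>) = limit_class ((\<lambda>x. h \<otimes> x) \<circ> \<gamma>)"
  using act_limit_class[OF _ coarsely_left_mult_mult] assms geodesic_ray_imp_quasi_ray H_closed(1)
  by blast

lemma act_one:
  assumes "\<xi> \<in> bdry"
  shows "act \<one> \<xi> = \<xi>"
proof -
  obtain \<gamma> where \<gamma>: "\<gamma> \<in> geodesic_rays H d" "\<xi> = limit_class \<gamma>" using bdry_quasi_ray assms by metis
  have "(\<lambda>x. \<one> \<otimes> x) \<circ> \<gamma> = \<gamma>" using geodesic_raysD(1)[OF \<gamma>(1)] H_closed by auto
  then show ?thesis using act_left_mult[OF H_closed(4) \<gamma>(1)] \<gamma>(2) by simp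
qed

lemma act_inv:
  assumes "g \<in> carrier G" "\<xi> \<in> bdry"
  shows "act (inv g) (act g \<xi>) = \<xi>" "act g (act (inv g) \<xi>) = \<xi>"
  using act_mult[of "inv g" g \<xi>] act_mult[of g "inv g" \<xi>] act_one assms by simp_all

lemma continuous_map_act:
  assumes g: "g \<in> carrier G"
  shows "continuous_map (boundary_topology H d) (boundary_topology H d) (act g)"
proof -
  obtain f where f: "coarsely_left_mult g f" using ex_coarsely_left_mult[OF g] by blast
  obtain A where A: "0 \<le> A" "quasi_isometric_embedding A f"
    using coarsely_left_mult_quasi_isometric[OF g f] by blast
  show ?thesis
    by (rule continuous_map_eq[OF continuous_map_boundary_map[OF A(2,1)]])
      (simp add: topspace_boundary_topology act_eq_boundary_map[OF g f])
qed

lemma homeomorphic_map_act: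
  assumes "g \<in> carrier G"
  shows "homeomorphic_map (boundary_topology H d) (boundary_topology H d) (act g)"
  unfolding homeomorphic_map_maps homeomorphic_maps_def topspace_boundary_topology
  using assms continuous_map_act act_inv by (intro exI[of _ "act (inv g)"]) auto

lemma bij_betw_act: "g \<in> carrier G \<Longrightarrow> bij_betw (act g) bdry bdry"
  by (rule bij_betw_byWitness[of _ "act (inv g)"]) (auto simp: act_inv act_closed)

lemma homeo_action_act: "homeo_action G (boundary_topology H d) act"
  unfolding homeo_action_def topspace_boundary_topology
proof (intro conjI ballI homeomorphic_map_act)
  \<comment> \<open>\<open>Bij\<close> asks for an extensional function, which is why
    \<open>act\<close> is restricted to \<open>bdry\<close>.\<close>
  have Bij: "act g \<in> Bij bdry" if "g \<in> carrier G" for g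
    using bij_betw_act[OF that] by (simp add: Bij_def act_def)
  have "act (g \<otimes> h) = compose bdry (act g) (act h)" if "g \<in> carrier G" "h \<in> carrier G" for g h
    using act_mult[OF that] by (auto simp: compose_def act_def[of "g \<otimes> h"] fun_eq_iff)
  then have "act \<in> hom G (BijGroup bdry)"
    using Bij by (auto simp: hom_def BijGroup_def)
  then show "group_action G bdry act"
    unfolding group_action_def group_hom_def group_hom_axioms_def
    using is_group group_BijGroup by blast
qed

lemma boundary_action_eq_act:
  assumes "h \<in> H" "\<xi> \<in> bdry"
  shows "boundary_action K S h \<xi> = act h \<xi>"
  using act_eq_boundary_map[OF _ coarsely_left_mult_conjugation[OF assms(1)] assms(2)] assms H_closed(1)
  by (simp add: boundary_action_def topspace_boundary_topology inv_K)

section \<open>Topological freeness\<close>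

lemma attracting_sequence:
  assumes g: "g \<in> carrier G" and U: "openin (boundary_topology H d) U" "U \<noteq> {}"
  obtains h b where "\<And>n::nat. h n \<in> H \<inter> (g <# H #> inv g)" "b \<in> bdry"
    "\<And>\<xi>. \<xi> \<in> bdry \<Longrightarrow> \<xi> \<noteq> b \<Longrightarrow> eventually (\<lambda>n. act (h n) \<xi> \<in> U) sequentially"
proof -
  define L where "L = H \<inter> (g <# H #> inv g)"
  obtain T where T: "finite T" "T \<subseteq> H" "\<And>x. x \<in> H \<Longrightarrow> \<exists>t\<in>T. x \<otimes> inv t \<in> L"
    using finite_coset_representatives[OF g] unfolding L_def by blast
  have "U \<subseteq> bdry" using U openin_subset topspace_boundary_topology by metis
  then obtain \<gamma> where \<gamma>: "\<gamma> \<in> geodesic_rays H d" "limit_class \<gamma> \<in> U"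
    using U(2) bdry_quasi_ray by (metis ex_in_conv subsetD)
  note \<gamma>H = geodesic_raysD(1)[OF \<gamma>(1)]
  have "\<exists>t\<in>T. \<gamma> n \<otimes> inv t \<in> L" for n using T(3) \<gamma>H by blast
  then obtain t where t: "\<And>n. t n \<in> T" "\<And>n. \<gamma> n \<otimes> inv (t n) \<in> L" by metis
  \<comment> \<open>Then \<open>inv (h n)\<close> takes \<open>\<gamma> n\<close> to
    \<open>t n\<close> in the finite set \<open>T\<close>, as \<open>attracting_subsequence\<close>
    asks of the origins of the reversed rays, and \<open>h n\<close> lies in
    \<open>L\<close>.\<close>
  define h where "h n = \<gamma> n \<otimes> inv (t n)" for n
  have hL: "h n \<in> L" for n using t by (simp add: h_def)
  then have hH: "h n \<in> H" for n by (auto simp: L_def)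
  have tH: "t n \<in> H" for n using t(1) T(2) by blast
  have ht: "inv (h n) \<otimes> \<gamma> n = t n" for n
  proof -
    have "\<gamma> n \<in> carrier G" "t n \<in> carrier G" using \<gamma>H tH H_closed by auto
    then show ?thesis by (simp add: h_def inv_mult_group m_assoc)
  qed
  obtain r b where r: "strict_mono (r :: nat \<Rightarrow> nat)" and b: "b \<in> bdry"
    and attr: "\<And>U \<eta>. openin (boundary_topology H d) U \<Longrightarrow> limit_class \<gamma> \<in> U \<Longrightarrow>
       \<eta> \<in> geodesic_rays H d \<Longrightarrow> limit_class \<eta> \<noteq> b \<Longrightarrow>
       eventually (\<lambda>n. limit_class ((\<lambda>x. h (r n) \<otimes> x) \<circ> \<eta>) \<in> U) sequentially"
  proof (rule attracting_subsequence[OF \<gamma>(1), of "\<lambda>n x. h n \<otimes> x" "\<lambda>n x. inv (h n) \<otimes> x" T])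
    show "h n \<otimes> (inv (h n) \<otimes> x) = x" if "x \<in> H" for n x
      using hH[of n] that H_closed by (simp flip: m_assoc)
  qed (use hH H_closed d_left_mult ht t(1) T in auto)
  have "eventually (\<lambda>n. act (h (r n)) \<xi> \<in> U) sequentially" if \<xi>: "\<xi> \<in> bdry" "\<xi> \<noteq> b" for \<xi>
  proof -
    obtain \<eta> where \<eta>: "\<eta> \<in> geodesic_rays H d" "\<xi> = limit_class \<eta>" using bdry_quasi_ray \<xi>(1) by metis
    then show ?thesis using attr[OF U(1) \<gamma>(2) \<eta>(1)] act_left_mult[OF hH \<eta>(1)] \<xi>(2) by simp
  qed
  then show ?thesis using that[of "\<lambda>n. h (r n)" b] hL b unfolding L_def by blast
qed

lemma act_eq_imp_eq:
  assumes "g \<in> carrier G" "\<xi> \<in> bdry" "\<eta> \<in> bdry" "act g \<xi> = act g \<eta>"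
  shows "\<xi> = \<eta>"
  using act_inv(1) assms by metis

text \<open>The element \<open>inv h \<otimes> (g \<otimes> h \<otimes> inv g)\<close> lies in
  \<open>H\<close> even if \<open>g\<close> does not, so freeness of \<open>H\<close> applies to it.
  The lemma serves twice: with the given open set for the attracting elements, and with the whole
  boundary at the end, where every element returns.\<close>

lemma commute_if_returns:
  assumes free: "\<And>h U. h \<in> H \<Longrightarrow> openin (boundary_topology H d) U \<Longrightarrow> U \<noteq> {} \<Longrightarrow>
      \<forall>\<xi>\<in>U. act h \<xi> = \<xi> \<Longrightarrow> h = \<one>"
    and g: "g \<in> carrier G" and U: "openin (boundary_topology H d) U" and fix_U: "\<And>\<xi>. \<xi> \<in> U \<Longrightarrow> act g \<xi> = \<xi>"
    and h: "h \<in> H" "g \<otimes> h \<otimes> inv g \<in> H" and \<xi>: "\<xi> \<in> U" "act h \<xi> \<in> U"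
  shows "g \<otimes> h = h \<otimes> g"
proof -
  have hG: "h \<in> carrier G" using h(1) H_closed by blast
  have Ub: "U \<subseteq> bdry" using U openin_subset topspace_boundary_topology by metis
  \<comment> \<open>On the points of \<open>U\<close> that \<open>h\<close> keeps in
    \<open>U\<close>, \<open>g\<close> acts trivially both before and after \<open>h\<close>, so
    \<open>h\<close> and its conjugate by \<open>g\<close> agree there.\<close>
  define V where "V = U \<inter> {\<eta> \<in> bdry. act h \<eta> \<in> U}"
  define k where "k = inv h \<otimes> (g \<otimes> h \<otimes> inv g)"
  have "openin (boundary_topology H d) {\<eta> \<in> bdry. act h \<eta> \<in> U}"
    using continuous_map_act[OF hG] U unfolding continuous_map_def topspace_boundary_topology by blast
  then have "openin (boundary_topology H d) V" unfolding V_def using U by (rule openin_Int[rotated])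
  moreover have "V \<noteq> {}" using \<xi> Ub by (auto simp: V_def)
  moreover have "act k \<eta> = \<eta>" if "\<eta> \<in> V" for \<eta>
  proof -
    have \<eta>: "\<eta> \<in> U" "act h \<eta> \<in> U" "\<eta> \<in> bdry" using that by (auto simp: V_def)
    have "act (inv g) \<eta> = \<eta>" using act_inv(1)[OF g \<eta>(3)] fix_U[OF \<eta>(1)] by simp
    then have "act (g \<otimes> h \<otimes> inv g) \<eta> = act h \<eta>"
      using act_mult g hG \<eta> fix_U[OF \<eta>(2)] by simp
    then show ?thesis using act_mult[of "inv h" "g \<otimes> h \<otimes> inv g" \<eta>] act_inv(1)[OF hG \<eta>(3)] g hG \<eta>(3)
      by (simp add: k_def)
  qed
  moreover have "k \<in> H" using h H_closed by (simp add: k_def)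
  ultimately have "k = \<one>" using free by blast
  then have "g \<otimes> h \<otimes> inv g = h" using g hG unfolding k_def
    by (metis inv_closed inv_solve_left m_closed r_one)
  then show ?thesis using g hG by (metis inv_solve_right m_closed)
qed

lemma conjugate_back:
  assumes g: "g \<in> carrier G" and h: "h \<in> inv g <# H #> g"
  shows "g \<otimes> h \<otimes> inv g \<in> H"
proof -
  obtain x where x: "x \<in> H" "h = inv g \<otimes> x \<otimes> g"
    using conjugate_memE[of "inv g" h] g h by auto
  have "g \<otimes> h \<otimes> inv g = x"
    unfolding x(2) using H_closed(1)[OF x(1)] g by (simp add: m_assoc mult_inv_cancel)
  then show ?thesis using x(1) by simp
qed

lemma topologically_free_act:
  assumes infinite: "infinite H"
    and free: "topologically_free K (boundary_topology H d) (boundary_action K S)"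
    and centr: "\<And>s. s \<in> carrier G - {\<one>} \<Longrightarrow> s \<notin> centralizer G (H \<inter> (inv s <# H #> s))"
  shows "topologically_free G (boundary_topology H d) act"
  unfolding topologically_free_def topspace_boundary_topology
proof (intro ballI)
  let ?X = "boundary_topology H d"
  have free': "h = \<one>" if h: "h \<in> H" and U: "openin ?X U" "U \<noteq> {}" "\<forall>\<xi>\<in>U. act h \<xi> = \<xi>" for h U
  proof (rule ccontr)
    assume "h \<noteq> \<one>"
    then have empty: "?X interior_of (invariants bdry (boundary_action K S) h) = {}"
      using free h by (simp add: topologically_free_def topspace_boundary_topology)
    have "U \<subseteq> bdry" using U openin_subset topspace_boundary_topology by metis
    then have "U \<subseteq> invariants bdry (boundary_action K S) h"
      using U(3) boundary_action_eq_act[OF h] by (auto simp: invariants_def)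
    then show False using interior_of_maximal[OF _ U(1)] empty U(2) by blast
  qed
  fix g assume g: "g \<in> carrier G - {\<one>}"
  then have gG: "g \<in> carrier G" by blast
  define U where "U = ?X interior_of (invariants bdry act g)"
  have U: "openin ?X U" "U \<subseteq> invariants bdry act g"
    unfolding U_def by (rule openin_interior_of interior_of_subset)+
  have fix_U: "act g \<xi> = \<xi>" "\<xi> \<in> bdry" if "\<xi> \<in> U" for \<xi>
    using that U(2) by (auto simp: invariants_def)
  show "U = {}"
  proof (rule ccontr)
    assume "U \<noteq> {}"
    \<comment> \<open>Applied to \<open>inv g\<close>, so that the \<open>h n\<close> lie in the
      subgroup that conjugation by \<open>g\<close> carries into \<open>H\<close>.\<close>
    obtain h b where h: "\<And>n::nat. h n \<in> H \<inter> (inv g <# H #> inv (inv g))" and b: "b \<in> bdry"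
      and attr: "\<And>\<xi>. \<xi> \<in> bdry \<Longrightarrow> \<xi> \<noteq> b \<Longrightarrow> eventually (\<lambda>n. act (h n) \<xi> \<in> U) sequentially"
      using attracting_sequence[OF _ U(1) \<open>U \<noteq> {}\<close>, of "inv g"] gG by blast
    have hn: "h n \<in> H" "h n \<in> carrier G" "g \<otimes> h n \<otimes> inv g \<in> H" for n
      using h[of n] conjugate_back[OF gG] H_closed gG by auto
    \<comment> \<open>A point of \<open>U\<close> other than \<open>b\<close> is needed, since only
      such a point is known to be attracted back into \<open>U\<close>.\<close>
    have "U \<noteq> {b}"
    proof
      assume Ub: "U = {b}"
      \<comment> \<open>Some \<open>h n\<close> sends both points to \<open>b\<close>, the only
        point of \<open>U\<close>, and it acts injectively.\<close>
      have "\<xi> = \<eta>" if "\<xi> \<in> bdry" "\<xi> \<noteq> b" "\<eta> \<in> bdry" "\<eta> \<noteq> b" for \<xi> \<eta>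
      proof -
        have "eventually (\<lambda>n. act (h n) \<xi> = b \<and> act (h n) \<eta> = b) sequentially"
          using eventually_conj[OF attr[OF that(1,2)] attr[OF that(3,4)]] Ub by simp
        then obtain n where "act (h n) \<xi> = b \<and> act (h n) \<eta> = b"
          using eventually_happens'[OF sequentially_bot] by blast
        then have "act (h n) \<xi> = act (h n) \<eta>" by simp
        then show ?thesis using act_eq_imp_eq hn(2) that by blast
      qed
      then have two: "\<xi> = \<eta>" if "\<xi> \<in> bdry - {b}" "\<eta> \<in> bdry - {b}" for \<xi> \<eta> using that by simp
      have "finite (bdry - {b})"
      proof (cases "bdry - {b} = {}")
        case True
        then show ?thesis by (simp only: finite.emptyI)
      next
        case False
        then obtain c where "c \<in> bdry - {b}" by blast
        then have "bdry - {b} \<subseteq> {c}" using two by auto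
        then show ?thesis by (rule finite_subset) simp
      qed
      then have "finite bdry" by simp
      \<comment> \<open>Here \<open>{b}\<close> is open, so an element of \<open>H\<close> that
        fixes \<open>b\<close> is trivial by freeness; the infinite set \<open>H\<close> would then
        embed into a finite boundary.\<close>
      moreover have "inj_on (\<lambda>x. act x b) H"
      proof (rule inj_onI)
        fix x y assume xy: "x \<in> H" "y \<in> H" "act x b = act y b"
        have xyG: "x \<in> carrier G" "y \<in> carrier G" using xy H_closed by auto
        have "act (inv x \<otimes> y) b = b" using act_mult[of "inv x" y b] act_inv(1)[of x b] xyG xy b by simp
        then have "inv x \<otimes> y = \<one>" using free'[OF _ U(1)] Ub xy H_closed by simp
        then show "x = y" using xyG by (metis inv_closed inv_equality inv_inv)
      qed
      moreover have "(\<lambda>x. act x b) ` H \<subseteq> bdry" using act_closed b H_closed by auto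
      ultimately show False using infinite by (meson finite_imageD finite_subset)
    qed
    then obtain \<xi> where \<xi>: "\<xi> \<in> U" "\<xi> \<noteq> b" using \<open>U \<noteq> {}\<close> by blast
    have comm: "eventually (\<lambda>n. g \<otimes> h n = h n \<otimes> g) sequentially"
      using attr[OF fix_U(2)[OF \<xi>(1)] \<xi>(2)]
    proof eventually_elim
      case (elim n)
      show ?case by (rule commute_if_returns[OF free' gG U(1) fix_U(1) hn(1,3) \<xi>(1) elim])
    qed
    have off_b: "act g \<zeta> = \<zeta>" if \<zeta>: "\<zeta> \<in> bdry" "\<zeta> \<noteq> b" for \<zeta>
    proof -
      have "eventually (\<lambda>n. g \<otimes> h n = h n \<otimes> g \<and> act (h n) \<zeta> \<in> U) sequentially"
        using comm attr[OF \<zeta>] by (rule eventually_conj)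
      then obtain n where n: "g \<otimes> h n = h n \<otimes> g" "act (h n) \<zeta> \<in> U"
        using eventually_happens'[OF sequentially_bot] by blast
      \<comment> \<open>Commuting lets \<open>g\<close> act after \<open>h n\<close>, on a point of
        \<open>U\<close>, where it does nothing; injectivity of the action of \<open>h n\<close>
        then cancels it.\<close>
      have "act (h n) (act g \<zeta>) = act (h n) \<zeta>"
        using act_mult[OF gG hn(2) \<zeta>(1), of n] act_mult[OF hn(2) gG \<zeta>(1), of n] n fix_U(1) by simp
      then show ?thesis using act_eq_imp_eq[OF hn(2)] act_closed[OF gG] \<zeta>(1) by blast
    qed
    \<comment> \<open>If \<open>g\<close> moved \<open>b\<close>, the image of \<open>b\<close>
      would be a point other than \<open>b\<close>, hence fixed by \<open>g\<close>, and injectivity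
      would make \<open>b\<close> fixed as well.\<close>
    have all: "act g \<zeta> = \<zeta>" if "\<zeta> \<in> bdry" for \<zeta>
      using off_b[of \<zeta>] off_b[of "act g b"] act_eq_imp_eq[OF gG act_closed[OF gG b] b] act_closed[OF gG b] that
      by (cases "\<zeta> = b") auto
    have top: "openin ?X bdry" using openin_topspace topspace_boundary_topology by metis
    have "g \<otimes> x = x \<otimes> g" if x: "x \<in> H \<inter> (inv g <# H #> g)" for x
    proof (rule commute_if_returns[OF free' gG top all _ _ b])
      show "x \<in> H" "g \<otimes> x \<otimes> inv g \<in> H" using x conjugate_back[OF gG] by auto
      then show "act x b \<in> bdry" using act_closed b H_closed(1) by blast
    qed
    then have "g \<in> centralizer G (H \<inter> (inv g <# H #> g))" using gG by (simp add: centralizer_def)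
    then show False using centr g by blast
  qed
qed

end

theorem theorem1p1:
  fixes G :: "('a, 'b) monoid_scheme" (structure) and H S :: "'a set"
  assumes "group G" and "countable (carrier G)" and "subgroup H G"
    and "hyperbolic_group (G\<lparr>carrier := H\<rparr>)" and "non_elementary (G\<lparr>carrier := H\<rparr>)"
    and "\<forall>g\<in>carrier G. finite_index (G\<lparr>carrier := H\<rparr>) (H \<inter> (g <# H #> inv g))"
    and "finite_generating_set (G\<lparr>carrier := H\<rparr>) S"
    and "topologically_free (G\<lparr>carrier := H\<rparr>) (group_boundary (G\<lparr>carrier := H\<rparr>) S)
           (boundary_action (G\<lparr>carrier := H\<rparr>) S)"
    and "\<forall>s\<in>carrier G - {\<one>}. s \<notin> centralizer G (H \<inter> (inv s <# H #> s))"
  shows "\<exists>\<alpha>. homeo_action G (group_boundary (G\<lparr>carrier := H\<rparr>) S) \<alpha> \<and>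
           topologically_free G (group_boundary (G\<lparr>carrier := H\<rparr>) S) \<alpha> \<and>
           (\<forall>h\<in>H. \<forall>\<xi>\<in>topspace (group_boundary (G\<lparr>carrier := H\<rparr>) S).
              \<alpha> h \<xi> = boundary_action (G\<lparr>carrier := H\<rparr>) S h \<xi>)"
proof -
  interpret commensurated_hyperbolic_subgroup G H S
    using assms unfolding commensurated_hyperbolic_subgroup_def
      commensurated_hyperbolic_subgroup_axioms_def by blast
  have "infinite H" using assms(5) by (simp add: non_elementary_def)
  then have "topologically_free G (boundary_topology H d) act"
    using topologically_free_act assms(8,9) by simp
  then show ?thesis
    using homeo_action_act boundary_action_eq_act
    by (intro exI[of _ act]) (simp add: topspace_boundary_topology)
qed

end
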